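(* Let $f\in\mathcal{A}_d$ with $\|f\|_\infty<\|f\|_{\mathcal{A}_d}=1$. The set \[ \mathcal{F}=\{\Psi\in\mathcal{M}_{d*}:\|\Psi\|_{\mathcal{A}_d^*}=1=\Psi(f)\} \] has extreme points, and the extreme points of $\mathcal{F}$ are also extreme points of the closed unit ball of $\mathcal{M}_{d*}$.
   Context: Let $d\ge1$ be an integer and $\mathbb{B}_d$ the open unit ball of $\mathbb{C}^d$. The Drury-Arveson space $H^2_d$ is the reproducing kernel Hilbert space of analytic functions on $\mathbb{B}_d$ with kernel $k(w,z)=1/(1-\langle w,z\rangle)$. Its multiplier algebra $\mathcal{M}_d$ consists of all analytic functions $f$ on $\mathbb{B}_d$ with $fH^2_d\subset H^2_d$; $f$ is identified with the multiplication operator $M_f\in B(H^2_d)$ and $\|f\|_{\mathcal{M}_d}=\|M_f\|$. $\mathcal{M}_d$ is WOT-closed, with predual $\mathcal{M}_{d*}=B(H^2_d)_*/(\mathcal{M}_d)_\perp$ (the weak-$*$ continuous functionals on $\mathcal{M}_d$). $\mathcal{A}_d$ is the norm closure of the polynomials in $\mathcal{M}_d$, with $\|f\|_{\mathcal{A}_d}=\|f\|_{\mathcal{M}_d}$, and $\|f\|_\infty=\sup_{z\in\mathbb{B}_d}|f(z)|$. $\mathcal{M}_{d*}$ is regarded (isometrically) as a subspace of $\mathcal{A}_d^*$ by restricting functionals to $\mathcal{A}_d$. *)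

theory Defs
  imports "HOL-Analysis.Analysis" "HOL-Library.Function_Algebras"
begin

text \<open>
  Pointwise real scalar multiplication of functions, so that the library's
  \<^const>\<open>extreme_point_of\<close> applies to sets of complex-valued functionals.
\<close>

instantiation "fun" :: (type, real_vector) real_vector
begin

definition scaleR_fun :: "real \<Rightarrow> ('a \<Rightarrow> 'b) \<Rightarrow> 'a \<Rightarrow> 'b" where
  "scaleR_fun r f = (\<lambda>x. r *\<^sub>R f x)"

instance
  by standard (auto simp: scaleR_fun_def fun_eq_iff scaleR_add_right scaleR_add_left)

end

lemma scaleR_fun_apply [simp]: "(r *\<^sub>R f) x = r *\<^sub>R f x"
  by (simp add: scaleR_fun_def)


subsection \<open>Reproducing kernel Hilbert spaces\<close>

text \<open>
  A function on a set \<open>X\<close> is represented by its extension by zero.  An inner product is a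
  binary function \<open>ip\<close>, linear in the first argument, of which only the values on \<open>H\<close> matter.
\<close>

definition ip_norm :: "(('a \<Rightarrow> complex) \<Rightarrow> ('a \<Rightarrow> complex) \<Rightarrow> complex) \<Rightarrow> ('a \<Rightarrow> complex) \<Rightarrow> real" where
  "ip_norm ip h = sqrt (Re (ip h h))"

locale function_hilbert_space =
  fixes X :: "'a set"
    and H :: "('a \<Rightarrow> complex) set"
    and ip :: "('a \<Rightarrow> complex) \<Rightarrow> ('a \<Rightarrow> complex) \<Rightarrow> complex"
  assumes outside: "\<And>g x. g \<in> H \<Longrightarrow> x \<notin> X \<Longrightarrow> g x = 0"
    and zero_mem: "(\<lambda>x. 0) \<in> H"
    and add_mem: "\<And>g h. g \<in> H \<Longrightarrow> h \<in> H \<Longrightarrow> (\<lambda>x. g x + h x) \<in> H"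
    and scale_mem: "\<And>c g. g \<in> H \<Longrightarrow> (\<lambda>x. c * g x) \<in> H"
    and ip_add: "\<And>g h l. g \<in> H \<Longrightarrow> h \<in> H \<Longrightarrow> l \<in> H \<Longrightarrow>
                   ip (\<lambda>x. g x + h x) l = ip g l + ip h l"
    and ip_scale: "\<And>c g l. g \<in> H \<Longrightarrow> l \<in> H \<Longrightarrow> ip (\<lambda>x. c * g x) l = c * ip g l"
    and ip_cnj: "\<And>g h. g \<in> H \<Longrightarrow> h \<in> H \<Longrightarrow> ip h g = cnj (ip g h)"
    and ip_pos: "\<And>g. g \<in> H \<Longrightarrow> g \<noteq> (\<lambda>x. 0) \<Longrightarrow> Re (ip g g) > 0"
    and complete: "\<And>u :: nat \<Rightarrow> 'a \<Rightarrow> complex.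
           (\<And>n. u n \<in> H) \<Longrightarrow>
           (\<And>e. e > 0 \<Longrightarrow> \<exists>N. \<forall>m\<ge>N. \<forall>n\<ge>N. ip_norm ip (u m - u n) < e) \<Longrightarrow>
           \<exists>g\<in>H. (\<lambda>n. ip_norm ip (u n - g)) \<longlonglongrightarrow> 0"

locale rkhs = function_hilbert_space X H ip
  for X :: "'a set" and H ip +
  fixes K :: "'a \<Rightarrow> 'a \<Rightarrow> complex"
  assumes kernel_mem: "\<And>z. z \<in> X \<Longrightarrow> (\<lambda>w. if w \<in> X then K w z else 0) \<in> H"
    and reproducing: "\<And>g z. g \<in> H \<Longrightarrow> z \<in> X \<Longrightarrow> g z = ip g (\<lambda>w. if w \<in> X then K w z else 0)"


subsection \<open>The Drury-Arveson space\<close>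

text \<open>Dimension \<open>d\<close> is \<open>CARD('n)\<close>; the norm of \<^typ>\<open>complex ^ 'n\<close> is the Euclidean one.\<close>

abbreviation cball_d :: "(complex ^ 'n) set" (\<open>\<bool>\<^sub>d\<close>) where
  "\<bool>\<^sub>d \<equiv> ball 0 1"

definition herm :: "complex ^ 'n \<Rightarrow> complex ^ 'n \<Rightarrow> complex" where
  "herm w z = (\<Sum>i\<in>UNIV. w $ i * cnj (z $ i))"

text \<open>Analytic means Frechet differentiable with complex-linear derivative at every point.\<close>

definition analytic_in :: "(complex ^ 'n \<Rightarrow> complex) \<Rightarrow> (complex ^ 'n) set \<Rightarrow> bool" where
  "analytic_in g U \<longleftrightarrow>
     (\<forall>z\<in>U. \<exists>D. (g has_derivative D) (at z) \<and> (\<forall>c v. D (c *s v) = c * D v))"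

text \<open>
  \<open>drury_arveson H ip\<close>: the pair \<open>(H, ip)\<close> is the space \<open>H\<^sup>2\<^sub>d\<close>.  By the Moore-Aronszajn theorem there
  is exactly one such \<open>H\<close>, and \<open>ip\<close> is determined on it.
\<close>

definition drury_arveson ::
    "(complex ^ 'n \<Rightarrow> complex) set \<Rightarrow>
     ((complex ^ 'n \<Rightarrow> complex) \<Rightarrow> (complex ^ 'n \<Rightarrow> complex) \<Rightarrow> complex) \<Rightarrow> bool" where
  "drury_arveson H ip \<longleftrightarrow>
     rkhs \<bool>\<^sub>d H ip (\<lambda>w z. 1 / (1 - herm w z)) \<and> (\<forall>g\<in>H. analytic_in g \<bool>\<^sub>d)"


subsection \<open>Bounded operators and the predual of \<open>B(H)\<close>\<close>

definition op_norm ::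
    "('a \<Rightarrow> complex) set \<Rightarrow> (('a \<Rightarrow> complex) \<Rightarrow> ('a \<Rightarrow> complex) \<Rightarrow> complex) \<Rightarrow>
     (('a \<Rightarrow> complex) \<Rightarrow> 'a \<Rightarrow> complex) \<Rightarrow> real" where
  "op_norm H ip T = Sup {ip_norm ip (T h) | h. h \<in> H \<and> ip_norm ip h \<le> 1}"

text \<open>Operators on \<open>H\<close> are normalised to vanish outside \<open>H\<close>, so that equality is equality on \<open>H\<close>.\<close>

definition bounded_ops ::
    "('a \<Rightarrow> complex) set \<Rightarrow> (('a \<Rightarrow> complex) \<Rightarrow> ('a \<Rightarrow> complex) \<Rightarrow> complex) \<Rightarrow>
     (('a \<Rightarrow> complex) \<Rightarrow> 'a \<Rightarrow> complex) set" where
  "bounded_ops H ip =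
     {T. (\<forall>h\<in>H. T h \<in> H) \<and> (\<forall>h. h \<notin> H \<longrightarrow> T h = 0) \<and>
         (\<forall>g\<in>H. \<forall>h\<in>H. T (\<lambda>x. g x + h x) = (\<lambda>x. T g x + T h x)) \<and>
         (\<forall>c. \<forall>h\<in>H. T (\<lambda>x. c * h x) = (\<lambda>x. c * T h x)) \<and>
         (\<exists>C. \<forall>h\<in>H. ip_norm ip (T h) \<le> C * ip_norm ip h)}"

text \<open>The norm of a functional on the space \<open>V\<close> with norm \<open>N\<close>.\<close>

definition functional_norm :: "('v \<Rightarrow> real) \<Rightarrow> 'v set \<Rightarrow> ('v \<Rightarrow> complex) \<Rightarrow> real" where
  "functional_norm N V \<phi> = Sup {cmod (\<phi> v) | v. v \<in> V \<and> N v \<le> 1}"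

text \<open>
  \<open>B(H)\<^sub>*\<close>: the functionals \<open>T \<mapsto> tr (T S)\<close> with \<open>S = \<Sum>\<^sub>n x\<^sub>n \<otimes> y\<^sub>n\<^sup>*\<close> of trace class, where
  \<open>(x\<^sub>n)\<close> and \<open>(y\<^sub>n)\<close> are square-summable; these are the ultraweakly (weak-*) continuous ones.
\<close>

definition B_predual ::
    "('a \<Rightarrow> complex) set \<Rightarrow> (('a \<Rightarrow> complex) \<Rightarrow> ('a \<Rightarrow> complex) \<Rightarrow> complex) \<Rightarrow>
     ((('a \<Rightarrow> complex) \<Rightarrow> 'a \<Rightarrow> complex) \<Rightarrow> complex) set" where
  "B_predual H ip =
     {\<phi>. \<exists>x y :: nat \<Rightarrow> 'a \<Rightarrow> complex. range x \<subseteq> H \<and> range y \<subseteq> H \<and>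
          summable (\<lambda>n. (ip_norm ip (x n))\<^sup>2) \<and> summable (\<lambda>n. (ip_norm ip (y n))\<^sup>2) \<and>
          \<phi> = (\<lambda>T. if T \<in> bounded_ops H ip then \<Sum>n. ip (T (x n)) (y n) else 0)}"


subsection \<open>Multipliers, the algebra \<open>A\<^sub>d\<close>, and the predual of \<open>M\<^sub>d\<close>\<close>

definition multipliers :: "(complex ^ 'n \<Rightarrow> complex) set \<Rightarrow> (complex ^ 'n \<Rightarrow> complex) set" where
  "multipliers H =
     {g. analytic_in g \<bool>\<^sub>d \<and> (\<forall>z. z \<notin> \<bool>\<^sub>d \<longrightarrow> g z = 0) \<and> (\<forall>h\<in>H. (\<lambda>z. g z * h z) \<in> H)}"

definition mult_op ::
    "('a \<Rightarrow> complex) set \<Rightarrow> ('a \<Rightarrow> complex) \<Rightarrow> ('a \<Rightarrow> complex) \<Rightarrow> 'a \<Rightarrow> complex" where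
  "mult_op H g = (\<lambda>h. if h \<in> H then (\<lambda>z. g z * h z) else 0)"

definition mult_norm ::
    "('a \<Rightarrow> complex) set \<Rightarrow> (('a \<Rightarrow> complex) \<Rightarrow> ('a \<Rightarrow> complex) \<Rightarrow> complex) \<Rightarrow>
     ('a \<Rightarrow> complex) \<Rightarrow> real" where
  "mult_norm H ip g = op_norm H ip (mult_op H g)"

definition sup_norm :: "(complex ^ 'n \<Rightarrow> complex) \<Rightarrow> real" where
  "sup_norm g = (SUP z\<in>\<bool>\<^sub>d. cmod (g z))"

definition ball_polynomials :: "(complex ^ 'n \<Rightarrow> complex) set" where
  "ball_polynomials =
     {\<lambda>z. if z \<in> \<bool>\<^sub>d then \<Sum>\<alpha>\<in>A. c \<alpha> * (\<Prod>i\<in>UNIV. (z $ i) ^ \<alpha> i) else 0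
        | (A :: ('n \<Rightarrow> nat) set) c. finite A}"

definition A_d ::
    "(complex ^ 'n \<Rightarrow> complex) set \<Rightarrow>
     ((complex ^ 'n \<Rightarrow> complex) \<Rightarrow> (complex ^ 'n \<Rightarrow> complex) \<Rightarrow> complex) \<Rightarrow>
     (complex ^ 'n \<Rightarrow> complex) set" where
  "A_d H ip =
     {g \<in> multipliers H. \<forall>e>0. \<exists>p\<in>ball_polynomials. mult_norm H ip (g - p) < e}"

text \<open>
  The class of \<open>\<phi>\<close> in \<open>B(H)\<^sub>* / (M\<^sub>d)\<^sub>\<bottom>\<close>, viewed as the functional \<open>g \<mapsto> \<phi> (M\<^sub>g)\<close> on \<open>M\<^sub>d\<close>
  (extended by zero): two functionals have the same image iff they differ by an element of
  \<open>(M\<^sub>d)\<^sub>\<bottom>\<close>.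
\<close>

definition predual_class ::
    "(complex ^ 'n \<Rightarrow> complex) set \<Rightarrow>
     (((complex ^ 'n \<Rightarrow> complex) \<Rightarrow> complex ^ 'n \<Rightarrow> complex) \<Rightarrow> complex) \<Rightarrow>
     (complex ^ 'n \<Rightarrow> complex) \<Rightarrow> complex" where
  "predual_class H \<phi> = (\<lambda>g. if g \<in> multipliers H then \<phi> (mult_op H g) else 0)"

definition M_predual ::
    "(complex ^ 'n \<Rightarrow> complex) set \<Rightarrow>
     ((complex ^ 'n \<Rightarrow> complex) \<Rightarrow> (complex ^ 'n \<Rightarrow> complex) \<Rightarrow> complex) \<Rightarrow>
     ((complex ^ 'n \<Rightarrow> complex) \<Rightarrow> complex) set" where
  "M_predual H ip = predual_class H ` B_predual H ip"

text \<open>The quotient norm.\<close>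

definition M_predual_norm ::
    "(complex ^ 'n \<Rightarrow> complex) set \<Rightarrow>
     ((complex ^ 'n \<Rightarrow> complex) \<Rightarrow> (complex ^ 'n \<Rightarrow> complex) \<Rightarrow> complex) \<Rightarrow>
     ((complex ^ 'n \<Rightarrow> complex) \<Rightarrow> complex) \<Rightarrow> real" where
  "M_predual_norm H ip \<Psi> =
     Inf {functional_norm (op_norm H ip) (bounded_ops H ip) \<phi> | \<phi>.
            \<phi> \<in> B_predual H ip \<and> predual_class H \<phi> = \<Psi>}"

text \<open>The norm in \<open>A\<^sub>d\<^sup>*\<close> of the restriction of a functional to \<open>A\<^sub>d\<close>.\<close>

definition A_dual_norm ::
    "(complex ^ 'n \<Rightarrow> complex) set \<Rightarrow>
     ((complex ^ 'n \<Rightarrow> complex) \<Rightarrow> (complex ^ 'n \<Rightarrow> complex) \<Rightarrow> complex) \<Rightarrow>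
     ((complex ^ 'n \<Rightarrow> complex) \<Rightarrow> complex) \<Rightarrow> real" where
  "A_dual_norm H ip \<Psi> = functional_norm (mult_norm H ip) (A_d H ip) \<Psi>"

end

theory Submission
  imports Defs "HOL-Real_Asymp.Real_Asymp"
begin

text \<open>
  Let \<open>T\<close> be multiplication by \<open>f\<close>.  On functions of high degree the Drury-Arveson norm is close to a
  Hardy norm, so polynomial multipliers have essential norm at most their sup norm.  Since
  \<open>\<parallel>f\<parallel>\<^sub>\<infinity> < \<parallel>T\<parallel> = 1\<close>, every sequence \<open>h\<^sub>n\<close> in the unit ball with \<open>\<parallel>T h\<^sub>n\<parallel> \<longlonglongrightarrow> 1\<close> has a norm convergent
  subsequence, and \<open>T\<close> is isometric exactly on a nonzero finite-dimensional space \<open>E\<close>.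

  If \<open>\<psi>\<close> is a functional of norm 1 on \<open>A\<^sub>d\<close> with \<open>\<psi>(f) = 1\<close>, differentiating \<open>\<parallel>f + \<epsilon> g\<parallel> \<ge> |1 + \<epsilon> \<psi>(g)|\<close>
  at \<open>\<epsilon> = 0\<close> shows \<open>Re \<psi>(g) \<le> Re \<langle>g h, f h\<rangle>\<close> for some unit vector \<open>h \<in> E\<close>.  By convexity, \<open>\<psi>\<close> is given
  on \<open>A\<^sub>d\<close> by a finite-rank functional \<open>A \<mapsto> \<Sum> c\<^sub>i\<^sub>j \<langle>A e\<^sub>i, f e\<^sub>j\<rangle>\<close> of norm at most 1 on \<open>B(H)\<close>, where \<open>(e\<^sub>i)\<close> is
  an orthonormal basis of \<open>E\<close>.  Fejer means show that an element of the predual is determined by its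
  values on polynomials.  Thus \<open>\<F>\<close> is the image of a compact set of matrices, hence has extreme points,
  and it is a face of the unit ball of the predual.
\<close>

section \<open>Hilbert spaces of functions\<close>

text \<open>The unit ball of the predual carries no evident compact topology, so the theorem of
  Krein and Milman has nothing to act on. Finite dimension of \<open>E\<close> is what turns the
  norming functionals into finitely many complex parameters. The dual norm of A_d is at most the
  quotient norm. The reverse estimate is obtained on the face, where the finite-rank representative
  has norm at most 1 on B(H) and therefore bounds the quotient norm. The space is given by its
  kernel, not by a basis. The monomials are produced as norm limits of averages of kernel functions
  over discrete tori, and their norms come out of the same computation. The Hardy norm is likewise a
  limit of finite sums: grids on tori inside the open ball, whose squared radii run through a
  discretised simplex. The comparison with the Hardy space works because the dimensions of the
  spaces of homogeneous polynomials of degrees n + k and n have a quotient tending to 1. It concerns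
  polynomials; membership of \<open>f\<close> in A_d transfers it to \<open>f\<close>.\<close>

definition smul :: "complex \<Rightarrow> ('a \<Rightarrow> complex) \<Rightarrow> 'a \<Rightarrow> complex" (infixr \<open>\<odot>\<close> 75) where
  "c \<odot> g = (\<lambda>x. c * g x)"

lemma smul_apply [simp]: "(c \<odot> g) x = c * g x"
  by (simp add: smul_def)

lemma sum_fun_apply: "(sum f A) x = (\<Sum>i\<in>A. f i x)"
  by (induction A rule: infinite_finite_induct) auto

lemma smul_one [simp]: "1 \<odot> g = g"
  by (simp add: fun_eq_iff)

lemma smul_zero [simp]: "0 \<odot> g = 0" "c \<odot> 0 = 0"
  by (simp_all add: fun_eq_iff)

lemma smul_smul [simp]: "a \<odot> b \<odot> g = (a * b) \<odot> g"
  by (simp add: fun_eq_iff)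

lemma smul_distrib: "c \<odot> (g + h) = c \<odot> g + c \<odot> h" "c \<odot> (g - h) = c \<odot> g - c \<odot> h"
    "(a + b) \<odot> g = a \<odot> g + b \<odot> g" "(a - b) \<odot> g = a \<odot> g - b \<odot> g"
  by (simp_all add: fun_eq_iff algebra_simps)

lemma smul_sum: "c \<odot> sum f A = (\<Sum>i\<in>A. c \<odot> f i)"
  by (simp add: fun_eq_iff sum_fun_apply sum_distrib_left)

lemma mult_smul [simp]: "g * (c \<odot> h) = c \<odot> (g * h)" "(c \<odot> g) * h = c \<odot> (g * h)"
  for g h :: "'a \<Rightarrow> complex"
  by (simp_all add: fun_eq_iff)

lemma uminus_eq_smul: "- g = (-1) \<odot> g"
  by (simp add: fun_eq_iff)

context function_hilbert_space
begin

abbreviation nm :: "('a \<Rightarrow> complex) \<Rightarrow> real" where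
  "nm \<equiv> ip_norm ip"

lemma zero_in [simp]: "0 \<in> H"
  using zero_mem by (simp add: zero_fun_def)

lemma add_in [intro, simp]: "g \<in> H \<Longrightarrow> h \<in> H \<Longrightarrow> g + h \<in> H"
  using add_mem by (simp add: plus_fun_def)

lemma smul_in [intro, simp]: "g \<in> H \<Longrightarrow> c \<odot> g \<in> H"
  using scale_mem by (simp add: smul_def)

lemma uminus_in [intro, simp]: "g \<in> H \<Longrightarrow> - g \<in> H"
  by (simp add: uminus_eq_smul)

lemma diff_in [intro, simp]: "g \<in> H \<Longrightarrow> h \<in> H \<Longrightarrow> g - h \<in> H"
  using add_in[of g "- h"] by simp

lemma sum_in [intro]: "(\<And>i. i \<in> A \<Longrightarrow> f i \<in> H) \<Longrightarrow> sum f A \<in> H"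
  by (induction A rule: infinite_finite_induct) auto

lemma ip_add_left: "g \<in> H \<Longrightarrow> h \<in> H \<Longrightarrow> l \<in> H \<Longrightarrow> ip (g + h) l = ip g l + ip h l"
  using ip_add by (simp add: plus_fun_def)

lemma ip_smul_left: "g \<in> H \<Longrightarrow> l \<in> H \<Longrightarrow> ip (c \<odot> g) l = c * ip g l"
  using ip_scale by (simp add: smul_def)

lemma ip_add_right: "g \<in> H \<Longrightarrow> h \<in> H \<Longrightarrow> l \<in> H \<Longrightarrow> ip l (g + h) = ip l g + ip l h"
  by (metis add_in complex_cnj_add ip_cnj ip_add_left)

lemma ip_smul_right: "g \<in> H \<Longrightarrow> l \<in> H \<Longrightarrow> ip l (c \<odot> g) = cnj c * ip l g"
  by (metis smul_in complex_cnj_mult ip_cnj ip_smul_left)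

lemma ip_zero_left [simp]: "l \<in> H \<Longrightarrow> ip 0 l = 0"
  using ip_smul_left[of 0 l 0] by simp

lemma ip_zero_right [simp]: "l \<in> H \<Longrightarrow> ip l 0 = 0"
  using ip_smul_right[of 0 l 0] by simp

lemma ip_uminus_left: "g \<in> H \<Longrightarrow> l \<in> H \<Longrightarrow> ip (- g) l = - ip g l"
  by (simp add: uminus_eq_smul ip_smul_left)

lemma ip_uminus_right: "g \<in> H \<Longrightarrow> l \<in> H \<Longrightarrow> ip l (- g) = - ip l g"
  by (simp add: uminus_eq_smul ip_smul_right)

lemma ip_diff_left: "g \<in> H \<Longrightarrow> h \<in> H \<Longrightarrow> l \<in> H \<Longrightarrow> ip (g - h) l = ip g l - ip h l"
  using ip_add_left[of g "- h" l] by (simp add: ip_uminus_left)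

lemma ip_diff_right: "g \<in> H \<Longrightarrow> h \<in> H \<Longrightarrow> l \<in> H \<Longrightarrow> ip l (g - h) = ip l g - ip l h"
  using ip_add_right[of g "- h" l] by (simp add: ip_uminus_right)

lemma ip_sum_left: "(\<And>i. i \<in> A \<Longrightarrow> f i \<in> H) \<Longrightarrow> l \<in> H \<Longrightarrow> ip (sum f A) l = (\<Sum>i\<in>A. ip (f i) l)"
  by (induction A rule: infinite_finite_induct) (auto simp: ip_add_left sum_in)

lemma ip_sum_right: "(\<And>i. i \<in> A \<Longrightarrow> f i \<in> H) \<Longrightarrow> l \<in> H \<Longrightarrow> ip l (sum f A) = (\<Sum>i\<in>A. ip l (f i))"
  by (induction A rule: infinite_finite_induct) (auto simp: ip_add_right sum_in)

lemma ip_self_nonneg: "g \<in> H \<Longrightarrow> Re (ip g g) \<ge> 0"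
  using ip_pos[of g] ip_zero_left[of 0] by (cases "g = 0") (auto simp: zero_fun_def less_imp_le)

lemma nm_nonneg [simp]: "nm g \<ge> 0" if "g \<in> H"
  by (simp add: ip_norm_def ip_self_nonneg that)

lemma nm_sq: "g \<in> H \<Longrightarrow> (nm g)\<^sup>2 = Re (ip g g)"
  by (simp add: ip_norm_def ip_self_nonneg)

lemma ip_self: "g \<in> H \<Longrightarrow> ip g g = complex_of_real ((nm g)\<^sup>2)"
  using ip_cnj[of g g] by (simp add: nm_sq complex_eq_iff)

lemma nm_zero [simp]: "nm 0 = 0" "nm (\<lambda>_. 0) = 0"
  by (simp_all add: ip_norm_def flip: zero_fun_def)

lemma nm_eq_0: "g \<in> H \<Longrightarrow> nm g = 0 \<Longrightarrow> g = 0"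
  using ip_pos[of g] nm_sq[of g] by (cases "g = 0") (auto simp: zero_fun_def)

lemma nm_smul: "g \<in> H \<Longrightarrow> nm (c \<odot> g) = cmod c * nm g"
proof -
  assume g: "g \<in> H"
  have "(nm (c \<odot> g))\<^sup>2 = Re ((c * cnj c) * ip g g)"
    using g by (simp add: nm_sq ip_smul_left ip_smul_right algebra_simps)
  also have "\<dots> = (cmod c * nm g)\<^sup>2"
    using g by (simp add: ip_self complex_norm_square[symmetric] power_mult_distrib flip: of_real_power)
  finally show ?thesis using g by (intro power2_eq_imp_eq[of "nm (c \<odot> g)"]) auto
qed

lemma nm_uminus [simp]: "g \<in> H \<Longrightarrow> nm (- g) = nm g"
  by (simp add: uminus_eq_smul nm_smul)

lemma nm_minus_commute: "g \<in> H \<Longrightarrow> h \<in> H \<Longrightarrow> nm (g - h) = nm (h - g)"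
  using nm_uminus[of "g - h"] by simp

lemma nm_add_sq: "g \<in> H \<Longrightarrow> h \<in> H \<Longrightarrow> (nm (g + h))\<^sup>2 = (nm g)\<^sup>2 + 2 * Re (ip g h) + (nm h)\<^sup>2"
  using ip_cnj[of g h] by (simp add: nm_sq ip_add_left ip_add_right)

lemma nm_diff_sq: "g \<in> H \<Longrightarrow> h \<in> H \<Longrightarrow> (nm (g - h))\<^sup>2 = (nm g)\<^sup>2 - 2 * Re (ip g h) + (nm h)\<^sup>2"
  using nm_add_sq[of g "- h"] by (simp add: ip_uminus_right)

lemma parallelogram:
  "g \<in> H \<Longrightarrow> h \<in> H \<Longrightarrow> (nm (g + h))\<^sup>2 + (nm (g - h))\<^sup>2 = 2 * (nm g)\<^sup>2 + 2 * (nm h)\<^sup>2"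
  by (simp add: nm_add_sq nm_diff_sq)

lemma Cauchy_Schwarz: "cmod (ip g h) \<le> nm g * nm h" if g: "g \<in> H" and h: "h \<in> H"
proof (cases "h = 0")
  case True
  then show ?thesis using g by simp
next
  case False
  then have n: "nm h > 0" using nm_eq_0[OF h] nm_nonneg[OF h] by fastforce
  define c where "c = ip g h / (nm h)\<^sup>2"
  have "Re (ip g (c \<odot> h)) = (cmod (ip g h))\<^sup>2 / (nm h)\<^sup>2"
    using g h by (simp add: ip_smul_right c_def mult.commute complex_mult_cnj flip: cmod_power2)
  moreover have "(nm (c \<odot> h))\<^sup>2 = (cmod (ip g h))\<^sup>2 / (nm h)\<^sup>2"
  proof -
    have "nm (c \<odot> h) = cmod (ip g h) / nm h"
      using n h by (simp add: nm_smul c_def norm_divide norm_mult power2_eq_square)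
    then show ?thesis by (simp add: power_divide)
  qed
  ultimately have "(nm (g - c \<odot> h))\<^sup>2 = (nm g)\<^sup>2 - (cmod (ip g h))\<^sup>2 / (nm h)\<^sup>2"
    using g h by (simp add: nm_diff_sq)
  then have "(cmod (ip g h))\<^sup>2 / (nm h)\<^sup>2 \<le> (nm g)\<^sup>2"
    using zero_le_power2[of "nm (g - c \<odot> h)"] by linarith
  then have "(cmod (ip g h))\<^sup>2 \<le> (nm g * nm h)\<^sup>2"
    using n by (simp add: field_simps power_mult_distrib)
  then show ?thesis using g h by (auto intro: power2_le_imp_le)
qed

lemma nm_triangle: "nm (g + h) \<le> nm g + nm h" if g: "g \<in> H" and h: "h \<in> H"
proof -
  have "Re (ip g h) \<le> nm g * nm h"
    using Cauchy_Schwarz[OF g h] complex_Re_le_cmod order_trans by blast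
  then have "(nm (g + h))\<^sup>2 \<le> (nm g + nm h)\<^sup>2"
    using g h by (simp add: nm_add_sq power2_sum)
  then show ?thesis using g h by (auto intro: power2_le_imp_le)
qed

lemma nm_triangle_diff: "g \<in> H \<Longrightarrow> h \<in> H \<Longrightarrow> nm (g - h) \<le> nm g + nm h"
  using nm_triangle[of g "- h"] by simp

lemma nm_dist_triangle: "g \<in> H \<Longrightarrow> h \<in> H \<Longrightarrow> l \<in> H \<Longrightarrow> nm (g - l) \<le> nm (g - h) + nm (h - l)"
  using nm_triangle[of "g - h" "h - l"] by simp

lemma nm_le_diff: "g \<in> H \<Longrightarrow> h \<in> H \<Longrightarrow> nm g \<le> nm h + nm (g - h)"
  using nm_triangle[of h "g - h"] by simp

lemma nm_sum_le: "(\<And>i. i \<in> A \<Longrightarrow> f i \<in> H) \<Longrightarrow> nm (sum f A) \<le> (\<Sum>i\<in>A. nm (f i))"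
proof (induction A rule: infinite_finite_induct)
  case (insert x F)
  then have "nm (f x + sum f F) \<le> nm (f x) + nm (sum f F)"
    by (intro nm_triangle sum_in) auto
  with insert show ?case by (simp del: plus_fun_apply)
qed auto

text \<open>\<open>H\<close> is a set inside a function type whose own topology is that of pointwise
  convergence, so norm convergence in \<open>H\<close> needs a predicate of its own.\<close>

definition lim_in :: "(nat \<Rightarrow> 'a \<Rightarrow> complex) \<Rightarrow> ('a \<Rightarrow> complex) \<Rightarrow> bool" where
  "lim_in u g \<longleftrightarrow> (\<lambda>n. nm (u n - g)) \<longlonglongrightarrow> 0"

lemma lim_in_nm:
  assumes "\<And>n. u n \<in> H" "g \<in> H" "lim_in u g"
  shows "(\<lambda>n. nm (u n)) \<longlonglongrightarrow> nm g"
proof (rule Lim_transform2[of "\<lambda>n. nm g"])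
  have "\<bar>nm g - nm (u n)\<bar> \<le> nm (u n - g)" for n
    using nm_le_diff[of "u n" g] nm_le_diff[of g "u n"] nm_minus_commute[of g "u n"] assms by auto
  then show "(\<lambda>n. nm g - nm (u n)) \<longlonglongrightarrow> 0"
    by (intro Lim_null_comparison[OF _ assms(3)[unfolded lim_in_def]]) auto
qed auto

lemma lim_in_ip_left:
  assumes "\<And>n. u n \<in> H" "g \<in> H" "lim_in u g" "h \<in> H"
  shows "(\<lambda>n. ip (u n) h) \<longlonglongrightarrow> ip g h"
proof (rule LIM_zero_cancel)
  have "cmod (ip (u n) h - ip g h) \<le> nm (u n - g) * nm h" for n
    using Cauchy_Schwarz[of "u n - g" h] assms by (simp add: ip_diff_left)
  moreover have "(\<lambda>n. nm (u n - g) * nm h) \<longlonglongrightarrow> 0"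
    using assms(3) by (auto simp: lim_in_def intro: tendsto_mult_left_zero)
  ultimately show "(\<lambda>n. ip (u n) h - ip g h) \<longlonglongrightarrow> 0"
    using Lim_null_comparison[of "\<lambda>n. ip (u n) h - ip g h" "\<lambda>n. nm (u n - g) * nm h" sequentially] by simp
qed

lemma lim_in_ip_right:
  assumes "\<And>n. u n \<in> H" "g \<in> H" "lim_in u g" "h \<in> H"
  shows "(\<lambda>n. ip h (u n)) \<longlonglongrightarrow> ip h g"
proof -
  have "(\<lambda>n. cnj (ip (u n) h)) \<longlonglongrightarrow> cnj (ip g h)"
    by (intro tendsto_cnj lim_in_ip_left assms)
  then show ?thesis by (simp only: ip_cnj[OF assms(1) assms(4), symmetric] ip_cnj[OF assms(2) assms(4), symmetric])
qed

lemma lim_in_add: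
  assumes "\<And>n. u n \<in> H" "g \<in> H" "lim_in u g" "\<And>n. v n \<in> H" "h \<in> H" "lim_in v h"
  shows "lim_in (\<lambda>n. u n + v n) (g + h)"
  unfolding lim_in_def
proof (rule Lim_null_comparison)
  have "nm (u n + v n - (g + h)) \<le> nm (u n - g) + nm (v n - h)" for n
    using nm_triangle[of "u n - g" "v n - h"] assms by (simp add: algebra_simps)
  then show "\<forall>\<^sub>F n in sequentially. norm (nm (u n + v n - (g + h))) \<le> nm (u n - g) + nm (v n - h)"
    using assms by auto
  show "(\<lambda>n. nm (u n - g) + nm (v n - h)) \<longlonglongrightarrow> 0"
    using assms tendsto_add[of "\<lambda>n. nm (u n - g)" 0 _ "\<lambda>n. nm (v n - h)" 0] by (simp add: lim_in_def)
qed

lemma lim_in_const [simp]: "lim_in (\<lambda>n. g) g"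
  by (simp add: lim_in_def)

lemma lim_in_bounded:
  assumes "\<And>n. u n \<in> H" "g \<in> H" "lim_in u g" "\<And>n. A (u n) \<in> H" "A g \<in> H"
    and "\<And>n. nm (A (u n) - A g) \<le> C * nm (u n - g)"
  shows "lim_in (\<lambda>n. A (u n)) (A g)"
  unfolding lim_in_def
proof (rule Lim_null_comparison)
  show "\<forall>\<^sub>F n in sequentially. norm (nm (A (u n) - A g)) \<le> C * nm (u n - g)"
    using assms by simp
  show "(\<lambda>n. C * nm (u n - g)) \<longlonglongrightarrow> 0"
    using assms(3) by (auto simp: lim_in_def intro: tendsto_mult_right_zero)
qed

lemma Cauchy_lim:
  assumes "\<And>n. u n \<in> H" "\<And>e. e > 0 \<Longrightarrow> \<exists>N. \<forall>m\<ge>N. \<forall>n\<ge>N. nm (u m - u n) < e"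
  obtains g where "g \<in> H" "lim_in u g"
  using complete[of u] assms that by (auto simp: lim_in_def)

lemma nm_sum_orthogonal:
  assumes "finite B" "\<And>i. i \<in> B \<Longrightarrow> e i \<in> H" "\<And>i j. i \<in> B \<Longrightarrow> j \<in> B \<Longrightarrow> i \<noteq> j \<Longrightarrow> ip (e i) (e j) = 0"
  shows "(nm (\<Sum>i\<in>B. e i))\<^sup>2 = (\<Sum>i\<in>B. (nm (e i))\<^sup>2)"
  using assms
proof (induction B rule: finite_induct)
  case (insert x F)
  have "ip (e x) (\<Sum>i\<in>F. e i) = 0"
    using insert by (subst ip_sum_right) (auto intro!: sum.neutral)
  moreover have "e x \<in> H" "sum e F \<in> H" using insert by (auto intro!: sum_in)
  ultimately have "(nm (e x + sum e F))\<^sup>2 = (nm (e x))\<^sup>2 + (nm (sum e F))\<^sup>2"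
    by (simp add: nm_add_sq)
  then show ?case using insert by (simp del: plus_fun_apply)
qed auto

text \<open>A gliding hump over nested balls, in the manner of the Baire category theorem.\<close>

theorem uniform_boundedness:
  fixes s :: "'i \<Rightarrow> ('a \<Rightarrow> complex) \<Rightarrow> real"
  assumes tri: "\<And>i g h. g \<in> H \<Longrightarrow> h \<in> H \<Longrightarrow> s i (g + h) \<le> s i g + s i h"
    and hom: "\<And>i c h. h \<in> H \<Longrightarrow> s i (c \<odot> h) = cmod c * s i h"
    and cont: "\<And>i. \<exists>C. \<forall>h\<in>H. s i h \<le> C * nm h"
    and bdd: "\<And>h. h \<in> H \<Longrightarrow> \<exists>B. \<forall>i. s i h \<le> B"
  shows "\<exists>C. \<forall>i. \<forall>h\<in>H. s i h \<le> C * nm h"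
proof (rule ccontr)
  assume "\<not> ?thesis"
  then have unb: "\<exists>i. \<exists>h\<in>H. s i h > C * nm h" for C
    by (auto simp: not_le)
  have neg: "s i (- h) = s i h" if "h \<in> H" for i h
    using hom[OF that, of i "-1"] by (simp add: uminus_eq_smul)
  have step: "\<exists>y\<in>H. \<exists>i. nm (y - x) \<le> r \<and> s i y > K" if x: "x \<in> H" and r: "r > 0" for x r K
  proof -
    obtain i h where h: "h \<in> H" "s i h > K / r * nm h" using unb by blast
    have "nm h \<noteq> 0"
    proof
      assume "nm h = 0"
      then have "h = 0" using h nm_eq_0 by blast
      then show False using h hom[of h i 0] by simp
    qed
    then have n: "nm h > 0" using nm_nonneg[OF h(1)] by linarith
    define l where "l = complex_of_real (r / nm h) \<odot> h"
    have l: "l \<in> H" "nm l = r" using h n r by (auto simp: l_def nm_smul norm_divide)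
    have sl: "s i l = r / nm h * s i h" using hom[OF h(1), of i "complex_of_real (r / nm h)"] n r
      by (simp add: l_def norm_divide)
    have "s i l > K"
    proof -
      have "r / nm h * s i h > r / nm h * (K / r * nm h)"
        using h(2) n r by (intro mult_strict_left_mono) auto
      then show ?thesis using n r by (simp add: sl)
    qed
    \<comment> \<open>\<open>2 \<odot> l\<close> is the difference of \<open>x + l\<close> and
      \<open>x - l\<close>, so the seminorm exceeds \<open>K\<close> at one of these points; both
      have distance \<open>r\<close> from \<open>x\<close>.\<close>
    have "2 * s i l = s i ((x + l) + - (x - l))"
    proof -
      have "(x + l) + - (x - l) = 2 \<odot> l" by (simp add: fun_eq_iff)
      then show ?thesis using hom[OF l(1), of i 2] by simp
    qed
    also have "\<dots> \<le> s i (x + l) + s i (x - l)"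
      using tri[of "x + l" "- (x - l)" i] x l by (simp only: neg add_in diff_in uminus_in)
    finally have "s i (x + l) > K \<or> s i (x - l) > K" using \<open>s i l > K\<close> by linarith
    then show ?thesis
    proof
      assume "s i (x + l) > K"
      then show ?thesis using x l by (intro bexI[of _ "x + l"] exI[of _ i]) auto
    next
      assume "s i (x - l) > K"
      then show ?thesis using x l by (intro bexI[of _ "x - l"] exI[of _ i]) auto
    qed
  qed
  \<comment> \<open>Pairs are (centre, radius). A good successor \<open>q\<close> of
    \<open>p\<close> is a closed ball contained in the ball \<open>p\<close>, of at most half its
    radius, at each point of which some seminorm exceeds \<open>n\<close>.\<close>
  define good where "good n p q \<longleftrightarrow> fst q \<in> H \<and> 0 < snd q \<and> snd q \<le> snd p / 2 \<and>
      nm (fst q - fst p) + snd q \<le> snd p \<and> (\<forall>z\<in>H. nm (z - fst q) \<le> snd q \<longrightarrow> (\<exists>i. s i z > n))"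
    for n :: real and p q :: "('a \<Rightarrow> complex) \<times> real"
  have ex: "\<exists>q. good n p q" if p: "fst p \<in> H" "snd p > 0" for n p
  proof -
    obtain y i where y: "y \<in> H" "nm (y - fst p) \<le> snd p / 2" "s i y > n + 1"
      using step[OF p(1), of "snd p / 2" "n + 1"] p by auto
    obtain C0 where C0: "\<forall>h\<in>H. s i h \<le> C0 * nm h" using cont[of i] by blast
    define C where "C = max C0 1"
    have C: "C > 0" "\<And>h. h \<in> H \<Longrightarrow> s i h \<le> C * nm h"
    proof -
      fix h assume h: "h \<in> H"
      then have "s i h \<le> C0 * nm h" using C0 by blast
      also have "\<dots> \<le> C * nm h" using h by (intro mult_right_mono) (auto simp: C_def)
      finally show "s i h \<le> C * nm h" .
    qed (simp add: C_def)
    \<comment> \<open>The surplus 1 in \<open>n + 1\<close> pays for the variation of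
      \<open>s i\<close> over a ball of radius \<open>1 / C\<close>.\<close>
    define r where "r = min (snd p / 2) (1 / C)"
    have "s i z > n" if z: "z \<in> H" "nm (z - y) \<le> r" for z
    proof -
      have "s i y \<le> s i z + s i (y - z)" using tri[of z "y - z" i] y z by simp
      also have "s i (y - z) \<le> C * nm (z - y)" using C(2)[of "y - z"] y z by (simp add: nm_minus_commute)
      also have "\<dots> \<le> C * (1 / C)" using z C by (intro mult_left_mono) (auto simp: r_def)
      finally show ?thesis using C y by simp
    qed
    then have "good n p (y, r)" using y C p unfolding good_def by (auto simp: r_def)
    then show ?thesis by blast
  qed
  have "\<exists>f. \<forall>n::nat. (fst (f n) \<in> H \<and> snd (f n) > 0) \<and> good (real n) (f n) (f (Suc n))"
  proof (rule dependent_nat_choice)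
    show "\<exists>x. fst x \<in> H \<and> (0::real) < snd x" by (rule exI[of _ "(0, 1)"]) auto
  next
    fix x n assume "fst x \<in> H \<and> (0::real) < snd x"
    then show "\<exists>y. (fst y \<in> H \<and> 0 < snd y) \<and> good (real n) x y"
      using ex[of x "real n"] by (auto simp: good_def)
  qed
  then obtain f where f: "\<And>n. fst (f n) \<in> H" "\<And>n. snd (f n) > 0" "\<And>n. good (real n) (f n) (f (Suc n))"
    by blast
  define x r where "x n = fst (f n)" and "r n = snd (f n)" for n
  have xH: "x n \<in> H" and rpos: "r n > 0" and rhalf: "r (Suc n) \<le> r n / 2"
    and nest: "nm (x (Suc n) - x n) + r (Suc n) \<le> r n"
    and big: "\<And>z. z \<in> H \<Longrightarrow> nm (z - x (Suc n)) \<le> r (Suc n) \<Longrightarrow> \<exists>i. s i z > n" for n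
    using f[of n] by (auto simp: x_def r_def good_def)
  have nest2: "nm (x (n + k) - x n) + r (n + k) \<le> r n" for n k
  proof (induction k)
    case 0
    have "x (n + 0) - x n = 0" by simp
    then show ?case by (simp only: nm_zero) simp
  next
    case (Suc k)
    have "nm (x (n + Suc k) - x n) \<le> nm (x (Suc (n + k)) - x (n + k)) + nm (x (n + k) - x n)"
      using nm_dist_triangle[of "x (n + Suc k)" "x (n + k)" "x n"] xH by simp
    then show ?case using Suc nest[of "n + k"] by (simp del: minus_apply)
  qed
  have close: "nm (x m - x n) \<le> r n" if mn: "m \<ge> n" for m n
  proof -
    obtain k where "m = n + k" using le_Suc_ex[OF mn] by auto
    then show ?thesis using nest2[of n k] rpos[of m] by simp
  qed
  have rb: "r n \<le> r 0 * (1 / 2) ^ n" for n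
  proof (induction n)
    case (Suc n) then show ?case using rhalf[of n] by simp
  qed auto
  have "(\<lambda>n. r 0 * (1 / 2) ^ n) \<longlonglongrightarrow> 0"
    using tendsto_mult_right_zero[OF LIMSEQ_realpow_zero[of "1/2::real"]] by auto
  then have r0: "r \<longlonglongrightarrow> 0"
    using rb rpos by (intro Lim_null_comparison[of r "\<lambda>n. r 0 * (1 / 2) ^ n"]) (auto simp: less_imp_le)
  obtain z where z: "z \<in> H" "lim_in x z"
  proof (rule Cauchy_lim[of x])
    show "x n \<in> H" for n by (rule xH)
    fix e :: real assume "e > 0"
    then obtain N where N: "r N < e / 2"
      using order_tendstoD(2)[OF r0, of "e / 2"] by (auto simp: eventually_sequentially)
    have "nm (x m - x n) < e" if "m \<ge> N" "n \<ge> N" for m n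
      using nm_dist_triangle[of "x m" "x N" "x n"] close[OF that(1)] close[OF that(2)] xH N
        nm_minus_commute[of "x N" "x n"] by auto
    then show "\<exists>N. \<forall>m\<ge>N. \<forall>n\<ge>N. nm (x m - x n) < e" by blast
  qed
  have "nm (z - x n) \<le> r n" for n
  proof (rule LIMSEQ_le_const2)
    have "lim_in (\<lambda>m. x m + - x n) (z + - x n)"
      using z xH by (intro lim_in_add) auto
    then show "(\<lambda>m. nm (x m - x n)) \<longlonglongrightarrow> nm (z - x n)"
      using z xH lim_in_nm[of "\<lambda>m. x m - x n" "z - x n"] by simp
    show "\<exists>N. \<forall>m\<ge>N. nm (x m - x n) \<le> r n" using close by blast
  qed
  then have ex: "\<exists>i. s i z > real n" for n using big[of z n] z by blast
  obtain B where B: "\<forall>i. s i z \<le> B" using bdd[OF z(1)] by blast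
  obtain n where "B < real n" using reals_Archimedean2 by blast
  moreover obtain i where "s i z > real n" using ex by blast
  ultimately show False using B[rule_format, of i] by linarith
qed

end

section \<open>Multi-indices and discrete tori\<close>

type_synonym 'n mindex = "'n \<Rightarrow> nat"

definition deg :: "'n::finite mindex \<Rightarrow> nat" where
  "deg \<alpha> = (\<Sum>i\<in>UNIV. \<alpha> i)"

definition unit_index :: "'n \<Rightarrow> 'n mindex" where
  "unit_index i = (\<lambda>j. if j = i then 1 else 0)"

definition mpow :: "('n::finite \<Rightarrow> 'b::comm_semiring_1) \<Rightarrow> 'n mindex \<Rightarrow> 'b" where
  "mpow x \<alpha> = (\<Prod>i\<in>UNIV. x i ^ \<alpha> i)"

definition multinom :: "'n::finite mindex \<Rightarrow> real" where
  "multinom \<alpha> = fact (deg \<alpha>) / (\<Prod>i\<in>UNIV. fact (\<alpha> i))"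

lemma le_deg: "\<alpha> i \<le> deg \<alpha>"
  unfolding deg_def by (rule member_le_sum) auto

lemma finite_le_index: "finite {\<alpha> :: 'n::finite mindex. \<forall>i. \<alpha> i \<le> k}"
proof -
  have "{\<alpha> :: 'n mindex. \<forall>i. \<alpha> i \<le> k} = PiE UNIV (\<lambda>_. {..k})"
    by (auto simp: PiE_def Pi_def)
  then show ?thesis by (simp add: finite_PiE)
qed

lemma finite_deg_le: "finite {\<alpha>. deg \<alpha> \<le> k}"
  by (rule finite_subset[OF _ finite_le_index[of k]]) (auto intro: le_deg order_trans)

lemma finite_deg_eq [simp]: "finite {\<alpha>. deg \<alpha> = k}"
  by (rule finite_subset[OF _ finite_deg_le[of k]]) auto

lemma finite_deg_less [simp]: "finite {\<alpha>. deg \<alpha> < k}"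
  by (rule finite_subset[OF _ finite_deg_le[of k]]) auto

lemma deg_zero [simp]: "deg 0 = 0"
  by (simp add: deg_def)

lemma deg_add [simp]: "deg (\<alpha> + \<beta>) = deg \<alpha> + deg \<beta>"
  by (simp add: deg_def sum.distrib)

lemma deg_unit_index [simp]: "deg (unit_index i) = 1"
  by (simp add: deg_def unit_index_def)

lemma deg_eq_0: "deg \<alpha> = 0 \<longleftrightarrow> \<alpha> = 0"
  by (auto simp: deg_def fun_eq_iff)

lemma mpow_zero [simp]: "mpow x 0 = 1" "mpow x (\<lambda>_. 0) = 1"
  by (simp_all add: mpow_def)

lemma mpow_add: "mpow x (\<alpha> + \<beta>) = mpow x \<alpha> * mpow x \<beta>"
  by (simp add: mpow_def power_add prod.distrib)

lemma mpow_unit_index [simp]: "mpow x (unit_index i) = x i"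
proof -
  have "mpow x (unit_index i) = (\<Prod>j\<in>UNIV. if j = i then x i else 1)"
    unfolding mpow_def unit_index_def by (rule prod.cong) auto
  then show ?thesis by simp
qed

lemma mpow_mult: "mpow (\<lambda>i. x i * y i) \<alpha> = mpow x \<alpha> * mpow y \<alpha>"
  by (simp add: mpow_def power_mult_distrib prod.distrib)

lemma mpow_scale: "mpow (\<lambda>i. c * x i) \<alpha> = c ^ deg \<alpha> * mpow x \<alpha>"
  by (simp add: mpow_def power_mult_distrib prod.distrib deg_def power_sum)

lemma mpow_const: "mpow (\<lambda>i. c) \<alpha> = c ^ deg \<alpha>"
  by (simp add: mpow_def deg_def power_sum)

lemma norm_mpow: "norm (mpow x \<alpha>) = mpow (\<lambda>i. norm (x i)) \<alpha>" for x :: "'n::finite \<Rightarrow> 'b::real_normed_field"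
  by (simp add: mpow_def prod_norm[symmetric] norm_power)

lemma mpow_nonneg: "(\<And>i. x i \<ge> 0) \<Longrightarrow> mpow x \<alpha> \<ge> 0" for x :: "'n::finite \<Rightarrow> real"
  by (simp add: mpow_def prod_nonneg)

lemma multinom_pos [simp]: "multinom \<alpha> > 0"
  by (simp add: multinom_def prod_pos)

lemma multinom_nonneg [simp]: "multinom \<alpha> \<ge> 0" "multinom \<alpha> \<noteq> 0"
  using multinom_pos[of \<alpha>] by (auto simp del: multinom_pos)

lemma multinom_zero [simp]: "multinom 0 = 1" "multinom (\<lambda>_. 0) = 1"
  by (simp_all add: multinom_def deg_def)

lemma prod_fact_unit_index:
  fixes \<alpha> :: "'n::finite mindex"
  shows "(\<Prod>j\<in>UNIV. fact ((\<alpha> + unit_index i) j) :: real) = (\<alpha> i + 1) * (\<Prod>j\<in>UNIV. fact (\<alpha> j))"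
proof -
  have "(\<Prod>j\<in>UNIV. fact ((\<alpha> + unit_index i) j) :: real)
      = (\<Prod>j\<in>UNIV. (if j = i then real (\<alpha> i + 1) else 1) * fact (\<alpha> j))"
    by (rule prod.cong) (auto simp: unit_index_def algebra_simps)
  also have "\<dots> = (\<Prod>j\<in>UNIV. if j = i then real (\<alpha> i + 1) else 1) * (\<Prod>j\<in>UNIV. fact (\<alpha> j))"
    by (rule prod.distrib)
  also have "(\<Prod>j\<in>UNIV. if j = i then real (\<alpha> i + 1) else 1) = real (\<alpha> i + 1)"
    by (subst prod.delta) auto
  finally show ?thesis by (simp add: algebra_simps del: plus_fun_apply)
qed

lemma multinom_unit_index:
  "multinom (\<alpha> + unit_index i) = multinom \<alpha> * (real (deg \<alpha>) + 1) / (real (\<alpha> i) + 1)"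
  unfolding multinom_def prod_fact_unit_index by (simp add: field_simps)

lemma multinom_le_unit_index: "multinom \<alpha> \<le> multinom (\<alpha> + unit_index i)"
proof -
  have "multinom \<alpha> * (real (\<alpha> i) + 1) \<le> multinom \<alpha> * (real (deg \<alpha>) + 1)"
    using le_deg[of \<alpha> i] by (intro mult_left_mono) auto
  then show ?thesis unfolding multinom_unit_index by (simp add: field_simps)
qed

text \<open>Pascal's rule in weighted form: \<open>multinom \<gamma>\<close> is divided among the
  coordinates in the proportions \<open>\<gamma> i / deg \<gamma>\<close>, and the share of
  coordinate \<open>i\<close> is \<open>multinom\<close> of \<gamma> lowered at \<open>i\<close>.
  With an arbitrary \<open>F\<close> it serves as the induction step both of the multinomial theorem
  and of \<open>sum_multinom_ratio\<close>.\<close>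

lemma sum_multinom_Suc:
  fixes F :: "'n::finite mindex \<Rightarrow> 'b::real_normed_field"
  shows "(\<Sum>\<gamma> | deg \<gamma> = Suc n. of_real (multinom \<gamma>) * F \<gamma>)
       = (\<Sum>i\<in>UNIV. \<Sum>\<alpha> | deg \<alpha> = n. of_real (multinom \<alpha>) * F (\<alpha> + unit_index i))"
proof -
  have "(\<Sum>\<alpha> | deg \<alpha> = n. of_real (multinom \<alpha>) * F (\<alpha> + unit_index i))
      = (\<Sum>\<gamma> | deg \<gamma> = Suc n. of_real (multinom \<gamma> * real (\<gamma> i) / real (Suc n)) * F \<gamma>)" for i
  proof -
    have "(\<Sum>\<gamma> | deg \<gamma> = Suc n. of_real (multinom \<gamma> * real (\<gamma> i) / real (Suc n)) * F \<gamma>)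
        = (\<Sum>\<gamma> | deg \<gamma> = Suc n \<and> \<gamma> i \<noteq> 0. of_real (multinom \<gamma> * real (\<gamma> i) / real (Suc n)) * F \<gamma>)"
      by (rule sum.mono_neutral_right) auto
    also have "\<dots> = (\<Sum>\<alpha> | deg \<alpha> = n. of_real (multinom \<alpha>) * F (\<alpha> + unit_index i))"
    proof (rule sum.reindex_bij_witness[of _ "\<lambda>\<alpha>. \<alpha> + unit_index i" "\<lambda>\<gamma>. \<gamma>(i := \<gamma> i - 1)"])
      fix \<gamma> :: "'n mindex" assume \<gamma>: "\<gamma> \<in> {\<gamma>. deg \<gamma> = Suc n \<and> \<gamma> i \<noteq> 0}"
      show eq: "\<gamma>(i := \<gamma> i - 1) + unit_index i = \<gamma>"
        using \<gamma> by (auto simp: unit_index_def fun_eq_iff)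
      have "deg (\<gamma>(i := \<gamma> i - 1)) + 1 = deg \<gamma>"
        using arg_cong[OF eq, of deg] by simp
      then show d: "\<gamma>(i := \<gamma> i - 1) \<in> {\<alpha>. deg \<alpha> = n}" using \<gamma> by simp
      have *: "multinom \<gamma> = multinom (\<gamma>(i := \<gamma> i - 1)) * (real n + 1) / real (\<gamma> i)"
        using multinom_unit_index[of "\<gamma>(i := \<gamma> i - 1)" i] d \<gamma> unfolding eq by (simp add: of_nat_diff)
      show "of_real (multinom (\<gamma>(i := \<gamma> i - 1))) * F (\<gamma>(i := \<gamma> i - 1) + unit_index i) =
         of_real (multinom \<gamma> * real (\<gamma> i) / real (Suc n)) * F \<gamma>"
      proof -
        have "multinom \<gamma> * real (\<gamma> i) / real (Suc n) = multinom (\<gamma>(i := \<gamma> i - 1))"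
          using \<gamma> * by (simp add: add.commute)
        then show ?thesis unfolding eq by (simp only:)
      qed
    next
      fix \<alpha> :: "'n mindex" assume "\<alpha> \<in> {\<alpha>. deg \<alpha> = n}"
      then show "(\<alpha> + unit_index i)(i := (\<alpha> + unit_index i) i - 1) = \<alpha>"
        "\<alpha> + unit_index i \<in> {\<gamma>. deg \<gamma> = Suc n \<and> \<gamma> i \<noteq> 0}"
        by (auto simp: unit_index_def fun_eq_iff deg_def sum.distrib)
    qed
    finally show ?thesis by simp
  qed
  then have "(\<Sum>i\<in>UNIV. \<Sum>\<alpha> | deg \<alpha> = n. of_real (multinom \<alpha>) * F (\<alpha> + unit_index i))
    = (\<Sum>\<gamma> | deg \<gamma> = Suc n. \<Sum>i\<in>UNIV. of_real (multinom \<gamma> * real (\<gamma> i) / real (Suc n)) * F \<gamma>)"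
    by (simp only:) (rule sum.swap)
  also have "\<dots> = (\<Sum>\<gamma> | deg \<gamma> = Suc n. of_real (multinom \<gamma>) * F \<gamma>)"
  proof (rule sum.cong[OF refl])
    fix \<gamma> :: "'n mindex" assume \<gamma>: "\<gamma> \<in> {\<gamma>. deg \<gamma> = Suc n}"
    have "(\<Sum>i\<in>UNIV. multinom \<gamma> * real (\<gamma> i) / real (Suc n)) = multinom \<gamma> * real (deg \<gamma>) / real (Suc n)"
      by (simp add: deg_def sum_divide_distrib sum_distrib_left)
    then have "(\<Sum>i\<in>UNIV. multinom \<gamma> * real (\<gamma> i) / real (Suc n)) = multinom \<gamma>" using \<gamma> by simp
    then show "(\<Sum>i\<in>UNIV. of_real (multinom \<gamma> * real (\<gamma> i) / real (Suc n)) * F \<gamma>) = of_real (multinom \<gamma>) * F \<gamma>"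
      by (simp only: sum_distrib_right[symmetric] of_real_sum[symmetric])
  qed
  finally show ?thesis by simp
qed

theorem multinomial:
  fixes x :: "'n::finite \<Rightarrow> 'b::real_normed_field"
  shows "(\<Sum>i\<in>UNIV. x i) ^ n = (\<Sum>\<alpha> | deg \<alpha> = n. of_real (multinom \<alpha>) * mpow x \<alpha>)"
proof (induction n)
  case 0
  have "{\<alpha> :: 'n mindex. deg \<alpha> = 0} = {0}" by (auto simp: deg_eq_0)
  then show ?case by simp
next
  case (Suc n)
  have "(\<Sum>\<alpha> | deg \<alpha> = Suc n. of_real (multinom \<alpha>) * mpow x \<alpha>)
      = (\<Sum>i\<in>UNIV. x i * (\<Sum>\<alpha> | deg \<alpha> = n. of_real (multinom \<alpha>) * mpow x \<alpha>))"
    unfolding sum_multinom_Suc by (simp add: mpow_add sum_distrib_left mult_ac)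
  then show ?case using Suc by (simp add: sum_distrib_right)
qed

text \<open>\<open>kap d n\<close> is the dimension of the homogeneous polynomials of degree \<open>n\<close> in \<open>d\<close> variables, which is
  the quotient of the squared norms of the Drury-Arveson and the Hardy space in that degree.\<close>

definition kap :: "nat \<Rightarrow> nat \<Rightarrow> real" where
  "kap d n = (\<Prod>j<n. (real j + real d) / (real j + 1))"

lemma kap_pos [simp]: "d > 0 \<Longrightarrow> kap d n > 0"
  unfolding kap_def by (intro prod_pos) auto

lemma kap_Suc: "kap d (Suc n) = kap d n * ((real n + real d) / (real n + 1))"
  by (simp add: kap_def)

text \<open>Induction on \<open>M\<close> by Pascal's rule. Adding a unit index multiplies the ratio
  by \<open>((\<gamma> + \<alpha>) i + 1) / (M + deg \<alpha> + 1)\<close>, and the numerators add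
  up over \<open>i\<close> to \<open>M + deg \<alpha> + d\<close>, which is the recursion of
  \<open>kap\<close>.\<close>

lemma sum_multinom_ratio:
  fixes \<alpha> :: "'n::finite mindex"
  shows "(\<Sum>\<gamma> | deg \<gamma> = M. multinom \<gamma> / multinom (\<gamma> + \<alpha>))
    = kap CARD('n) (M + deg \<alpha>) / (kap CARD('n) (deg \<alpha>) * multinom \<alpha>)"
proof (induction M)
  case 0
  have "{\<alpha> :: 'n mindex. deg \<alpha> = 0} = {0}" by (auto simp: deg_eq_0)
  moreover have "kap CARD('n) (deg \<alpha>) \<noteq> 0" using kap_pos[of "CARD('n)" "deg \<alpha>"] by (auto simp del: kap_pos)
  ultimately show ?case by simp
next
  case (Suc M)
  let ?d = "CARD('n)"
  have "(\<Sum>\<gamma> | deg \<gamma> = Suc M. multinom \<gamma> / multinom (\<gamma> + \<alpha>))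
      = (\<Sum>i\<in>UNIV. \<Sum>\<gamma> | deg \<gamma> = M. multinom \<gamma> / multinom (\<gamma> + unit_index i + \<alpha>))"
    using sum_multinom_Suc[where n = M and F = "\<lambda>\<gamma>. 1 / multinom (\<gamma> + \<alpha>)"] by simp
  also have "\<dots> = (\<Sum>\<gamma> | deg \<gamma> = M. \<Sum>i\<in>UNIV. multinom \<gamma> / multinom (\<gamma> + unit_index i + \<alpha>))"
    by (rule sum.swap)
  also have "\<dots> = (\<Sum>\<gamma> | deg \<gamma> = M. ((real (M + deg \<alpha>) + ?d) / (real (M + deg \<alpha>) + 1)) * (multinom \<gamma> / multinom (\<gamma> + \<alpha>)))"
  proof (rule sum.cong[OF refl])
    fix \<gamma> :: "'n mindex" assume \<gamma>: "\<gamma> \<in> {\<gamma>. deg \<gamma> = M}"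
    have "multinom \<gamma> / multinom (\<gamma> + unit_index i + \<alpha>)
        = (multinom \<gamma> / multinom (\<gamma> + \<alpha>) / (real (M + deg \<alpha>) + 1)) * (real ((\<gamma> + \<alpha>) i) + 1)" for i
      using \<gamma> multinom_unit_index[of "\<gamma> + \<alpha>" i] by (simp add: add_ac)
    then have "(\<Sum>i\<in>UNIV. multinom \<gamma> / multinom (\<gamma> + unit_index i + \<alpha>))
        = (multinom \<gamma> / multinom (\<gamma> + \<alpha>) / (real (M + deg \<alpha>) + 1)) * (\<Sum>i\<in>UNIV. real ((\<gamma> + \<alpha>) i) + 1)"
      by (simp only: sum_distrib_left)
    also have "(\<Sum>i\<in>UNIV. real ((\<gamma> + \<alpha>) i) + 1) = real (deg (\<gamma> + \<alpha>)) + ?d"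
      by (simp add: deg_def sum.distrib)
    finally show "(\<Sum>i\<in>UNIV. multinom \<gamma> / multinom (\<gamma> + unit_index i + \<alpha>))
      = ((real (M + deg \<alpha>) + ?d) / (real (M + deg \<alpha>) + 1)) * (multinom \<gamma> / multinom (\<gamma> + \<alpha>))"
      using \<gamma> by (simp add: mult_ac del: plus_fun_apply)
  qed
  also have "\<dots> = ((real (M + deg \<alpha>) + ?d) / (real (M + deg \<alpha>) + 1)) * (kap ?d (M + deg \<alpha>) / (kap ?d (deg \<alpha>) * multinom \<alpha>))"
    by (simp only: sum_distrib_left[symmetric] Suc)
  finally show ?case by (simp add: kap_Suc add_ac mult_ac del: plus_fun_apply)
qed

text \<open>\<open>kap d n\<close> is the binomial coefficient n + d - 1 over n, a polynomial in n,
  so a fixed shift of the degree becomes invisible. This is what makes multiplication operators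
  resemble those on the Hardy space in high degrees.\<close>

lemma kap_ratio_tendsto: "(\<lambda>n. kap d (n + k) / kap d n) \<longlonglongrightarrow> 1" if "d > 0"
proof (induction k)
  case 0
  have "kap d n \<noteq> 0" for n using kap_pos[OF that, of n] by linarith
  then show ?case by simp
next
  case (Suc k)
  have "(\<lambda>n. (real (n + k) + real d) / (real (n + k) + 1)) \<longlonglongrightarrow> 1"
    by real_asymp
  then have "(\<lambda>n. kap d (n + k) / kap d n * ((real (n + k) + real d) / (real (n + k) + 1))) \<longlonglongrightarrow> 1 * 1"
    by (intro tendsto_mult Suc)
  then show ?case by (simp add: kap_Suc mult_ac)
qed

section \<open>Roots of unity and orthogonality on discrete tori\<close>

definition root_unity :: "nat \<Rightarrow> complex" where
  "root_unity L = cis (2 * pi / real L)"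

lemma root_unity_power: "root_unity L ^ k = cis (2 * pi * real k / real L)"
  unfolding root_unity_def Complex.DeMoivre by (simp add: mult_ac)

lemma norm_root_unity [simp]: "cmod (root_unity L ^ k) = 1"
  by (simp add: root_unity_power)

lemma root_unity_power_eq_iff:
  assumes "L > 0"
  shows "root_unity L ^ a = root_unity L ^ b \<longleftrightarrow> a mod L = b mod L"
proof -
  have L: "root_unity L ^ L = 1" using assms by (simp add: root_unity_power)
  have red: "root_unity L ^ a = root_unity L ^ (a mod L)" for a
  proof -
    have "root_unity L ^ a = root_unity L ^ (L * (a div L) + a mod L)" by simp
    also have "\<dots> = (root_unity L ^ L) ^ (a div L) * root_unity L ^ (a mod L)"
      by (simp only: power_add power_mult)
    finally show ?thesis by (simp add: L)
  qed
  have inj: "inj_on (\<lambda>k. cis (2 * pi * real k / real L)) {..<L}"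
    using Complex.bij_betw_roots_unity[OF assms] by (simp add: bij_betw_def)
  have "a mod L \<in> {..<L}" "b mod L \<in> {..<L}" using assms by auto
  then have "root_unity L ^ (a mod L) = root_unity L ^ (b mod L) \<longleftrightarrow> a mod L = b mod L"
    using inj by (auto simp: root_unity_power inj_on_def)
  then show ?thesis using red by metis
qed

lemma sum_root_unity:
  assumes "L > 0"
  shows "(\<Sum>j<L. (root_unity L ^ j) ^ a * cnj ((root_unity L ^ j) ^ b)) = (if a mod L = b mod L then of_nat L else 0)"
proof -
  define q where "q = root_unity L ^ a * cnj (root_unity L ^ b)"
  have unit: "root_unity L ^ k * cnj (root_unity L ^ k) = 1" for k
    by (simp add: complex_norm_square[symmetric] flip: complex_cnj_power)
  have "(root_unity L ^ j) ^ a * cnj ((root_unity L ^ j) ^ b) = q ^ j" for j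
    by (simp add: q_def power_mult_distrib power_mult[symmetric] mult.commute)
  then have *: "(\<Sum>j<L. (root_unity L ^ j) ^ a * cnj ((root_unity L ^ j) ^ b)) = (\<Sum>j<L. q ^ j)"
    by simp
  have qL: "q ^ L = 1"
  proof -
    have "root_unity L ^ L = 1" using assms by (simp add: root_unity_power)
    then have "(root_unity L ^ a) ^ L = 1" "(root_unity L ^ b) ^ L = 1"
      by (metis power_commutes power_mult power_one mult.commute)+
    then show ?thesis by (simp add: q_def power_mult_distrib flip: complex_cnj_power)
  qed
  have q1: "q = 1 \<longleftrightarrow> root_unity L ^ a = root_unity L ^ b"
  proof
    assume "q = 1"
    then have "root_unity L ^ b = (root_unity L ^ a * cnj (root_unity L ^ b)) * root_unity L ^ b" by (simp add: q_def)
    also have "\<dots> = root_unity L ^ a * (root_unity L ^ b * cnj (root_unity L ^ b))" by (simp only: mult_ac)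
    finally show "root_unity L ^ a = root_unity L ^ b" by (simp only: unit mult_1_right)
  qed (simp only: q_def unit)
  show ?thesis
  proof (cases "a mod L = b mod L")
    case True
    then have "q = 1" using q1 root_unity_power_eq_iff[OF assms] by simp
    then show ?thesis using True * by simp
  next
    case False
    then have "q \<noteq> 1" using q1 root_unity_power_eq_iff[OF assms] by simp
    then have "(\<Sum>j<L. q ^ j) = 0" using geometric_sum[of q L] qL by simp
    then show ?thesis using False * by simp
  qed
qed

definition torus_point :: "nat \<Rightarrow> ('n \<Rightarrow> real) \<Rightarrow> 'n mindex \<Rightarrow> 'n \<Rightarrow> complex" where
  "torus_point L r \<theta> = (\<lambda>i. of_real (r i) * root_unity L ^ \<theta> i)"

definition torus_grid :: "nat \<Rightarrow> 'n mindex set" where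
  "torus_grid L = PiE UNIV (\<lambda>_. {..<L})"

lemma finite_torus_grid [simp]: "finite (torus_grid L :: 'n::finite mindex set)"
  by (simp add: torus_grid_def finite_PiE)

lemma card_torus_grid: "card (torus_grid L :: 'n::finite mindex set) = L ^ CARD('n)"
  by (simp add: torus_grid_def card_PiE)

text \<open>A grid with \<open>L\<close> points per coordinate sees exponents only modulo
  \<open>L\<close>. Later uses either take \<open>L\<close> above the degrees involved, where
  congruence is equality, or estimate the aliased terms.\<close>

lemma torus_orthogonality:
  fixes \<alpha> \<beta> :: "'n::finite mindex"
  assumes "L > 0"
  shows "(\<Sum>\<theta>\<in>torus_grid L. mpow (torus_point L r \<theta>) \<alpha> * cnj (mpow (torus_point L r \<theta>) \<beta>))
    = (if \<forall>i. \<alpha> i mod L = \<beta> i mod L then of_nat L ^ CARD('n) * of_real (mpow r \<alpha> * mpow r \<beta>) else 0)"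
proof -
  have "mpow (torus_point L r \<theta>) \<alpha> * cnj (mpow (torus_point L r \<theta>) \<beta>)
      = of_real (mpow r \<alpha> * mpow r \<beta>) *
        (\<Prod>i\<in>UNIV. (root_unity L ^ \<theta> i) ^ \<alpha> i * cnj ((root_unity L ^ \<theta> i) ^ \<beta> i))" for \<theta>
    by (simp add: torus_point_def mpow_def power_mult_distrib prod.distrib mult_ac)
  then have "(\<Sum>\<theta>\<in>torus_grid L. mpow (torus_point L r \<theta>) \<alpha> * cnj (mpow (torus_point L r \<theta>) \<beta>))
      = of_real (mpow r \<alpha> * mpow r \<beta>) *
        (\<Sum>\<theta>\<in>torus_grid L. \<Prod>i\<in>UNIV. (root_unity L ^ \<theta> i) ^ \<alpha> i * cnj ((root_unity L ^ \<theta> i) ^ \<beta> i))"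
    by (simp only: sum_distrib_left)
  also have "(\<Sum>\<theta>\<in>torus_grid L. \<Prod>i\<in>UNIV. (root_unity L ^ \<theta> i) ^ \<alpha> i * cnj ((root_unity L ^ \<theta> i) ^ \<beta> i))
      = (\<Prod>i\<in>UNIV. \<Sum>j<L. (root_unity L ^ j) ^ \<alpha> i * cnj ((root_unity L ^ j) ^ \<beta> i))"
    unfolding torus_grid_def
    by (rule prod_sum_PiE[symmetric]) auto
  also have "\<dots> = (\<Prod>i\<in>UNIV. if \<alpha> i mod L = \<beta> i mod L then of_nat L else 0)"
    by (simp only: sum_root_unity[OF assms])
  also have "\<dots> = (if \<forall>i. \<alpha> i mod L = \<beta> i mod L then of_nat L ^ CARD('n) else 0)"
    by (auto intro!: prod_zero)
  finally show ?thesis by simp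
qed

section \<open>Monomials in the Drury-Arveson space\<close>

declare mem_ball [simp del] mem_ball_0 [simp del]

lemma cmod_herm_le: "cmod (herm w z) \<le> norm w * norm z"
proof -
  have "cmod (herm w z) \<le> (\<Sum>i\<in>UNIV. \<bar>norm (w $ i)\<bar> * \<bar>norm (z $ i)\<bar>)"
    unfolding herm_def by (rule order_trans[OF norm_sum]) (simp add: norm_mult)
  also have "\<dots> \<le> L2_set (\<lambda>i. norm (w $ i)) UNIV * L2_set (\<lambda>i. norm (z $ i)) UNIV"
    by (rule L2_set_mult_ineq)
  finally show ?thesis by (simp add: norm_vec_def)
qed

lemma herm_self: "herm z z = complex_of_real ((norm z)\<^sup>2)"
  by (simp add: herm_def norm_vec_def L2_set_def sum_nonneg complex_norm_square del: of_real_power)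

lemma herm_power: "herm w z ^ n
    = (\<Sum>\<alpha> | deg \<alpha> = n. of_real (multinom \<alpha>) * (mpow (($) w) \<alpha> * cnj (mpow (($) z) \<alpha>)))"
  unfolding herm_def multinomial by (simp add: mpow_mult mpow_def[of "\<lambda>i. cnj (z $ i)"] mpow_def[of "($) z"])

lemma cmod_herm_less_1: "w \<in> ball 0 1 \<Longrightarrow> z \<in> ball 0 1 \<Longrightarrow> cmod (herm w z) < 1"
  using cmod_herm_le[of w z] mult_strict_mono[of "norm w" 1 "norm z" 1]
  by (auto simp: mem_ball_0 intro: le_less_trans)

locale drury_arveson_space =
  fixes H :: "(complex ^ 'n \<Rightarrow> complex) set"
    and ip :: "(complex ^ 'n \<Rightarrow> complex) \<Rightarrow> (complex ^ 'n \<Rightarrow> complex) \<Rightarrow> complex"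
  assumes drury_arveson: "drury_arveson H ip"

sublocale drury_arveson_space \<subseteq> rkhs "ball 0 1" H ip "\<lambda>w z. 1 / (1 - herm w z)"
  using drury_arveson by (simp add: drury_arveson_def)

definition monomial :: "'n::finite mindex \<Rightarrow> complex ^ 'n \<Rightarrow> complex" where
  "monomial \<alpha> = (\<lambda>z. if z \<in> ball 0 1 then mpow (($) z) \<alpha> else 0)"

text \<open>The reproducing kernel at \<open>z\<close> as a vector of the space, extended by zero;
  for d = 1 it is the Szego kernel of the disc.\<close>

definition szego :: "complex ^ 'n \<Rightarrow> complex ^ 'n \<Rightarrow> complex" where
  "szego z = (\<lambda>w. if w \<in> ball 0 1 then 1 / (1 - herm w z) else 0)"

text \<open>Polyradius of a torus inside the unit ball on which \<open>\<bar>herm w z\<bar> \<le> 1 / 2\<close> for all \<open>w\<close> in the ball.\<close>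

definition trad :: "'n::finite itself \<Rightarrow> real" where
  "trad _ = 1 / (2 * real CARD('n))"

definition tpoint :: "nat \<Rightarrow> 'n::finite mindex \<Rightarrow> complex ^ 'n" where
  "tpoint L \<theta> = (\<chi> i. torus_point L (\<lambda>_. trad TYPE('n)) \<theta> i)"

lemma trad_pos: "trad TYPE('n::finite) > 0" and trad_le_1: "trad TYPE('n::finite) \<le> 1"
proof -
  have "CARD('n) \<ge> 1" by (simp add: Suc_leI)
  then have "real CARD('n) * 2 \<ge> 1" by linarith
  then show "trad TYPE('n::finite) > 0" "trad TYPE('n::finite) \<le> 1"
    by (simp_all add: trad_def field_simps)
qed

lemma tpoint_ball: "tpoint L \<theta> \<in> ball 0 1"
proof -
  have "norm (tpoint L \<theta>) \<le> (\<Sum>i\<in>UNIV. norm (tpoint L \<theta> $ i))"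
    unfolding norm_vec_def by (rule L2_set_le_sum) auto
  also have "\<dots> = (\<Sum>i\<in>(UNIV :: 'a set). trad TYPE('a))"
    using trad_pos[where 'n='a] by (simp add: tpoint_def torus_point_def norm_mult less_imp_le)
  also have "\<dots> < 1" by (simp add: trad_def)
  finally show ?thesis by (simp add: mem_ball_0)
qed

lemma mpow_tpoint: "mpow (($) (tpoint L \<theta>)) \<alpha> = mpow (torus_point L (\<lambda>_. trad TYPE('n)) \<theta>) \<alpha>"
  for \<theta> :: "'n::finite mindex"
  by (simp add: tpoint_def mpow_def)

lemma cmod_mpow_le_1: "z \<in> ball 0 1 \<Longrightarrow> cmod (mpow (($) z) \<alpha>) \<le> 1"
proof -
  assume "z \<in> ball 0 1"
  then have "cmod (z $ i) \<le> 1" for i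
    using Finite_Cartesian_Product.norm_nth_le[of z i] by (simp add: mem_ball_0)
  then show ?thesis unfolding norm_mpow unfolding mpow_def by (intro prod_le_1) (auto intro: power_le_one)
qed

section \<open>Recovering the monomials from the kernel\<close>

context drury_arveson_space
begin

lemma szego_in [simp]: "z \<in> ball 0 1 \<Longrightarrow> szego z \<in> H"
  using kernel_mem[of z] by (simp add: szego_def)

lemma ip_szego: "g \<in> H \<Longrightarrow> z \<in> ball 0 1 \<Longrightarrow> ip g (szego z) = g z"
  using reproducing[of g z] by (simp add: szego_def)

lemma ip_szego_left: "g \<in> H \<Longrightarrow> z \<in> ball 0 1 \<Longrightarrow> ip (szego z) g = cnj (g z)"
  using ip_cnj[of g "szego z"] by (simp add: ip_szego)

lemma lim_in_pointwise:
  assumes "\<And>n. u n \<in> H" "g \<in> H" "lim_in u g"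
  shows "(\<lambda>n. u n z) \<longlonglongrightarrow> g z"
proof (cases "z \<in> ball 0 1")
  case True
  then show ?thesis using lim_in_ip_left[OF assms, of "szego z"] assms by (simp add: ip_szego)
next
  case False
  then show ?thesis using outside[OF assms(1)] outside[OF assms(2)] by simp
qed

lemma szego_sums:
  assumes "w \<in> ball 0 1" "z \<in> ball 0 1"
  shows "(\<lambda>n. herm w z ^ n) sums szego z w"
  using geometric_sums[OF cmod_herm_less_1[OF assms]] assms by (simp add: szego_def)

text \<open>Averages of reproducing kernels that isolate the monomial \<open>\<alpha>\<close> up to aliasing.\<close>

definition avg_kernel :: "nat \<Rightarrow> 'n mindex \<Rightarrow> complex ^ 'n \<Rightarrow> complex" where
  "avg_kernel L \<alpha> = (1 / of_nat L ^ CARD('n)) \<odot>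
     (\<Sum>\<theta>\<in>torus_grid L. mpow (($) (tpoint L \<theta>)) \<alpha> \<odot> szego (tpoint L \<theta>))"

text \<open>The factor with which \<open>monomial \<alpha>\<close> survives the averaging:
  \<open>multinom \<alpha>\<close> comes from the expansion of the kernel, and the modulus of the
  torus monomial enters twice, from the averaging factor and from the kernel.\<close>

definition acoef :: "'n mindex \<Rightarrow> real" where
  "acoef \<alpha> = multinom \<alpha> * trad TYPE('n) ^ (2 * deg \<alpha>)"

lemma acoef_pos: "acoef \<alpha> > 0"
  by (simp add: acoef_def trad_pos)

lemma avg_kernel_in: "avg_kernel L \<alpha> \<in> H"
  unfolding avg_kernel_def by (intro smul_in sum_in szego_in tpoint_ball)

lemma ip_avg_kernel:
  assumes "g \<in> H"
  shows "ip (avg_kernel L \<alpha>) g =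
    (1 / of_nat L ^ CARD('n)) * (\<Sum>\<theta>\<in>torus_grid L. mpow (($) (tpoint L \<theta>)) \<alpha> * cnj (g (tpoint L \<theta>)))"
proof -
  have in_H: "mpow (($) (tpoint L \<theta>)) \<alpha> \<odot> szego (tpoint L \<theta>) \<in> H" for \<theta>
    by (intro smul_in szego_in tpoint_ball)
  have "ip (avg_kernel L \<alpha>) g = (1 / of_nat L ^ CARD('n)) *
      ip (\<Sum>\<theta>\<in>torus_grid L. mpow (($) (tpoint L \<theta>)) \<alpha> \<odot> szego (tpoint L \<theta>)) g"
    unfolding avg_kernel_def by (intro ip_smul_left sum_in in_H assms)
  also have "ip (\<Sum>\<theta>\<in>torus_grid L. mpow (($) (tpoint L \<theta>)) \<alpha> \<odot> szego (tpoint L \<theta>)) g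
    = (\<Sum>\<theta>\<in>torus_grid L. mpow (($) (tpoint L \<theta>)) \<alpha> * cnj (g (tpoint L \<theta>)))"
    using assms by (simp add: ip_sum_left in_H ip_smul_left tpoint_ball ip_szego_left)
  finally show ?thesis .
qed

lemma avg_kernel_sums:
  assumes w: "w \<in> ball 0 1" and L: "L > 0"
  shows "(\<lambda>n. \<Sum>\<beta> | deg \<beta> = n. of_real (multinom \<beta>) * mpow (($) w) \<beta> *
      (if \<forall>i. \<alpha> i mod L = \<beta> i mod L then of_real (trad TYPE('n) ^ (deg \<alpha> + deg \<beta>)) else 0)) sums avg_kernel L \<alpha> w"
proof -
  let ?c = "1 / of_nat L ^ CARD('n) :: complex"
  have "(\<lambda>n. ?c * (\<Sum>\<theta>\<in>torus_grid L. mpow (($) (tpoint L \<theta>)) \<alpha> * herm w (tpoint L \<theta>) ^ n)) sums avg_kernel L \<alpha> w"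
    unfolding avg_kernel_def smul_apply sum_fun_apply
    by (intro sums_mult sums_sum szego_sums w tpoint_ball)
  moreover have "?c * (\<Sum>\<theta>\<in>torus_grid L. mpow (($) (tpoint L \<theta>)) \<alpha> * herm w (tpoint L \<theta>) ^ n)
    = (\<Sum>\<beta> | deg \<beta> = n. of_real (multinom \<beta>) * mpow (($) w) \<beta> *
      (if \<forall>i. \<alpha> i mod L = \<beta> i mod L then of_real (trad TYPE('n) ^ (deg \<alpha> + deg \<beta>)) else 0))" for n
  proof -
    have "?c * (\<Sum>\<theta>\<in>torus_grid L. mpow (($) (tpoint L \<theta>)) \<alpha> * herm w (tpoint L \<theta>) ^ n)
      = (\<Sum>\<theta>\<in>torus_grid L. \<Sum>\<beta> | deg \<beta> = n. of_real (multinom \<beta>) * mpow (($) w) \<beta> *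
          (?c * (mpow (($) (tpoint L \<theta>)) \<alpha> * cnj (mpow (($) (tpoint L \<theta>)) \<beta>))))"
      by (simp only: herm_power sum_distrib_left mult_ac)
    also have "\<dots> = (\<Sum>\<beta> | deg \<beta> = n. \<Sum>\<theta>\<in>torus_grid L. of_real (multinom \<beta>) * mpow (($) w) \<beta> *
          (?c * (mpow (($) (tpoint L \<theta>)) \<alpha> * cnj (mpow (($) (tpoint L \<theta>)) \<beta>))))"
      by (rule sum.swap)
    also have "\<dots> = (\<Sum>\<beta> | deg \<beta> = n. of_real (multinom \<beta>) * mpow (($) w) \<beta> *
          (?c * (\<Sum>\<theta>\<in>torus_grid L. mpow (($) (tpoint L \<theta>)) \<alpha> * cnj (mpow (($) (tpoint L \<theta>)) \<beta>))))"
      by (simp only: sum_distrib_left)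
    also have "\<dots> = (\<Sum>\<beta> | deg \<beta> = n. of_real (multinom \<beta>) * mpow (($) w) \<beta> *
      (if \<forall>i. \<alpha> i mod L = \<beta> i mod L then of_real (trad TYPE('n) ^ (deg \<alpha> + deg \<beta>)) else 0))"
      unfolding mpow_tpoint torus_orthogonality[OF L] using L
      by (intro sum.cong refl) (auto simp: mpow_const power_add)
    finally show ?thesis .
  qed
  ultimately show ?thesis by simp
qed

text \<open>An index other than \<alpha> that is aliased to \<alpha> has degree at least
  \<open>L\<close>. The radius \<open>trad\<close> adds up to 1/2 over the coordinates, so by the
  multinomial theorem the error in degree \<open>n\<close> is at most \<open>(1 / 2) ^ n\<close>,
  uniformly in \<open>w\<close>; summing from \<open>L\<close> on gives the bound.\<close>

lemma avg_kernel_close: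
  assumes w: "w \<in> ball 0 1" and L: "L > deg \<alpha>"
  shows "cmod (avg_kernel L \<alpha> w - of_real (acoef \<alpha>) * mpow (($) w) \<alpha>) \<le> 2 * (1 / 2) ^ L"
proof -
  let ?r = "trad TYPE('n)"
  define F where "F \<beta> = of_real (multinom \<beta>) * mpow (($) w) \<beta> *
      (if \<forall>i. \<alpha> i mod L = \<beta> i mod L then of_real (?r ^ (deg \<alpha> + deg \<beta>)) else 0)" for \<beta> :: "'n mindex"
  define t where "t n = (\<Sum>\<beta> | deg \<beta> = n. F \<beta>) - (if n = deg \<alpha> then F \<alpha> else 0)" for n
  have L0: "L > 0" using L by simp
  have Fa: "F \<alpha> = of_real (acoef \<alpha>) * mpow (($) w) \<alpha>"
    by (simp add: F_def acoef_def mult_ac flip: mult_2)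
  have s1: "(\<lambda>n. \<Sum>\<beta> | deg \<beta> = n. F \<beta>) sums avg_kernel L \<alpha> w"
    unfolding F_def by (rule avg_kernel_sums[OF w L0])
  have s2: "(\<lambda>n. if n = deg \<alpha> then F \<alpha> else 0) sums F \<alpha>"
    using sums_single[of "deg \<alpha>" "\<lambda>_. F \<alpha>"] by simp
  have sums: "t sums (avg_kernel L \<alpha> w - of_real (acoef \<alpha>) * mpow (($) w) \<alpha>)"
    unfolding t_def Fa[symmetric] by (intro sums_diff s1 s2)
  have bound: "cmod (t n) \<le> (if n < L then 0 else (1 / 2) ^ n)" for n
  proof -
    have "t n = (\<Sum>\<beta> | deg \<beta> = n. if \<beta> = \<alpha> then 0 else F \<beta>)"
    proof -
      have "(\<Sum>\<beta> | deg \<beta> = n. if \<beta> = \<alpha> then 0 else F \<beta>) = (\<Sum>\<beta> | deg \<beta> = n. F \<beta> - (if \<beta> = \<alpha> then F \<alpha> else 0))"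
        by (rule sum.cong) auto
      also have "\<dots> = t n" by (auto simp: t_def sum_subtractf)
      finally show ?thesis by simp
    qed
    also have "cmod \<dots> \<le> (\<Sum>\<beta> | deg \<beta> = n. cmod (if \<beta> = \<alpha> then 0 else F \<beta>))"
      by (rule norm_sum)
    also have "\<dots> \<le> (\<Sum>\<beta>\<in>{\<beta> :: 'n mindex. deg \<beta> = n}. if n < L then 0 else multinom \<beta> * mpow (\<lambda>i. ?r) \<beta>)"
    proof (rule sum_mono)
      fix \<beta> :: "'n mindex" assume "\<beta> \<in> {\<beta>. deg \<beta> = n}"
      then have \<beta>: "deg \<beta> = n" by simp
      show "cmod (if \<beta> = \<alpha> then 0 else F \<beta>) \<le> (if n < L then 0 else multinom \<beta> * mpow (\<lambda>i. ?r) \<beta>)"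
      proof (cases "n < L")
        case True
        have "F \<beta> = 0" if "\<beta> \<noteq> \<alpha>"
        proof -
          have "\<alpha> i mod L = \<alpha> i" "\<beta> i mod L = \<beta> i" for i
            using le_deg[of \<alpha> i] le_deg[of \<beta> i] L True \<beta> by auto
          then have "\<not> (\<forall>i. \<alpha> i mod L = \<beta> i mod L)" using that by (metis ext)
          then show ?thesis by (simp add: F_def del: not_all)
        qed
        then show ?thesis using True by simp
      next
        case False
        have r: "0 \<le> ?r" "?r \<le> 1" using trad_pos[where 'n='n] trad_le_1[where 'n='n] by simp_all
        have "cmod (F \<beta>) \<le> multinom \<beta> * 1 * ?r ^ (deg \<alpha> + deg \<beta>)"
          unfolding F_def norm_mult
          using cmod_mpow_le_1[OF w, of \<beta>] r by (intro mult_mono) (auto simp: norm_mult norm_power)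
        also have "\<dots> \<le> multinom \<beta> * ?r ^ deg \<beta>"
          using r by (auto simp: intro!: mult_left_mono power_decreasing)
        finally show ?thesis using False r by (simp add: mpow_const)
      qed
    qed
    also have "\<dots> = (if n < L then 0 else (\<Sum>i\<in>(UNIV :: 'n set). ?r) ^ n)"
      using multinomial[of "\<lambda>i::'n. ?r" n] by simp
    also have "(\<Sum>i\<in>(UNIV :: 'n set). ?r) = 1 / 2" by (simp add: trad_def)
    finally show ?thesis .
  qed
  have "(\<lambda>n. (1 / 2 :: real) ^ (n + L)) sums (2 * (1 / 2) ^ L)"
    using sums_mult[OF geometric_sums[of "1/2 :: real"], of "(1/2)^L"] by (simp add: power_add mult_ac)
  then have b: "(\<lambda>n. if n < L then 0 else (1 / 2 :: real) ^ n) sums (2 * (1 / 2) ^ L)"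
    using sums_iff_shift'[of "\<lambda>n. if n < L then 0 else (1 / 2 :: real) ^ n" L "2 * (1 / 2) ^ L"] by simp
  show ?thesis
    using norm_suminf_le[of t "\<lambda>n. if n < L then 0 else (1 / 2 :: real) ^ n"] bound b sums
    by (auto simp: sums_iff)
qed

text \<open>By the reproducing property the inner product is an average of values of
  \<open>avg_kernel M \<beta>\<close> over the grid of size \<open>L\<close>, and there that
  function is close to a multiple of its monomial. The error involves \<open>M\<close> alone, which
  permits the iterated limit in \<open>ip_monomial\<close>.\<close>

lemma ip_avg_kernel_close:
  assumes "L > deg \<alpha>" "L > deg \<beta>" "M > deg \<beta>"
  shows "cmod (ip (avg_kernel L \<alpha>) (avg_kernel M \<beta>) - (if \<alpha> = \<beta> then of_real (acoef \<alpha> * trad TYPE('n) ^ (2 * deg \<alpha>)) else 0))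
     \<le> 2 * (1 / 2) ^ M"
proof -
  let ?c = "1 / of_nat L ^ CARD('n) :: complex" and ?r = "trad TYPE('n)"
  let ?p = "\<lambda>\<theta>. mpow (($) (tpoint L \<theta>))"
  let ?d = "\<lambda>\<theta>. avg_kernel M \<beta> (tpoint L \<theta>) - of_real (acoef \<beta>) * ?p \<theta> \<beta>"
  have L: "L > 0" using assms by simp
  have eq: "(\<forall>i. \<alpha> i mod L = \<beta> i mod L) \<longleftrightarrow> \<alpha> = \<beta>"
    using le_deg[of \<alpha>] le_deg[of \<beta>] assms by (metis ext le_less_trans mod_less)
  have "?c * (\<Sum>\<theta>\<in>torus_grid L. ?p \<theta> \<alpha> * cnj (of_real (acoef \<beta>) * ?p \<theta> \<beta>))
    = of_real (acoef \<beta>) * (?c * (\<Sum>\<theta>\<in>torus_grid L. ?p \<theta> \<alpha> * cnj (?p \<theta> \<beta>)))"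
    by (simp add: sum_distrib_left sum_divide_distrib mult_ac)
  also have "\<dots> = (if \<alpha> = \<beta> then of_real (acoef \<alpha> * ?r ^ (2 * deg \<alpha>)) else 0)"
    unfolding mpow_tpoint torus_orthogonality[OF L] eq using L
    by (auto simp: mpow_const mult_2 power_add)
  finally have "ip (avg_kernel L \<alpha>) (avg_kernel M \<beta>) - (if \<alpha> = \<beta> then of_real (acoef \<alpha> * ?r ^ (2 * deg \<alpha>)) else 0)
    = ?c * (\<Sum>\<theta>\<in>torus_grid L. ?p \<theta> \<alpha> * cnj (avg_kernel M \<beta> (tpoint L \<theta>))) -
      ?c * (\<Sum>\<theta>\<in>torus_grid L. ?p \<theta> \<alpha> * cnj (of_real (acoef \<beta>) * ?p \<theta> \<beta>))"
    by (simp only: ip_avg_kernel[OF avg_kernel_in])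
  also have "\<dots> = ?c * (\<Sum>\<theta>\<in>torus_grid L. ?p \<theta> \<alpha> * cnj (?d \<theta>))"
    by (simp add: sum_subtractf right_diff_distrib diff_divide_distrib)
  also have "cmod \<dots> \<le> cmod ?c * (\<Sum>\<theta>\<in>(torus_grid L :: 'n mindex set). 2 * (1 / 2) ^ M)"
    unfolding norm_mult
  proof (intro mult_left_mono order_trans[OF norm_sum] sum_mono)
    fix \<theta> :: "'n mindex"
    have "cmod (?p \<theta> \<alpha> * cnj (?d \<theta>)) \<le> 1 * (2 * (1 / 2) ^ M)"
      unfolding norm_mult complex_mod_cnj
      by (intro mult_mono cmod_mpow_le_1 avg_kernel_close tpoint_ball assms) auto
    then show "cmod (?p \<theta> \<alpha> * cnj (?d \<theta>)) \<le> 2 * (1 / 2) ^ M" by simp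
  qed auto
  also have "\<dots> = 2 * (1 / 2) ^ M" using L by (simp add: card_torus_grid norm_divide norm_power)
  finally show ?thesis .
qed

text \<open>Nothing places the monomials in \<open>H\<close> a priori. All inner products of late
  averages are close to one and the same number, hence the averages form a Cauchy sequence; its
  limit is identified by point values.\<close>

lemma avg_kernel_lim:
  shows monomial_in [simp]: "monomial \<alpha> \<in> H"
    and lim_avg_kernel: "lim_in (\<lambda>L. avg_kernel L \<alpha>) (of_real (acoef \<alpha>) \<odot> monomial \<alpha>)"
proof -
  let ?u = "\<lambda>L. avg_kernel L \<alpha>"
  have b2: "(\<lambda>n. C * (1 / 2 :: real) ^ n) \<longlonglongrightarrow> 0" for C
    using tendsto_mult_right_zero[OF LIMSEQ_realpow_zero[of "1/2::real"]] by auto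
  obtain g where g: "g \<in> H" "lim_in ?u g"
  proof (rule Cauchy_lim[of ?u])
    fix e :: real assume "e > 0"
    then obtain N where N: "\<And>n. n \<ge> N \<Longrightarrow> 2 * (1 / 2 :: real) ^ n < e\<^sup>2 / 4"
      using order_tendstoD(2)[OF b2[of 2], of "e\<^sup>2 / 4"] by (auto simp: eventually_sequentially)
    have "nm (?u m - ?u n) < e" if mn: "m \<ge> max N (Suc (deg \<alpha>))" "n \<ge> max N (Suc (deg \<alpha>))" for m n
    proof -
      define v where "v = complex_of_real (acoef \<alpha> * trad TYPE('n) ^ (2 * deg \<alpha>))"
      have c: "cmod (ip (?u i) (?u j) - v) < e\<^sup>2 / 4"
        if "i \<ge> max N (Suc (deg \<alpha>))" "j \<ge> max N (Suc (deg \<alpha>))" for i j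
        using ip_avg_kernel_close[of \<alpha> i \<alpha> j] N[of j] that by (auto simp: v_def)
      have "(nm (?u m - ?u n))\<^sup>2 = Re ((ip (?u m) (?u m) - v) - (ip (?u m) (?u n) - v) - (ip (?u n) (?u m) - v) + (ip (?u n) (?u n) - v))"
        by (simp add: nm_sq ip_diff_left ip_diff_right avg_kernel_in)
      also have "\<dots> \<le> cmod ((ip (?u m) (?u m) - v) - (ip (?u m) (?u n) - v) - (ip (?u n) (?u m) - v) + (ip (?u n) (?u n) - v))"
        by (rule complex_Re_le_cmod)
      also have "\<dots> \<le> cmod (ip (?u m) (?u m) - v) + cmod (ip (?u m) (?u n) - v) + cmod (ip (?u n) (?u m) - v) + cmod (ip (?u n) (?u n) - v)"
        by (rule norm_triangle_le norm_triangle_le_diff add_mono order_refl)+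
      also have "\<dots> < e\<^sup>2"
        using c[OF mn(1) mn(1)] c[OF mn(1) mn(2)] c[OF mn(2) mn(1)] c[OF mn(2) mn(2)] by linarith
      finally show ?thesis using \<open>e > 0\<close> by (intro power2_less_imp_less[of _ e]) auto
    qed
    then show "\<exists>N. \<forall>m\<ge>N. \<forall>n\<ge>N. nm (?u m - ?u n) < e" by blast
  qed (auto simp: avg_kernel_in)
  have "g = of_real (acoef \<alpha>) \<odot> monomial \<alpha>"
  proof (rule ext)
    fix w
    show "g w = (of_real (acoef \<alpha>) \<odot> monomial \<alpha>) w"
    proof (cases "w \<in> ball 0 1")
      case True
      have "(\<lambda>L. ?u L w) \<longlonglongrightarrow> of_real (acoef \<alpha>) * mpow (($) w) \<alpha>"
      proof (rule LIM_zero_cancel, rule Lim_null_comparison[OF _ b2[of 2]])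
        show "\<forall>\<^sub>F n in sequentially. norm (?u n w - of_real (acoef \<alpha>) * mpow (($) w) \<alpha>) \<le> 2 * (1 / 2) ^ n"
          using avg_kernel_close[OF True] by (intro eventually_sequentiallyI[of "Suc (deg \<alpha>)"]) auto
      qed
      moreover have "(\<lambda>L. ?u L w) \<longlonglongrightarrow> g w" by (intro lim_in_pointwise g avg_kernel_in)
      ultimately show ?thesis using True LIMSEQ_unique by (auto simp: monomial_def)
    qed (use outside[OF g(1)] in \<open>simp add: monomial_def\<close>)
  qed
  then show *: "lim_in ?u (of_real (acoef \<alpha>) \<odot> monomial \<alpha>)" using g by simp
  have "monomial \<alpha> = of_real (1 / acoef \<alpha>) \<odot> g"
    using acoef_pos[of \<alpha>] by (simp add: \<open>g = _\<close>)
  then show "monomial \<alpha> \<in> H" using g by simp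
qed

text \<open>The averages are replaced by their limits one after the other: first in
  \<open>M\<close>, while the first argument is still an average, then in \<open>L\<close>. Division
  by the factors \<open>acoef\<close> leaves \<open>1 / multinom \<alpha>\<close>.\<close>

theorem ip_monomial: "ip (monomial \<alpha>) (monomial \<beta>) = (if \<alpha> = \<beta> then of_real (1 / multinom \<alpha>) else 0)"
proof -
  let ?v = "if \<alpha> = \<beta> then complex_of_real (acoef \<alpha> * trad TYPE('n) ^ (2 * deg \<alpha>)) else 0"
  let ?e = "\<lambda>\<alpha>. of_real (acoef \<alpha>) \<odot> monomial \<alpha>"
  have b2: "(\<lambda>n. 2 * (1 / 2 :: real) ^ n) \<longlonglongrightarrow> 0"
    using tendsto_mult_right_zero[OF LIMSEQ_realpow_zero[of "1/2::real"]] by auto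
  have "ip (avg_kernel L \<alpha>) (?e \<beta>) = ?v" if "L > deg \<alpha>" "L > deg \<beta>" for L
  proof (rule LIMSEQ_unique)
    show "(\<lambda>M. ip (avg_kernel L \<alpha>) (avg_kernel M \<beta>)) \<longlonglongrightarrow> ip (avg_kernel L \<alpha>) (?e \<beta>)"
      by (intro lim_in_ip_right avg_kernel_in lim_avg_kernel smul_in monomial_in)
    show "(\<lambda>M. ip (avg_kernel L \<alpha>) (avg_kernel M \<beta>)) \<longlonglongrightarrow> ?v"
    proof (rule LIM_zero_cancel, rule Lim_null_comparison[OF _ b2])
      show "\<forall>\<^sub>F M in sequentially. norm (ip (avg_kernel L \<alpha>) (avg_kernel M \<beta>) - ?v) \<le> 2 * (1 / 2) ^ M"
        using ip_avg_kernel_close[of \<alpha> L \<beta>] that by (intro eventually_sequentiallyI[of "Suc (deg \<beta>)"]) auto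
    qed
  qed
  then have "(\<lambda>L. ip (avg_kernel L \<alpha>) (?e \<beta>)) \<longlonglongrightarrow> ?v"
    by (intro tendsto_eventually eventually_sequentiallyI[of "Suc (max (deg \<alpha>) (deg \<beta>))"]) auto
  moreover have "(\<lambda>L. ip (avg_kernel L \<alpha>) (?e \<beta>)) \<longlonglongrightarrow> ip (?e \<alpha>) (?e \<beta>)"
    by (intro lim_in_ip_left avg_kernel_in lim_avg_kernel smul_in monomial_in)
  ultimately have "ip (?e \<alpha>) (?e \<beta>) = ?v" using LIMSEQ_unique by blast
  moreover have "ip (?e \<alpha>) (?e \<beta>) = of_real (acoef \<alpha>) * of_real (acoef \<beta>) * ip (monomial \<alpha>) (monomial \<beta>)"
    by (simp add: ip_smul_left ip_smul_right)
  ultimately have "of_real (acoef \<alpha>) * of_real (acoef \<beta>) * ip (monomial \<alpha>) (monomial \<beta>) = ?v"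
    by (simp only:)
  note * = this
  have pos: "acoef \<alpha> \<noteq> 0" "acoef \<beta> \<noteq> 0" "trad TYPE('n) \<noteq> 0"
    using acoef_pos[of \<alpha>] acoef_pos[of \<beta>] trad_pos[where 'n='n] by auto
  show ?thesis
  proof (cases "\<alpha> = \<beta>")
    case True
    then have "of_real (acoef \<alpha>) * ip (monomial \<alpha>) (monomial \<alpha>) = complex_of_real (trad TYPE('n) ^ (2 * deg \<alpha>))"
      using * pos by simp
    then have "of_real (trad TYPE('n) ^ (2 * deg \<alpha>)) * (of_real (multinom \<alpha>) * ip (monomial \<alpha>) (monomial \<alpha>)) = complex_of_real (trad TYPE('n) ^ (2 * deg \<alpha>)) * 1"
      by (simp add: acoef_def mult_ac)
    then have "of_real (multinom \<alpha>) * ip (monomial \<alpha>) (monomial \<alpha>) = 1"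
      using pos by (simp only: mult_cancel_left) auto
    then show ?thesis using True by (simp add: field_simps)
  qed (use * pos in auto)
qed

section \<open>Taylor coefficients and truncation to low degrees\<close>

definition coef :: "(complex ^ 'n \<Rightarrow> complex) \<Rightarrow> 'n mindex \<Rightarrow> complex" where
  "coef x \<alpha> = of_real (multinom \<alpha>) * ip x (monomial \<alpha>)"

definition proj :: "'n mindex set \<Rightarrow> (complex ^ 'n \<Rightarrow> complex) \<Rightarrow> complex ^ 'n \<Rightarrow> complex" where
  "proj A x = (\<Sum>\<alpha>\<in>A. coef x \<alpha> \<odot> monomial \<alpha>)"

lemma proj_in [simp]: "proj A x \<in> H"
  unfolding proj_def by (intro sum_in smul_in monomial_in)

lemma coef_add: "x \<in> H \<Longrightarrow> y \<in> H \<Longrightarrow> coef (x + y) \<alpha> = coef x \<alpha> + coef y \<alpha>"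
  and coef_diff: "x \<in> H \<Longrightarrow> y \<in> H \<Longrightarrow> coef (x - y) \<alpha> = coef x \<alpha> - coef y \<alpha>"
  and coef_smul: "x \<in> H \<Longrightarrow> coef (c \<odot> x) \<alpha> = c * coef x \<alpha>"
  by (simp_all add: coef_def ip_add_left ip_diff_left ip_smul_left algebra_simps)

lemma coef_sum: "(\<And>i. i \<in> A \<Longrightarrow> f i \<in> H) \<Longrightarrow> coef (sum f A) \<alpha> = (\<Sum>i\<in>A. coef (f i) \<alpha>)"
  by (simp add: coef_def ip_sum_left sum_distrib_left)

lemma coef_monomial: "coef (monomial \<beta>) \<alpha> = (if \<alpha> = \<beta> then 1 else 0)"
  by (simp add: coef_def ip_monomial)

lemma coef_zero [simp]: "coef 0 \<alpha> = 0"
  by (simp add: coef_def)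

lemma coef_lincomb: "finite A \<Longrightarrow> coef (\<Sum>\<beta>\<in>A. c \<beta> \<odot> monomial \<beta>) \<alpha> = (if \<alpha> \<in> A then c \<alpha> else 0)"
  by (simp add: coef_sum coef_smul coef_monomial if_distrib cong: if_cong)

lemma coef_proj: "finite A \<Longrightarrow> coef (proj A x) \<alpha> = (if \<alpha> \<in> A then coef x \<alpha> else 0)"
  unfolding proj_def by (rule coef_lincomb)

lemma proj_add: "x \<in> H \<Longrightarrow> y \<in> H \<Longrightarrow> proj A (x + y) = proj A x + proj A y"
  by (simp add: proj_def coef_add smul_distrib sum.distrib)

lemma proj_diff: "x \<in> H \<Longrightarrow> y \<in> H \<Longrightarrow> proj A (x - y) = proj A x - proj A y"
  by (simp add: proj_def coef_diff smul_distrib sum_subtractf)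

lemma proj_smul: "x \<in> H \<Longrightarrow> proj A (c \<odot> x) = c \<odot> proj A x"
  by (simp add: proj_def coef_smul smul_sum)

lemma proj_sum: "(\<And>i. i \<in> I \<Longrightarrow> f i \<in> H) \<Longrightarrow> proj A (sum f I) = (\<Sum>i\<in>I. proj A (f i))"
  by (induction I rule: infinite_finite_induct)
    (auto simp: proj_add sum_in proj_def[of _ 0] simp del: plus_fun_apply)

lemma proj_proj: "finite A \<Longrightarrow> finite B \<Longrightarrow> proj A (proj B x) = proj (A \<inter> B) x"
  unfolding proj_def[of A] proj_def[of "A \<inter> B"] coef_proj
  by (rule sum.mono_neutral_cong_right) (auto simp: coef_proj)

lemma proj_union_disjoint: "finite A \<Longrightarrow> finite B \<Longrightarrow> A \<inter> B = {} \<Longrightarrow> proj (A \<union> B) x = proj A x + proj B x"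
  unfolding proj_def by (rule sum.union_disjoint)

lemma proj_subset_diff: "finite A \<Longrightarrow> B \<subseteq> A \<Longrightarrow> proj A x - proj B x = proj (A - B) x"
  unfolding proj_def by (simp add: sum_diff)

lemma ip_proj_left: "x \<in> H \<Longrightarrow> y \<in> H \<Longrightarrow> ip (proj A x) y = (\<Sum>\<alpha>\<in>A. coef x \<alpha> * cnj (coef y \<alpha>) / of_real (multinom \<alpha>))"
  using ip_cnj[of y "monomial _"]
  by (simp add: proj_def ip_sum_left ip_smul_left) (simp add: coef_def ip_cnj[of y, symmetric] mult_ac)

lemma ip_proj_right: "x \<in> H \<Longrightarrow> y \<in> H \<Longrightarrow> ip x (proj A y) = (\<Sum>\<alpha>\<in>A. coef x \<alpha> * cnj (coef y \<alpha>) / of_real (multinom \<alpha>))"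
  using ip_cnj[of "proj A y" x] by (simp add: ip_proj_left mult.commute)

lemma ip_proj_swap: "x \<in> H \<Longrightarrow> y \<in> H \<Longrightarrow> ip (proj A x) y = ip x (proj A y)"
  by (simp add: ip_proj_left ip_proj_right)

lemma nm_proj_sq:
  assumes "finite A" "x \<in> H"
  shows "(nm (proj A x))\<^sup>2 = (\<Sum>\<alpha>\<in>A. (cmod (coef x \<alpha>))\<^sup>2 / multinom \<alpha>)"
proof -
  have "ip (proj A x) (proj A x) = (\<Sum>\<alpha>\<in>A. coef x \<alpha> * cnj (coef x \<alpha>) / of_real (multinom \<alpha>))"
    using assms by (simp add: ip_proj_left coef_proj)
  also have "\<dots> = of_real (\<Sum>\<alpha>\<in>A. (cmod (coef x \<alpha>))\<^sup>2 / multinom \<alpha>)"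
    by (simp add: complex_norm_square del: of_real_power)
  finally show ?thesis by (simp add: nm_sq)
qed

lemma nm_proj_split:
  assumes "finite A" "x \<in> H"
  shows "(nm x)\<^sup>2 = (nm (proj A x))\<^sup>2 + (nm (x - proj A x))\<^sup>2"
proof -
  have "ip (proj A x) (x - proj A x) = 0"
    using assms by (simp add: ip_diff_right ip_proj_left coef_proj)
  then show ?thesis using nm_add_sq[of "proj A x" "x - proj A x"] assms by simp
qed

lemma nm_proj_le: "finite A \<Longrightarrow> x \<in> H \<Longrightarrow> nm (proj A x) \<le> nm x"
  using nm_proj_split[of A x] by (intro power2_le_imp_le[of "nm (proj A x)"]) auto

lemma coef_le: "x \<in> H \<Longrightarrow> (cmod (coef x \<alpha>))\<^sup>2 \<le> multinom \<alpha> * (nm x)\<^sup>2"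
  using nm_proj_sq[of "{\<alpha>}" x] nm_proj_split[of "{\<alpha>}" x]
  by (simp add: field_simps)

abbreviation trunc :: "nat \<Rightarrow> (complex ^ 'n \<Rightarrow> complex) \<Rightarrow> complex ^ 'n \<Rightarrow> complex" where
  "trunc N \<equiv> proj {\<alpha>. deg \<alpha> < N}"

abbreviation hom :: "nat \<Rightarrow> (complex ^ 'n \<Rightarrow> complex) \<Rightarrow> complex ^ 'n \<Rightarrow> complex" where
  "hom n \<equiv> proj {\<alpha>. deg \<alpha> = n}"

lemma trunc_Suc: "trunc (Suc N) x = trunc N x + hom N x"
proof -
  have "{\<alpha> :: 'n mindex. deg \<alpha> < Suc N} = {\<alpha>. deg \<alpha> < N} \<union> {\<alpha>. deg \<alpha> = N}" by auto
  then show ?thesis by (simp add: proj_union_disjoint disjoint_iff del: plus_fun_apply)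
qed

lemma trunc_eq_sum_hom: "trunc N x = (\<Sum>n<N. hom n x)"
  by (induction N) (simp_all add: trunc_Suc del: plus_fun_apply, simp add: proj_def)

text \<open>The homogeneous components of the kernel have squared norms
  \<open>((norm z)\<^sup>2) ^ n\<close>, and their geometric series adds up to the squared norm of
  the kernel itself. By Pythagoras nothing is left over.\<close>

lemma lim_trunc_szego:
  assumes z: "z \<in> ball 0 1"
  shows "lim_in (\<lambda>N. trunc N (szego z)) (szego z)"
proof -
  let ?k = "szego z" and ?q = "(norm z)\<^sup>2"
  have q: "norm ?q < 1" using z by (simp add: mem_ball_0 power_less_one_iff abs_square_less_1)
  have coef: "coef ?k \<alpha> = of_real (multinom \<alpha>) * cnj (mpow (($) z) \<alpha>)" for \<alpha>
    using z by (simp add: coef_def ip_szego_left) (simp add: monomial_def)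
  have n1: "(nm ?k)\<^sup>2 = 1 / (1 - ?q)"
  proof -
    have "ip ?k ?k = 1 / (1 - complex_of_real ?q)"
      using z by (simp add: ip_szego) (simp add: szego_def herm_self)
    also have "\<dots> = complex_of_real (1 / (1 - ?q))" by simp
    finally show ?thesis using z by (simp only: nm_sq[OF szego_in[OF z]] Re_complex_of_real)
  qed
  have hn: "(\<Sum>\<alpha> | deg \<alpha> = n. (cmod (coef ?k \<alpha>))\<^sup>2 / multinom \<alpha>) = ?q ^ n" for n
  proof -
    have "complex_of_real (\<Sum>\<alpha> | deg \<alpha> = n. (cmod (coef ?k \<alpha>))\<^sup>2 / multinom \<alpha>) = herm z z ^ n"
      unfolding herm_power coef norm_mult power_mult_distrib
      by (simp add: power2_eq_square mult.assoc flip: complex_norm_square)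
    then show ?thesis unfolding herm_self of_real_power[symmetric] by (rule of_real_eq_iff[THEN iffD1])
  qed
  have n2: "(nm (trunc N ?k))\<^sup>2 = (\<Sum>n<N. ?q ^ n)" for N
  proof (induction N)
    case (Suc N)
    have "{\<alpha> :: 'n mindex. deg \<alpha> < Suc N} = {\<alpha>. deg \<alpha> < N} \<union> {\<alpha>. deg \<alpha> = N}" by auto
    then show ?case using Suc z
      by (simp add: nm_proj_sq sum.union_disjoint disjoint_iff hn)
  qed (simp add: proj_def)
  have "(\<lambda>N. (nm ?k)\<^sup>2 - (nm (trunc N ?k))\<^sup>2) \<longlonglongrightarrow> 1 / (1 - ?q) - 1 / (1 - ?q)"
    unfolding n1 n2 using geometric_sums[OF q] by (intro tendsto_intros) (simp add: sums_def)
  moreover have "(nm ?k)\<^sup>2 - (nm (trunc N ?k))\<^sup>2 = (nm (?k - trunc N ?k))\<^sup>2" for N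
    using nm_proj_split[of "{\<alpha>. deg \<alpha> < N}" ?k] z by simp
  ultimately have "(\<lambda>N. (nm (?k - trunc N ?k))\<^sup>2) \<longlonglongrightarrow> 0"
    by (simp only: diff_self)
  then have "(\<lambda>N. sqrt ((nm (?k - trunc N ?k))\<^sup>2)) \<longlonglongrightarrow> sqrt 0"
    by (rule tendsto_real_sqrt)
  then show ?thesis unfolding lim_in_def
    using z by (simp add: nm_minus_commute[of "proj _ ?k" ?k])
qed

text \<open>The truncations form a Cauchy sequence because their norms increase and stay bounded.
  The limit is \<open>x\<close>: truncation is self-adjoint, the claim is known for the kernels, and
  pairing with kernels gives the point values.\<close>

theorem lim_trunc:
  assumes x: "x \<in> H"
  shows "lim_in (\<lambda>N. trunc N x) x"
proof -
  have mono: "(nm (trunc N x - trunc M x))\<^sup>2 = (nm (trunc N x))\<^sup>2 - (nm (trunc M x))\<^sup>2" if "M \<le> N" for M N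
  proof -
    have "proj {\<alpha>. deg \<alpha> < M} (trunc N x) = trunc M x"
      using that by (subst proj_proj) (auto intro!: arg_cong[of _ _ "\<lambda>A. proj A x"])
    then show ?thesis using nm_proj_split[of "{\<alpha>. deg \<alpha> < M}" "trunc N x"] by simp
  qed
  have inc: "incseq (\<lambda>N. (nm (trunc N x))\<^sup>2)"
    unfolding incseq_def using mono by (metis diff_ge_0_iff_ge zero_le_power2)
  have bd: "(nm (trunc N x))\<^sup>2 \<le> (nm x)\<^sup>2" for N
    using nm_proj_le[of "{\<alpha>. deg \<alpha> < N}" x] x by (intro power_mono) auto
  obtain l where l: "(\<lambda>N. (nm (trunc N x))\<^sup>2) \<longlonglongrightarrow> l" "\<And>N. (nm (trunc N x))\<^sup>2 \<le> l"
    using incseq_convergent[OF inc, of "(nm x)\<^sup>2"] bd by auto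
  obtain y where y: "y \<in> H" "lim_in (\<lambda>N. trunc N x) y"
  proof (rule Cauchy_lim[of "\<lambda>N. trunc N x"])
    fix e :: real assume e: "e > 0"
    then obtain K where K: "\<And>n. n \<ge> K \<Longrightarrow> (nm (trunc n x))\<^sup>2 > l - e\<^sup>2"
      using order_tendstoD(1)[OF l(1), of "l - e\<^sup>2"] by (auto simp: eventually_sequentially)
    have *: "nm (trunc n x - trunc m x) < e" if "m \<ge> K" "m \<le> n" for m n
    proof -
      have "(nm (trunc n x - trunc m x))\<^sup>2 < e\<^sup>2"
        using mono[OF that(2)] K[OF that(1)] l(2)[of n] by linarith
      then show ?thesis using e by (intro power2_less_imp_less[of _ e]) auto
    qed
    have "nm (trunc n x - trunc m x) < e" if "m \<ge> K" "n \<ge> K" for m n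
      using *[of m n] *[of n m] that nm_minus_commute[of "trunc n x" "trunc m x"] by (cases "m \<le> n") auto
    then show "\<exists>N. \<forall>m\<ge>N. \<forall>n\<ge>N. nm (trunc m x - trunc n x) < e" by blast
  qed simp
  have "y = x"
  proof
    fix z
    show "y z = x z"
    proof (cases "z \<in> ball 0 1")
      case True
      have "(\<lambda>N. trunc N x z) \<longlonglongrightarrow> y z" by (intro lim_in_pointwise y) auto
      moreover have "(\<lambda>N. ip x (trunc N (szego z))) \<longlonglongrightarrow> ip x (szego z)"
        using True x by (intro lim_in_ip_right lim_trunc_szego) auto
      moreover have "ip x (trunc N (szego z)) = trunc N x z" for N
        using True x ip_proj_swap[of x "szego z"] ip_szego[of "trunc N x" z] by (simp)
      ultimately show ?thesis using True x LIMSEQ_unique by (auto simp: ip_szego)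
    qed (use outside[OF x] outside[OF y(1)] in simp)
  qed
  then show ?thesis using y by simp
qed

lemma eq_if_coef_eq:
  assumes "x \<in> H" "y \<in> H" "\<And>\<alpha>. coef x \<alpha> = coef y \<alpha>"
  shows "x = y"
proof
  fix z
  have "(\<lambda>N. trunc N x z) \<longlonglongrightarrow> x z" "(\<lambda>N. trunc N y z) \<longlonglongrightarrow> y z"
    using assms by (auto intro!: lim_in_pointwise lim_trunc)
  moreover have "trunc N x = trunc N y" for N using assms by (simp add: proj_def)
  ultimately show "x z = y z" using LIMSEQ_unique by auto
qed

end

section \<open>Multipliers\<close>

lemma powser_coeffs_eq:
  fixes a b :: "nat \<Rightarrow> complex"
  assumes "\<And>z. cmod z < 1 \<Longrightarrow> (\<lambda>n. a n * z ^ n) sums f z" "\<And>z. cmod z < 1 \<Longrightarrow> (\<lambda>n. b n * z ^ n) sums f z"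
  shows "a = b"
proof -
  have rad: "fps_conv_radius (Abs_fps c) > 0" if "\<And>z. cmod z < 1 \<Longrightarrow> (\<lambda>n. c n * z ^ n) sums f z" for c :: "nat \<Rightarrow> complex"
  proof -
    have "summable (\<lambda>n. c n * (1 / 2) ^ n)" using that[of "1 / 2"] by (auto simp: sums_iff)
    then have "ereal (norm (1 / 2 :: complex)) \<le> conv_radius c" by (intro conv_radius_geI)
    moreover have "ereal (norm (1 / 2 :: complex)) > 0" by simp
    ultimately have "conv_radius c > 0" by (rule less_le_trans[rotated])
    then show ?thesis by (simp add: fps_conv_radius_def)
  qed
  have "Abs_fps a = Abs_fps b"
  proof (rule eval_fps_eqD[OF rad rad])
    have "eval_fps (Abs_fps a) z = eval_fps (Abs_fps b) z" if "z \<in> ball 0 1" for z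
      using assms[of z] that by (simp add: eval_fps_def sums_iff mem_ball_0)
    then show "\<forall>\<^sub>F z in nhds 0. eval_fps (Abs_fps a) z = eval_fps (Abs_fps b) z"
      by (intro eventually_nhds_in_open[of "ball 0 1", THEN eventually_mono]) (auto simp: mem_ball_0)
  qed (use assms in blast)+
  then show ?thesis by (metis fps_nth_Abs_fps ext)
qed

lemma analytic_in_add: "analytic_in g U \<Longrightarrow> analytic_in h U \<Longrightarrow> analytic_in (\<lambda>z. g z + h z) U"
  unfolding analytic_in_def
proof
  fix z assume *: "\<forall>z\<in>U. \<exists>D. (g has_derivative D) (at z) \<and> (\<forall>c v. D (c *s v) = c * D v)"
    "\<forall>z\<in>U. \<exists>D. (h has_derivative D) (at z) \<and> (\<forall>c v. D (c *s v) = c * D v)" "z \<in> U"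
  obtain D E where "(g has_derivative D) (at z)" "\<forall>c v. D (c *s v) = c * D v"
    "(h has_derivative E) (at z)" "\<forall>c v. E (c *s v) = c * E v" using * by metis
  then show "\<exists>D. ((\<lambda>z. g z + h z) has_derivative D) (at z) \<and> (\<forall>c v. D (c *s v) = c * D v)"
    by (intro exI[of _ "\<lambda>v. D v + E v"]) (auto intro!: has_derivative_add simp: algebra_simps)
qed

lemma analytic_in_mult: "analytic_in g U \<Longrightarrow> analytic_in h U \<Longrightarrow> analytic_in (\<lambda>z. g z * h z) U"
  unfolding analytic_in_def
proof
  fix z assume *: "\<forall>z\<in>U. \<exists>D. (g has_derivative D) (at z) \<and> (\<forall>c v. D (c *s v) = c * D v)"
    "\<forall>z\<in>U. \<exists>D. (h has_derivative D) (at z) \<and> (\<forall>c v. D (c *s v) = c * D v)" "z \<in> U"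
  obtain D E where "(g has_derivative D) (at z)" "\<forall>c v. D (c *s v) = c * D v"
    "(h has_derivative E) (at z)" "\<forall>c v. E (c *s v) = c * E v" using * by metis
  then show "\<exists>D. ((\<lambda>z. g z * h z) has_derivative D) (at z) \<and> (\<forall>c v. D (c *s v) = c * D v)"
    by (intro exI[of _ "\<lambda>v. g z * E v + D v * h z"] conjI has_derivative_mult) (auto simp: algebra_simps)
qed

lemma analytic_in_const: "analytic_in (\<lambda>z. c) U"
  unfolding analytic_in_def by (auto intro!: exI[of _ "\<lambda>_. 0"])

lemma analytic_in_coord: "analytic_in (\<lambda>z. z $ i) U"
proof -
  have "((\<lambda>z. z $ i) has_derivative (\<lambda>v. v $ i)) (at z)" for z :: "complex ^ 'a"
    by (intro bounded_linear_imp_has_derivative bounded_linear_vec_nth)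
  then show ?thesis unfolding analytic_in_def by (auto intro!: exI[of _ "\<lambda>v. v $ i"])
qed

lemma analytic_in_power: "analytic_in g U \<Longrightarrow> analytic_in (\<lambda>z. g z ^ k) U"
  by (induction k) (auto intro: analytic_in_const analytic_in_mult)

lemma analytic_in_prod: "(\<And>i. i \<in> A \<Longrightarrow> analytic_in (g i) U) \<Longrightarrow> analytic_in (\<lambda>z. \<Prod>i\<in>A. g i z) U"
  by (induction A rule: infinite_finite_induct) (auto intro: analytic_in_const analytic_in_mult)

lemma analytic_in_sum: "(\<And>i. i \<in> A \<Longrightarrow> analytic_in (g i) U) \<Longrightarrow> analytic_in (\<lambda>z. \<Sum>i\<in>A. g i z) U"
  by (induction A rule: infinite_finite_induct) (auto intro: analytic_in_const analytic_in_add)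

lemma analytic_in_cong:
  assumes "open U" "\<And>z. z \<in> U \<Longrightarrow> g z = h z" "analytic_in g U"
  shows "analytic_in h U"
  using assms unfolding analytic_in_def by (meson has_derivative_transform_within_open)

lemma analytic_in_monomial: "analytic_in (monomial \<alpha>) (ball 0 1)"
proof (rule analytic_in_cong[of _ "\<lambda>z. \<Prod>i\<in>UNIV. (z $ i) ^ \<alpha> i"])
  show "analytic_in (\<lambda>z. \<Prod>i\<in>UNIV. (z $ i) ^ \<alpha> i) (ball 0 1)"
    by (intro analytic_in_prod analytic_in_power analytic_in_coord)
qed (auto simp: monomial_def mpow_def)

lemma monomial_mult: "monomial \<alpha> * monomial \<beta> = monomial (\<alpha> + \<beta>)"
  by (simp add: monomial_def fun_eq_iff mpow_add)

text \<open>The norms of monomials decrease along the order of multi-indices; this is why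
  multiplication by a monomial is a contraction.\<close>

lemma multinom_le_add: "multinom \<beta> \<le> multinom (\<alpha> + \<beta>)"
proof (induction "deg \<alpha>" arbitrary: \<alpha>)
  case 0
  then show ?case by (simp add: deg_eq_0[THEN iffD1, of \<alpha>])
next
  case (Suc k)
  then obtain i where i: "\<alpha> i \<noteq> 0" by (metis deg_eq_0 ext zero_fun_apply nat.distinct(1))
  define \<alpha>' where "\<alpha>' = \<alpha>(i := \<alpha> i - 1)"
  have eq: "\<alpha> = \<alpha>' + unit_index i" using i by (auto simp: \<alpha>'_def unit_index_def fun_eq_iff)
  have "deg \<alpha> = deg \<alpha>' + 1" unfolding eq deg_add by simp
  then have "multinom \<beta> \<le> multinom (\<alpha>' + \<beta>)" using Suc by (intro Suc(1)) simp
  also have "\<dots> \<le> multinom (\<alpha>' + \<beta> + unit_index i)" by (rule multinom_le_unit_index)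
  also have "\<alpha>' + \<beta> + unit_index i = \<alpha> + \<beta>" unfolding eq by (simp add: add_ac del: plus_fun_apply)
  finally show ?case .
qed

section \<open>Operator norms\<close>

context function_hilbert_space
begin

lemma op_bound:
  assumes "A \<in> bounded_ops H ip"
  obtains C where "C \<ge> 0" "\<And>h. h \<in> H \<Longrightarrow> nm (A h) \<le> C * nm h"
proof -
  obtain C where C: "\<And>h. h \<in> H \<Longrightarrow> nm (A h) \<le> C * nm h" using assms unfolding bounded_ops_def by blast
  have "nm (A h) \<le> max C 0 * nm h" if "h \<in> H" for h
    using C[OF that] mult_right_mono[of C "max C 0" "nm h"] that by auto
  then show ?thesis using that[of "max C 0"] by auto
qed

lemma op_in: "A \<in> bounded_ops H ip \<Longrightarrow> h \<in> H \<Longrightarrow> A h \<in> H"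
  by (simp add: bounded_ops_def)

lemma op_add: "A \<in> bounded_ops H ip \<Longrightarrow> g \<in> H \<Longrightarrow> h \<in> H \<Longrightarrow> A (g + h) = A g + A h"
  by (simp add: bounded_ops_def plus_fun_def)

lemma op_smul: "A \<in> bounded_ops H ip \<Longrightarrow> h \<in> H \<Longrightarrow> A (c \<odot> h) = c \<odot> A h"
  by (simp add: bounded_ops_def smul_def)

lemma op_norm_bdd_above:
  assumes "A \<in> bounded_ops H ip"
  shows "bdd_above {nm (A h) | h. h \<in> H \<and> nm h \<le> 1}"
proof -
  obtain C where C: "C \<ge> 0" "\<And>h. h \<in> H \<Longrightarrow> nm (A h) \<le> C * nm h" using op_bound[OF assms] by blast
  have "nm (A h) \<le> C" if "h \<in> H" "nm h \<le> 1" for h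
    using C(2)[OF that(1)] mult_left_mono[OF that(2) C(1)] by simp
  then show ?thesis by (auto intro!: bdd_aboveI[of _ C])
qed

lemma op_norm_unit: "A \<in> bounded_ops H ip \<Longrightarrow> h \<in> H \<Longrightarrow> nm h \<le> 1 \<Longrightarrow> nm (A h) \<le> op_norm H ip A"
  unfolding op_norm_def by (rule cSup_upper[OF _ op_norm_bdd_above]) auto

lemma op_norm_nonneg: "A \<in> bounded_ops H ip \<Longrightarrow> op_norm H ip A \<ge> 0"
  by (rule order_trans[OF nm_nonneg[OF op_in[of A 0]] op_norm_unit[of A 0]]) simp_all

lemma op_norm_bound:
  assumes A: "A \<in> bounded_ops H ip" and h: "h \<in> H"
  shows "nm (A h) \<le> op_norm H ip A * nm h"
proof (cases "nm h = 0")
  case True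
  then have "h = 0" using h nm_eq_0 by blast
  then show ?thesis using op_smul[OF A h, of 0] by simp
next
  case False
  then have pos: "nm h > 0" using nm_nonneg[OF h] by linarith
  have "nm (complex_of_real (1 / nm h) \<odot> h) \<le> 1"
    using h pos by (simp add: nm_smul norm_divide)
  then have "nm (A (complex_of_real (1 / nm h) \<odot> h)) \<le> op_norm H ip A"
    by (rule op_norm_unit[OF A smul_in[OF h]])
  moreover have "nm (A (complex_of_real (1 / nm h) \<odot> h)) = 1 / nm h * nm (A h)"
    unfolding op_smul[OF A h] nm_smul[OF op_in[OF A h]] norm_of_real using pos by simp
  ultimately have "1 / nm h * nm (A h) \<le> op_norm H ip A" by (simp only:)
  then show ?thesis using pos by (simp add: field_simps)
qed

lemma op_norm_le:
  assumes "\<And>h. h \<in> H \<Longrightarrow> nm (A h) \<le> C * nm h" "C \<ge> 0"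
  shows "op_norm H ip A \<le> C"
  unfolding op_norm_def
proof (rule cSup_least)
  show "{nm (A h) | h. h \<in> H \<and> nm h \<le> 1} \<noteq> {}" using zero_in nm_zero by (metis (mono_tags, lifting) empty_Collect_eq zero_le_one)
  fix x assume "x \<in> {nm (A h) | h. h \<in> H \<and> nm h \<le> 1}"
  then obtain h where "h \<in> H" "nm h \<le> 1" "x = nm (A h)" by blast
  then show "x \<le> C" using assms(1)[of h] mult_left_mono[of "nm h" 1 C] assms(2) by simp
qed

end

section \<open>Multiplication by polynomials\<close>

context drury_arveson_space
begin

abbreviation mnorm :: "(complex ^ 'n \<Rightarrow> complex) \<Rightarrow> real" where
  "mnorm \<equiv> mult_norm H ip"

lemma nm_lincomb: "finite A \<Longrightarrow> (nm (\<Sum>\<beta>\<in>A. c \<beta> \<odot> monomial \<beta>))\<^sup>2 = (\<Sum>\<beta>\<in>A. (cmod (c \<beta>))\<^sup>2 / multinom \<beta>)"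
proof -
  assume A: "finite A"
  have "(nm (monomial \<beta>))\<^sup>2 = 1 / multinom \<beta>" for \<beta> by (simp add: nm_sq ip_monomial)
  then have "(nm (c \<beta> \<odot> monomial \<beta>))\<^sup>2 = (cmod (c \<beta>))\<^sup>2 / multinom \<beta>" for \<beta>
    by (simp add: nm_smul power_mult_distrib)
  then show ?thesis using A by (subst nm_sum_orthogonal) (auto simp: ip_smul_left ip_smul_right ip_monomial)
qed

text \<open>A closure argument for a \<open>g\<close> not yet known to be a multiplier: the bound on
  differences of truncations makes \<open>g * trunc N x\<close> a Cauchy sequence, and its norm
  limit must be the pointwise limit \<open>g * x\<close>.\<close>

lemma mult_extend:
  assumes mem: "\<And>N. g * trunc N x \<in> H" and x: "x \<in> H" and C: "C \<ge> 0"
    and bd: "\<And>M N. nm (g * (trunc M x - trunc N x)) \<le> C * nm (trunc M x - trunc N x)"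
  shows "g * x \<in> H" "nm (g * x) \<le> C * nm x"
proof -
  obtain y where y: "y \<in> H" "lim_in (\<lambda>N. g * trunc N x) y"
  proof (rule Cauchy_lim[of "\<lambda>N. g * trunc N x"])
    fix e :: real assume e: "e > 0"
    obtain N where N: "\<And>n. n \<ge> N \<Longrightarrow> nm (trunc n x - x) < e / (2 * (C + 1))"
      using order_tendstoD(2)[OF lim_trunc[OF x, unfolded lim_in_def], of "e / (2 * (C + 1))"] e C
      by (auto simp: eventually_sequentially)
    have "nm (g * trunc m x - g * trunc n x) < e" if "m \<ge> N" "n \<ge> N" for m n
    proof -
      have "nm (trunc m x - trunc n x) \<le> nm (trunc m x - x) + nm (trunc n x - x)"
        using nm_dist_triangle[of "trunc m x" x "trunc n x"] nm_minus_commute[of x "trunc n x"] x by simp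
      also have "\<dots> < e / (2 * (C + 1)) + e / (2 * (C + 1))" using N that by (intro add_strict_mono) auto
      also have "\<dots> = e / (C + 1)"
      proof -
        have "e / (2 * (C + 1)) = e / (C + 1) / 2" by simp
        then show ?thesis by (simp only: field_sum_of_halves)
      qed
      finally have *: "nm (trunc m x - trunc n x) < e / (C + 1)" .
      have "nm (g * trunc m x - g * trunc n x) \<le> C * nm (trunc m x - trunc n x)"
        using bd[of m n] by (simp add: right_diff_distrib del: minus_apply times_fun_apply)
      also have "\<dots> \<le> (C + 1) * nm (trunc m x - trunc n x)" by (intro mult_right_mono) auto
      also have "\<dots> < (C + 1) * (e / (C + 1))" using * C by (intro mult_strict_left_mono) auto
      finally show ?thesis using C by simp
    qed
    then show "\<exists>N. \<forall>m\<ge>N. \<forall>n\<ge>N. nm (g * trunc m x - g * trunc n x) < e" by blast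
  qed (rule mem)
  have "y z = (g * x) z" for z
  proof -
    have "(\<lambda>N. (g * trunc N x) z) \<longlonglongrightarrow> y z" by (intro lim_in_pointwise mem y)
    moreover have "(\<lambda>N. (g * trunc N x) z) \<longlonglongrightarrow> (g * x) z"
      unfolding times_fun_apply by (intro tendsto_mult_left lim_in_pointwise lim_trunc x) simp
    ultimately show ?thesis using LIMSEQ_unique by blast
  qed
  then have yx: "y = g * x" by blast
  then show "g * x \<in> H" using y by simp
  show "nm (g * x) \<le> C * nm x"
  proof (rule LIMSEQ_le)
    show "(\<lambda>N. nm (g * trunc N x)) \<longlonglongrightarrow> nm (g * x)" using y yx by (intro lim_in_nm mem) auto
    show "(\<lambda>N. C * nm (trunc N x)) \<longlonglongrightarrow> C * nm x"
      by (intro tendsto_mult_left lim_in_nm lim_trunc x) simp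
    have "nm (g * trunc N x) \<le> C * nm (trunc N x)" for N
    proof -
      have "trunc 0 x = 0" by (simp add: proj_def)
      then show ?thesis using bd[of N 0] by (simp del: minus_apply times_fun_apply)
    qed
    then show "\<exists>N. \<forall>n\<ge>N. nm (g * trunc n x) \<le> C * nm (trunc n x)" by blast
  qed
qed

lemma monomial_mult_proj: "monomial \<alpha> * proj A x = (\<Sum>\<beta>\<in>A. coef x \<beta> \<odot> monomial (\<alpha> + \<beta>))"
  unfolding proj_def sum_distrib_left by (simp add: monomial_mult del: times_fun_apply)

text \<open>The terms are shifted injectively, so they stay orthogonal, and the norm of each can
  only decrease.\<close>

lemma nm_monomial_mult_proj:
  assumes A: "finite A" and x: "x \<in> H"
  shows "nm (monomial \<alpha> * proj A x) \<le> nm (proj A x)"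
proof -
  have inj: "inj_on (\<lambda>\<beta>. \<alpha> + \<beta>) A" by (auto intro: inj_onI)
  have "monomial \<alpha> * proj A x = (\<Sum>\<gamma>\<in>(\<lambda>\<beta>. \<alpha> + \<beta>) ` A. coef x (\<gamma> - \<alpha>) \<odot> monomial \<gamma>)"
    unfolding monomial_mult_proj sum.reindex[OF inj] by (simp del: plus_fun_apply)
  then have "(nm (monomial \<alpha> * proj A x))\<^sup>2 = (\<Sum>\<gamma>\<in>(\<lambda>\<beta>. \<alpha> + \<beta>) ` A. (cmod (coef x (\<gamma> - \<alpha>)))\<^sup>2 / multinom \<gamma>)"
    using A by (simp only: nm_lincomb finite_imageI)
  also have "\<dots> = (\<Sum>\<beta>\<in>A. (cmod (coef x \<beta>))\<^sup>2 / multinom (\<alpha> + \<beta>))"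
    unfolding sum.reindex[OF inj] by (simp del: plus_fun_apply)
  also have "\<dots> \<le> (\<Sum>\<beta>\<in>A. (cmod (coef x \<beta>))\<^sup>2 / multinom \<beta>)"
    by (intro sum_mono divide_left_mono multinom_le_add mult_pos_pos) auto
  also have "\<dots> = (nm (proj A x))\<^sup>2" using A x by (simp add: nm_proj_sq)
  finally show ?thesis by (rule power2_le_imp_le) simp
qed

lemma monomial_mult_in: "x \<in> H \<Longrightarrow> monomial \<alpha> * x \<in> H"
  and nm_monomial_mult: "x \<in> H \<Longrightarrow> nm (monomial \<alpha> * x) \<le> nm x"
proof -
  assume x: "x \<in> H"
  have bd: "nm (monomial \<alpha> * (trunc M x - trunc N x)) \<le> 1 * nm (trunc M x - trunc N x)" for M N
  proof -
    have *: "nm (monomial \<alpha> * (trunc M x - trunc N x)) \<le> nm (trunc M x - trunc N x)" if "N \<le> M" for M N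
      using that nm_monomial_mult_proj[OF _ x, of "{\<alpha>. deg \<alpha> < M} - {\<alpha>. deg \<alpha> < N}"]
      by (subst (1 2) proj_subset_diff) auto
    have neg: "monomial \<alpha> * (trunc M x - trunc N x) = - (monomial \<alpha> * (trunc N x - trunc M x))"
      by (simp add: algebra_simps fun_eq_iff)
    have mem: "monomial \<alpha> * (trunc N x - trunc M x) \<in> H"
      unfolding right_diff_distrib monomial_mult_proj by (intro diff_in sum_in smul_in monomial_in)
    show ?thesis
    proof (cases "N \<le> M")
      case False
      have "nm (monomial \<alpha> * (trunc M x - trunc N x)) = nm (monomial \<alpha> * (trunc N x - trunc M x))"
        unfolding neg by (rule nm_uminus[OF mem])
      then show ?thesis using False *[of M N] nm_minus_commute[of "trunc M x" "trunc N x"] by simp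
    qed (use * in simp)
  qed
  have mem: "monomial \<alpha> * trunc N x \<in> H" for N
    unfolding monomial_mult_proj by (intro sum_in smul_in monomial_in)
  show "monomial \<alpha> * x \<in> H" "nm (monomial \<alpha> * x) \<le> nm x"
    using mult_extend[of "monomial \<alpha>" x 1, OF mem x _ bd] by auto
qed

definition polys :: "(complex ^ 'n \<Rightarrow> complex) set" where
  "polys = {(\<Sum>\<alpha>\<in>A. c \<alpha> \<odot> monomial \<alpha>) | A c. finite A}"

lemma ball_polynomials_eq: "ball_polynomials = polys"
proof -
  have "(\<lambda>z. if z \<in> ball 0 1 then \<Sum>\<alpha>\<in>A. c \<alpha> * (\<Prod>i\<in>UNIV. (z $ i) ^ \<alpha> i) else 0)
      = (\<Sum>\<alpha>\<in>A. c \<alpha> \<odot> monomial \<alpha>)" for A :: "'n mindex set" and c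
    by (auto simp: fun_eq_iff sum_fun_apply monomial_def mpow_def)
  then show ?thesis unfolding ball_polynomials_def polys_def by simp
qed

lemma polys_mult:
  assumes "p \<in> polys"
  shows "\<exists>C\<ge>0. \<forall>x\<in>H. p * x \<in> H \<and> nm (p * x) \<le> C * nm x"
proof -
  obtain A c where p: "p = (\<Sum>\<alpha>\<in>A. c \<alpha> \<odot> monomial \<alpha>)" "finite A" using assms by (auto simp: polys_def)
  have "p * x \<in> H \<and> nm (p * x) \<le> (\<Sum>\<alpha>\<in>A. cmod (c \<alpha>)) * nm x" if x: "x \<in> H" for x
  proof -
    have px: "p * x = (\<Sum>\<alpha>\<in>A. c \<alpha> \<odot> (monomial \<alpha> * x))"
      unfolding p sum_distrib_right by simp
    have mem: "c \<alpha> \<odot> (monomial \<alpha> * x) \<in> H" for \<alpha> using x by (intro smul_in monomial_mult_in)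
    have "nm (p * x) \<le> (\<Sum>\<alpha>\<in>A. nm (c \<alpha> \<odot> (monomial \<alpha> * x)))"
      unfolding px by (rule nm_sum_le) (rule mem)
    also have "\<dots> \<le> (\<Sum>\<alpha>\<in>A. cmod (c \<alpha>) * nm x)"
      using x by (intro sum_mono) (simp add: nm_smul monomial_mult_in nm_monomial_mult mult_left_mono)
    finally show ?thesis unfolding px using mem by (auto intro!: sum_in simp: sum_distrib_right)
  qed
  moreover have "(\<Sum>\<alpha>\<in>A. cmod (c \<alpha>)) \<ge> 0" by (intro sum_nonneg) auto
  ultimately show ?thesis by blast
qed

lemma polys_mult_in: "p \<in> polys \<Longrightarrow> x \<in> H \<Longrightarrow> p * x \<in> H"
  using polys_mult by blast

lemma multipliersI: "analytic_in g (ball 0 1) \<Longrightarrow> (\<And>z. z \<notin> ball 0 1 \<Longrightarrow> g z = 0) \<Longrightarrow> (\<And>h. h \<in> H \<Longrightarrow> g * h \<in> H) \<Longrightarrow> g \<in> multipliers H"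
  by (simp add: multipliers_def times_fun_def)

lemma multipliers_mult_in: "g \<in> multipliers H \<Longrightarrow> h \<in> H \<Longrightarrow> g * h \<in> H"
  by (simp add: multipliers_def times_fun_def)

lemma multipliers_in: "g \<in> multipliers H \<Longrightarrow> g \<in> H"
proof -
  assume g: "g \<in> multipliers H"
  have "g * monomial 0 = g" using g by (auto simp: multipliers_def monomial_def fun_eq_iff)
  then show ?thesis using multipliers_mult_in[OF g monomial_in[of 0]] by simp
qed

lemma multipliers_add: "g \<in> multipliers H \<Longrightarrow> h \<in> multipliers H \<Longrightarrow> g + h \<in> multipliers H"
  using analytic_in_add[of g _ h]
  by (intro multipliersI) (auto simp: multipliers_def plus_fun_def distrib_right times_fun_def intro: add_mem)

lemma multipliers_smul: "g \<in> multipliers H \<Longrightarrow> c \<odot> g \<in> multipliers H"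
  using analytic_in_mult[OF analytic_in_const[of c], of g] 
  by (intro multipliersI) (auto simp: multipliers_def smul_def times_fun_def mult.assoc intro: scale_mem)

lemma multipliers_diff: "g \<in> multipliers H \<Longrightarrow> h \<in> multipliers H \<Longrightarrow> g - h \<in> multipliers H"
  using multipliers_add[of g "(-1) \<odot> h"] multipliers_smul[of h "-1"] by (simp add: uminus_eq_smul[symmetric])

lemma polys_multipliers: "p \<in> polys \<Longrightarrow> p \<in> multipliers H"
proof (rule multipliersI)
  assume "p \<in> polys"
  then obtain A c where p: "p = (\<Sum>\<alpha>\<in>A. c \<alpha> \<odot> monomial \<alpha>)" "finite A" by (auto simp: polys_def)
  have "analytic_in (\<lambda>z. \<Sum>\<alpha>\<in>A. c \<alpha> * monomial \<alpha> z) (ball 0 1)"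
    by (intro analytic_in_sum analytic_in_mult analytic_in_const analytic_in_monomial)
  moreover have "(\<lambda>z. \<Sum>\<alpha>\<in>A. c \<alpha> * monomial \<alpha> z) = p" by (simp add: p fun_eq_iff sum_fun_apply)
  ultimately show "analytic_in p (ball 0 1)" by simp
  show "p z = 0" if "z \<notin> ball 0 1" for z using that by (simp add: p sum_fun_apply monomial_def)
qed (rule polys_mult_in)

section \<open>Homogeneous components of products and boundedness of multipliers\<close>

lemma hom_sums: "x \<in> H \<Longrightarrow> (\<lambda>n. hom n x z) sums x z"
proof -
  assume x: "x \<in> H"
  have "(\<lambda>N. trunc N x z) \<longlonglongrightarrow> x z" by (intro lim_in_pointwise lim_trunc x) simp
  then show ?thesis unfolding sums_def trunc_eq_sum_hom sum_fun_apply .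
qed

lemma hom_scale:
  assumes z: "z \<in> ball 0 1" and l: "cmod l \<le> 1"
  shows "hom n x (l *s z) = l ^ n * hom n x z" "l *s z \<in> ball 0 1"
proof -
  have "norm (l *s z) = cmod l * norm z"
    by (simp add: norm_vec_def norm_mult L2_set_right_distrib vector_scalar_mult_def)
  then show lz: "l *s z \<in> ball 0 1" using z l mult_mono[of "cmod l" 1 "norm z" "norm z"] by (simp add: mem_ball_0)
  have "mpow (($) (l *s z)) \<alpha> = l ^ deg \<alpha> * mpow (($) z) \<alpha>" for \<alpha>
    using mpow_scale[of l "($) z" \<alpha>] by (simp add: mpow_def vector_scalar_mult_def)
  then show "hom n x (l *s z) = l ^ n * hom n x z"
    using z lz by (simp add: proj_def sum_fun_apply monomial_def sum_distrib_left mult_ac)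
qed

text \<open>Along the line through \<open>z\<close> each function is a power series in the scalar
  \<open>l\<close> whose coefficients are the values at \<open>z\<close> of its homogeneous
  components. Uniqueness of these coefficients turns the Cauchy product into the convolution
  formula.\<close>

theorem hom_mult:
  assumes g: "g \<in> H" and x: "x \<in> H" and gx: "g * x \<in> H"
  shows "hom n (g * x) = (\<Sum>k\<le>n. hom k g * hom (n - k) x)"
proof
  fix z
  show "hom n (g * x) z = (\<Sum>k\<le>n. hom k g * hom (n - k) x) z"
  proof (cases "z \<in> ball 0 1")
    case True
    have s: "(\<lambda>n. hom n y z * l ^ n) sums y (l *s z)" if "y \<in> H" "cmod l \<le> 1" for y l
      using hom_sums[OF that(1), of "l *s z"] hom_scale[OF True that(2)] by (simp add: mult.commute)
    have abs: "summable (\<lambda>n. norm (hom n y z * l ^ n))" if "y \<in> H" "cmod l < 1" for y l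
      using powser_insidea[of "\<lambda>n. hom n y z" 1 l] s[OF that(1), of 1] that by (auto simp: sums_iff)
    have "(\<lambda>n. hom n (g * x) z) = (\<lambda>n. \<Sum>k\<le>n. hom k g z * hom (n - k) x z)"
    proof (rule powser_coeffs_eq[where f = "\<lambda>l. (g * x) (l *s z)"])
      fix l assume l: "cmod l < 1"
      show "(\<lambda>n. hom n (g * x) z * l ^ n) sums (g * x) (l *s z)" using gx l by (intro s) auto
      have "(\<lambda>n. \<Sum>k\<le>n. (hom k g z * l ^ k) * (hom (n - k) x z * l ^ (n - k))) sums
          ((\<Sum>n. hom n g z * l ^ n) * (\<Sum>n. hom n x z * l ^ n))"
        using g x l by (intro Cauchy_product_sums abs)
      also have "(\<Sum>n. hom n g z * l ^ n) * (\<Sum>n. hom n x z * l ^ n) = (g * x) (l *s z)"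
        using s[OF g, of l] s[OF x, of l] l by (simp add: sums_iff)
      also have "(\<lambda>n. \<Sum>k\<le>n. (hom k g z * l ^ k) * (hom (n - k) x z * l ^ (n - k)))
         = (\<lambda>n. (\<Sum>k\<le>n. hom k g z * hom (n - k) x z) * l ^ n)"
        by (rule ext, simp add: sum_distrib_right, rule sum.cong[OF refl])
          (simp add: mult_ac flip: power_add)
      finally show "(\<lambda>n. (\<Sum>k\<le>n. hom k g z * hom (n - k) x z) * l ^ n) sums (g * x) (l *s z)" .
    qed
    then show ?thesis by (simp add: sum_fun_apply fun_eq_iff)
  next
    case False
    then show ?thesis by (simp add: sum_fun_apply proj_def monomial_def)
  qed
qed

lemma proj_polys: "finite A \<Longrightarrow> proj A x \<in> polys"
  unfolding proj_def polys_def by blast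

text \<open>Uniform boundedness applies to the seminorms \<open>h \<mapsto> \<parallel>trunc N (g h)\<parallel>\<close>, which are continuous
  because they only involve polynomial multipliers.\<close>

theorem multiplier_bounded:
  assumes g: "g \<in> multipliers H"
  obtains C where "C \<ge> 0" "\<And>h. h \<in> H \<Longrightarrow> nm (g * h) \<le> C * nm h"
proof -
  have gH: "g \<in> H" and gh: "\<And>h. h \<in> H \<Longrightarrow> g * h \<in> H"
    using g multipliers_in multipliers_mult_in by auto
  have "\<exists>C. \<forall>N. \<forall>h\<in>H. nm (trunc N (g * h)) \<le> C * nm h"
  proof (rule uniform_boundedness)
    fix N h c assume h: "h \<in> H"
    show "nm (trunc N (g * (c \<odot> h))) = cmod c * nm (trunc N (g * h))"
      using h by (simp add: proj_smul gh nm_smul del: times_fun_apply)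
  next
    fix N a b assume "a \<in> H" "b \<in> H"
    then show "nm (trunc N (g * (a + b))) \<le> nm (trunc N (g * a)) + nm (trunc N (g * b))"
      using nm_triangle[of "trunc N (g * a)" "trunc N (g * b)"]
      by (simp add: distrib_left proj_add gh del: plus_fun_apply times_fun_apply)
  next
    fix N
    obtain K where K: "\<And>k. K k \<ge> 0" "\<And>k x. x \<in> H \<Longrightarrow> nm (hom k g * x) \<le> K k * nm x"
    proof -
      have "\<forall>k. \<exists>C\<ge>0. \<forall>x\<in>H. hom k g * x \<in> H \<and> nm (hom k g * x) \<le> C * nm x"
        using polys_mult[OF proj_polys] by simp
      then obtain K where "\<forall>k. K k \<ge> 0 \<and> (\<forall>x\<in>H. hom k g * x \<in> H \<and> nm (hom k g * x) \<le> K k * nm x)" by metis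
      then show ?thesis using that[of K] by blast
    qed
    have mem: "hom k g * hom l h \<in> H" for k l h by (intro polys_mult_in proj_polys) auto
    \<comment> \<open>The constant may depend on \<open>N\<close>:
      \<open>uniform_boundedness\<close> asks for the continuity of each seminorm separately and
      returns the uniformity.\<close>
    show "\<exists>C. \<forall>h\<in>H. nm (trunc N (g * h)) \<le> C * nm h"
    proof (intro exI[of _ "\<Sum>n<N. \<Sum>k\<le>n. K k"] ballI)
      fix h assume h: "h \<in> H"
      have "nm (trunc N (g * h)) \<le> (\<Sum>n<N. nm (hom n (g * h)))"
        unfolding trunc_eq_sum_hom by (rule nm_sum_le) simp
      also have "\<dots> \<le> (\<Sum>n<N. \<Sum>k\<le>n. nm (hom k g * hom (n - k) h))"
        unfolding hom_mult[OF gH h gh[OF h]] by (intro sum_mono nm_sum_le mem)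
      also have "\<dots> \<le> (\<Sum>n<N. \<Sum>k\<le>n. K k * nm h)"
      proof (intro sum_mono)
        fix n k
        have "nm (hom k g * hom (n - k) h) \<le> K k * nm (hom (n - k) h)" by (intro K) simp
        also have "\<dots> \<le> K k * nm h" using h by (intro mult_left_mono K nm_proj_le) auto
        finally show "nm (hom k g * hom (n - k) h) \<le> K k * nm h" .
      qed
      finally show "nm (trunc N (g * h)) \<le> (\<Sum>n<N. \<Sum>k\<le>n. K k) * nm h" by (simp add: sum_distrib_right)
    qed
  next
    fix h assume h: "h \<in> H"
    show "\<exists>B. \<forall>N. nm (trunc N (g * h)) \<le> B"
      using nm_proj_le[OF _ gh[OF h]] by (intro exI[of _ "nm (g * h)"]) auto
  qed
  then obtain C where C: "\<And>N h. h \<in> H \<Longrightarrow> nm (trunc N (g * h)) \<le> C * nm h" by blast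
  have "nm (g * h) \<le> max C 0 * nm h" if h: "h \<in> H" for h
  proof (rule LIMSEQ_le_const2)
    show "(\<lambda>N. nm (trunc N (g * h))) \<longlonglongrightarrow> nm (g * h)"
      by (intro lim_in_nm lim_trunc gh h) simp
    have "C * nm h \<le> max C 0 * nm h" using h by (intro mult_right_mono) auto
    then have "nm (trunc n (g * h)) \<le> max C 0 * nm h" for n using C[OF h, of n] by linarith
    then show "\<exists>N. \<forall>n\<ge>N. nm (trunc n (g * h)) \<le> max C 0 * nm h" by blast
  qed
  then show ?thesis using that[of "max C 0"] by auto
qed

lemma mult_op_apply: "h \<in> H \<Longrightarrow> mult_op H g h = g * h"
  by (simp add: mult_op_def times_fun_def)

lemma mult_op_bounded: "g \<in> multipliers H \<Longrightarrow> mult_op H g \<in> bounded_ops H ip"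
proof -
  assume g: "g \<in> multipliers H"
  obtain C where C: "\<And>h. h \<in> H \<Longrightarrow> nm (g * h) \<le> C * nm h" using multiplier_bounded[OF g] by blast
  show ?thesis
    unfolding bounded_ops_def
  proof (intro CollectI conjI allI ballI impI)
    show "mult_op H g h = 0" if "h \<notin> H" for h using that by (simp add: mult_op_def)
    show "mult_op H g h \<in> H" if "h \<in> H" for h using that g by (simp add: mult_op_apply multipliers_mult_in)
    show "mult_op H g (\<lambda>x. a x + b x) = (\<lambda>x. mult_op H g a x + mult_op H g b x)" if "a \<in> H" "b \<in> H" for a b
      using that add_mem[of a b] by (simp add: mult_op_def distrib_left)
    show "mult_op H g (\<lambda>x. c * h x) = (\<lambda>x. c * mult_op H g h x)" if "h \<in> H" for c h
      using that scale_mem[of h c] by (simp add: mult_op_def mult_ac)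
    show "\<exists>C. \<forall>h\<in>H. nm (mult_op H g h) \<le> C * nm h"
      using C by (auto simp: mult_op_apply simp del: times_fun_apply)
  qed
qed

lemma nm_mult_le: "g \<in> multipliers H \<Longrightarrow> h \<in> H \<Longrightarrow> nm (g * h) \<le> mnorm g * nm h"
  using op_norm_bound[OF mult_op_bounded, of g h] by (simp add: mult_norm_def mult_op_apply del: times_fun_apply)

lemma mnorm_nonneg [simp]: "g \<in> multipliers H \<Longrightarrow> mnorm g \<ge> 0"
  using op_norm_nonneg[OF mult_op_bounded] by (simp add: mult_norm_def)

lemma mnorm_le: "(\<And>h. h \<in> H \<Longrightarrow> nm (g * h) \<le> C * nm h) \<Longrightarrow> C \<ge> 0 \<Longrightarrow> mnorm g \<le> C"
  unfolding mult_norm_def by (rule op_norm_le) (auto simp: mult_op_apply simp del: times_fun_apply)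

text \<open>Pair \<open>g * szego z\<close> with \<open>szego z\<close>: the reproducing property
  extracts \<open>g z\<close> times the squared norm of the kernel.\<close>

lemma cmod_le_mnorm:
  assumes g: "g \<in> multipliers H"
  shows "cmod (g z) \<le> mnorm g"
proof (cases "z \<in> ball 0 1")
  case True
  then have k: "szego z \<in> H" by simp
  have "ip (szego z) (szego z) \<noteq> 0"
    unfolding ip_szego[OF k True] using True cmod_herm_less_1[OF True True] by (auto simp: szego_def)
  then have pos: "nm (szego z) > 0" using k nm_nonneg[OF k] by (auto simp: ip_self less_le)
  have "ip (g * szego z) (szego z) = g z * ip (szego z) (szego z)"
    using True k g by (simp add: ip_szego multipliers_mult_in del: times_fun_apply) simp
  then have "cmod (g z) * (nm (szego z))\<^sup>2 = cmod (ip (g * szego z) (szego z))"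
    using k by (simp add: norm_mult ip_self norm_power del: times_fun_apply)
  also have "\<dots> \<le> nm (g * szego z) * nm (szego z)"
    using g k by (intro Cauchy_Schwarz multipliers_mult_in)
  also have "\<dots> \<le> (mnorm g * nm (szego z)) * nm (szego z)"
    using g k by (intro mult_right_mono nm_mult_le) auto
  finally have "cmod (g z) * (nm (szego z))\<^sup>2 \<le> mnorm g * (nm (szego z))\<^sup>2"
    by (simp add: power2_eq_square mult_ac)
  then show ?thesis using pos by simp
next
  case False
  then show ?thesis using g by (simp add: multipliers_def)
qed

lemma mnorm_add: "g \<in> multipliers H \<Longrightarrow> h \<in> multipliers H \<Longrightarrow> mnorm (g + h) \<le> mnorm g + mnorm h"
proof (rule mnorm_le)
  fix x assume *: "g \<in> multipliers H" "h \<in> multipliers H" "x \<in> H"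
  have "nm ((g + h) * x) \<le> nm (g * x) + nm (h * x)"
    unfolding distrib_right using * by (intro nm_triangle multipliers_mult_in)
  also have "\<dots> \<le> mnorm g * nm x + mnorm h * nm x" using * by (intro add_mono nm_mult_le)
  finally show "nm ((g + h) * x) \<le> (mnorm g + mnorm h) * nm x" by (simp add: distrib_right del: plus_fun_apply)
qed auto

lemma mnorm_smul: "g \<in> multipliers H \<Longrightarrow> mnorm (c \<odot> g) \<le> cmod c * mnorm g"
proof (rule mnorm_le)
  fix x assume *: "g \<in> multipliers H" "x \<in> H"
  then show "nm ((c \<odot> g) * x) \<le> cmod c * mnorm g * nm x"
    using nm_mult_le[of g x] by (simp add: nm_smul multipliers_mult_in mult.assoc mult_left_mono del: times_fun_apply)
qed auto

end

section \<open>Fejer means and weak-* density of the polynomials\<close>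

lemma mult_le_sum_squares: "0 \<le> a \<Longrightarrow> 0 \<le> b \<Longrightarrow> a * b \<le> a\<^sup>2 + b\<^sup>2" for a b :: real
  using sum_squares_bound[of a b] mult_nonneg_nonneg[of a b] by linarith

context drury_arveson_space
begin

text \<open>For \<open>i \<le> j\<close> exactly \<open>n - (j - i)\<close> of the degree windows of length \<open>n\<close> contain both \<open>i\<close> and \<open>j\<close>
  (none if \<open>j - i \<ge> n\<close>).  Hence multiplication by the Fejer mean \<open>fejer n g\<close> is \<open>1 / n\<close> times the sum of
  the compressions of multiplication by \<open>g\<close> to these windows, which bounds its norm.\<close>

definition fejer :: "nat \<Rightarrow> (complex ^ 'n \<Rightarrow> complex) \<Rightarrow> complex ^ 'n \<Rightarrow> complex" where
  "fejer n g = (\<Sum>\<alpha> | deg \<alpha> < n. (of_real (1 - real (deg \<alpha>) / real n) * coef g \<alpha>) \<odot> monomial \<alpha>)"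

lemma fejer_polys: "fejer n g \<in> polys"
  unfolding fejer_def polys_def by (rule CollectI, intro exI conjI, rule refl, rule finite_deg_less)

lemma fejer_in [simp]: "fejer n g \<in> H"
  unfolding fejer_def by (intro sum_in smul_in monomial_in)

lemma hom_fejer: "hom k (fejer n g) = of_real (if k < n then 1 - real k / real n else 0) \<odot> hom k g"
  unfolding proj_def[of "{\<alpha>. deg \<alpha> = k}"] smul_sum
proof (rule sum.cong[OF refl])
  fix \<alpha> :: "'n mindex" assume "\<alpha> \<in> {\<alpha>. deg \<alpha> = k}"
  then show "coef (fejer n g) \<alpha> \<odot> monomial \<alpha> = of_real (if k < n then 1 - real k / real n else 0) \<odot> coef g \<alpha> \<odot> monomial \<alpha>"
    unfolding fejer_def coef_lincomb[OF finite_deg_less] by simp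
qed

text \<open>The degrees in a window of length \<open>n\<close> that ends at \<open>s\<close>, cut
  off at 0; the form \<open>s < i + n\<close> avoids truncated subtraction.\<close>

definition window :: "nat \<Rightarrow> nat \<Rightarrow> nat set" where
  "window n s = {i. i \<le> s \<and> s < i + n}"

abbreviation win :: "nat \<Rightarrow> nat \<Rightarrow> (complex ^ 'n \<Rightarrow> complex) \<Rightarrow> complex ^ 'n \<Rightarrow> complex" where
  "win n s \<equiv> proj {\<alpha>. deg \<alpha> \<in> window n s}"

lemma finite_window [simp]: "finite {\<alpha> :: 'n mindex. deg \<alpha> \<in> window n s}"
  by (rule finite_subset[OF _ finite_deg_le[of s]]) (auto simp: window_def)

lemma hom_hom: "hom i (hom j x) = (if i = j then hom j x else 0)"
proof (cases "i = j")
  case False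
  then have "{\<alpha> :: 'n mindex. deg \<alpha> = i} \<inter> {\<alpha>. deg \<alpha> = j} = {}" by auto
  then show ?thesis using False by (simp add: proj_proj) (simp add: proj_def)
qed (simp add: proj_proj)

lemma win_trunc:
  assumes "x \<in> H"
  shows "win n s (trunc N x) = (\<Sum>i<N. of_bool (i \<in> window n s) \<odot> hom i x)"
proof -
  have "win n s (hom i x) = of_bool (i \<in> window n s) \<odot> hom i x" for i
  proof -
    have "{\<alpha> :: 'n mindex. deg \<alpha> \<in> window n s} \<inter> {\<alpha>. deg \<alpha> = i} = (if i \<in> window n s then {\<alpha>. deg \<alpha> = i} else {})"
      by auto
    then show ?thesis by (simp add: proj_proj) (simp add: proj_def)
  qed
  then show ?thesis unfolding trunc_eq_sum_hom using assms by (subst proj_sum) auto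
qed

text \<open>Multiplication by \<open>g\<close> never lowers degrees, and its part from degree
  \<open>i\<close> to degree \<open>j\<close> is multiplication by the component of degree
  \<open>j - i\<close>. The factor \<open>of_bool (i \<le> j)\<close> disposes of the case in which
  this difference is truncated.\<close>

lemma ip_mult_hom:
  assumes g: "g \<in> multipliers H" and x: "x \<in> H" and y: "y \<in> H"
  shows "ip (g * hom i x) (hom j y) = of_bool (i \<le> j) * ip (hom (j - i) g * hom i x) y"
proof -
  have gi: "g * hom i x \<in> H" using g by (intro multipliers_mult_in) auto
  have pm: "hom k g * y \<in> H" if "y \<in> H" for k y using that by (intro polys_mult_in proj_polys) auto
  have "hom j (g * hom i x) = (\<Sum>k\<le>j. hom k g * hom (j - k) (hom i x))"
    by (rule hom_mult[OF multipliers_in[OF g] proj_in gi])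
  also have "\<dots> = (\<Sum>k\<le>j. if k = j - i \<and> i \<le> j then hom (j - i) g * hom i x else 0)"
    by (rule sum.cong) (auto simp: hom_hom)
  also have "\<dots> = of_bool (i \<le> j) \<odot> (hom (j - i) g * hom i x)"
    by (cases "i \<le> j") auto
  finally have "ip (hom j (g * hom i x)) y = ip (of_bool (i \<le> j) \<odot> (hom (j - i) g * hom i x)) y"
    by (simp only:)
  then show ?thesis using gi y pm[of "hom i x"] by (simp only: ip_proj_swap ip_smul_left proj_in)
qed

lemma card_window_le: "card {s. s < K \<and> i \<in> window n s} \<le> n"
proof -
  have "card {s. s < K \<and> i \<in> window n s} \<le> card {i..<i+n}"
    by (rule card_mono) (auto simp: window_def)
  then show ?thesis by simp
qed

text \<open>The windows containing both degrees end at \<open>j\<close>, ...,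
  \<open>i + n - 1\<close>; since \<open>i < N\<close>, all of them are among the ends below
  \<open>N + n\<close>.\<close>

lemma card_window2:
  assumes "i \<le> j" "i < N"
  shows "real (card {s. s < N + n \<and> i \<in> window n s \<and> j \<in> window n s}) = real n * (if j - i < n then 1 - real (j - i) / real n else 0)"
proof -
  have "{s. s < N + n \<and> i \<in> window n s \<and> j \<in> window n s} = {j..<i+n}"
    using assms by (auto simp: window_def)
  then show ?thesis using assms by (auto simp: field_simps of_nat_diff)
qed

lemma fejer_window:
  assumes g: "g \<in> multipliers H" and x: "x \<in> H" and y: "y \<in> H"
  shows "of_nat n * ip (fejer n g * trunc N x) (trunc S y)
    = (\<Sum>s<N + n. ip (g * win n s (trunc N x)) (win n s (trunc S y)))"
proof -
  have fm: "fejer n g \<in> multipliers H" by (intro polys_multipliers fejer_polys)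
  have mem: "h * hom i x \<in> H" if "h \<in> multipliers H" for h i using that by (intro multipliers_mult_in) auto
  \<comment> \<open>The expansion over pairs of degrees is stated for any multiplier and any
    weights, because it is applied to \<open>g\<close> with the indicators of a window and to the
    Fejer mean with weights 1.\<close>
  have expand: "ip (h * (\<Sum>i<N. a i \<odot> hom i x)) (\<Sum>j<S. b j \<odot> hom j y)
     = (\<Sum>i<N. \<Sum>j<S. a i * cnj (b j) * (of_bool (i \<le> j) * ip (hom (j - i) h * hom i x) y))"
    if h: "h \<in> multipliers H" for h a b
  proof -
    have "ip (h * (\<Sum>i<N. a i \<odot> hom i x)) (\<Sum>j<S. b j \<odot> hom j y)
      = ip (\<Sum>i<N. a i \<odot> (h * hom i x)) (\<Sum>j<S. b j \<odot> hom j y)"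
      by (simp only: sum_distrib_left mult_smul)
    also have "\<dots> = (\<Sum>i<N. \<Sum>j<S. ip (a i \<odot> (h * hom i x)) (b j \<odot> hom j y))"
      using mem[OF h] by (subst ip_sum_left) (auto intro!: sum_in sum.cong ip_sum_right)
    also have "\<dots> = (\<Sum>i<N. \<Sum>j<S. a i * cnj (b j) * ip (h * hom i x) (hom j y))"
      using mem[OF h] by (simp only: ip_smul_left ip_smul_right smul_in proj_in mult_ac)
    finally show ?thesis by (simp only: ip_mult_hom[OF h x y])
  qed
  have "(\<Sum>s<N + n. ip (g * win n s (trunc N x)) (win n s (trunc S y)))
    = (\<Sum>s<N + n. \<Sum>i<N. \<Sum>j<S. of_bool (i \<in> window n s) * cnj (of_bool (j \<in> window n s)) *
         (of_bool (i \<le> j) * ip (hom (j - i) g * hom i x) y))"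
    unfolding win_trunc[OF x] win_trunc[OF y] expand[OF g] ..
  also have "\<dots> = (\<Sum>i<N. \<Sum>j<S. \<Sum>s<N + n. of_bool (i \<in> window n s) * cnj (of_bool (j \<in> window n s)) *
         (of_bool (i \<le> j) * ip (hom (j - i) g * hom i x) y))"
    by (subst sum.swap, rule sum.cong[OF refl], rule sum.swap)
  also have "\<dots> = (\<Sum>i<N. \<Sum>j<S. of_nat (card {s. s < N + n \<and> i \<in> window n s \<and> j \<in> window n s}) *
         (of_bool (i \<le> j) * ip (hom (j - i) g * hom i x) y))"
  proof (intro sum.cong refl)
    fix i j
    have "(\<Sum>s<N + n. of_bool (i \<in> window n s) * cnj (of_bool (j \<in> window n s)) :: complex)
        = (\<Sum>s<N + n. of_bool (i \<in> window n s \<and> j \<in> window n s))"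
      by (rule sum.cong) auto
    also have "\<dots> = of_nat (card {s. s < N + n \<and> i \<in> window n s \<and> j \<in> window n s})"
      by (simp add: of_bool_def sum.If_cases Int_def)
    finally show "(\<Sum>s<N + n. of_bool (i \<in> window n s) * cnj (of_bool (j \<in> window n s)) *
         (of_bool (i \<le> j) * ip (hom (j - i) g * hom i x) y)) = of_nat (card {s. s < N + n \<and> i \<in> window n s \<and> j \<in> window n s}) *
         (of_bool (i \<le> j) * ip (hom (j - i) g * hom i x) y)"
      by (simp only: sum_distrib_right[symmetric])
  qed
  also have "\<dots> = (\<Sum>i<N. \<Sum>j<S. of_nat n * (of_bool (i \<le> j) * ip (hom (j - i) (fejer n g) * hom i x) y))"
  proof (intro sum.cong refl)
    fix i j assume "i \<in> {..<N}"
    then have i: "i < N" by simp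
    have pm: "hom k g * hom i x \<in> H" for k by (intro polys_mult_in proj_polys) auto
    show "of_nat (card {s. s < N + n \<and> i \<in> window n s \<and> j \<in> window n s}) *
         (of_bool (i \<le> j) * ip (hom (j - i) g * hom i x) y) =
      of_nat n * (of_bool (i \<le> j) * ip (hom (j - i) (fejer n g) * hom i x) y)"
    proof (cases "i \<le> j")
      case True
      have "complex_of_nat (card {s. s < N + n \<and> i \<in> window n s \<and> j \<in> window n s})
          = of_real (real (card {s. s < N + n \<and> i \<in> window n s \<and> j \<in> window n s}))" by simp
      also have "\<dots> = of_nat n * of_real (if j - i < n then 1 - real (j - i) / real n else 0)"
        unfolding card_window2[OF True i] by simp
      finally show ?thesis unfolding hom_fejer mult_smul ip_smul_left[OF pm y]
        by (simp only: mult_ac)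
    qed simp
  qed
  also have "\<dots> = of_nat n * (\<Sum>i<N. \<Sum>j<S. 1 * cnj 1 * (of_bool (i \<le> j) * ip (hom (j - i) (fejer n g) * hom i x) y))"
    by (simp only: sum_distrib_left mult_1 complex_cnj_one)
  also have "\<dots> = of_nat n * ip (fejer n g * trunc N x) (trunc S y)"
    unfolding expand[OF fm, symmetric] by (simp add: trunc_eq_sum_hom)
  finally show ?thesis by simp
qed

text \<open>Each degree belongs to at most \<open>n\<close> windows.\<close>

lemma sum_nm_win_le:
  assumes x: "x \<in> H"
  shows "(\<Sum>s<K. (nm (win n s (trunc N x)))\<^sup>2) \<le> real n * (nm x)\<^sup>2"
proof -
  have "(nm (win n s (trunc N x)))\<^sup>2 = (\<Sum>\<alpha> | deg \<alpha> < N. of_bool (deg \<alpha> \<in> window n s) * ((cmod (coef x \<alpha>))\<^sup>2 / multinom \<alpha>))" for s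
  proof -
    have "(nm (win n s (trunc N x)))\<^sup>2 = (\<Sum>\<alpha>\<in>{\<alpha>. deg \<alpha> \<in> window n s} \<inter> {\<alpha>. deg \<alpha> < N}. (cmod (coef x \<alpha>))\<^sup>2 / multinom \<alpha>)"
      using x by (simp add: proj_proj nm_proj_sq)
    also have "\<dots> = (\<Sum>\<alpha> | deg \<alpha> < N. of_bool (deg \<alpha> \<in> window n s) * ((cmod (coef x \<alpha>))\<^sup>2 / multinom \<alpha>))"
      by (rule sum.mono_neutral_cong_left) auto
    finally show ?thesis .
  qed
  then have "(\<Sum>s<K. (nm (win n s (trunc N x)))\<^sup>2)
     = (\<Sum>\<alpha> | deg \<alpha> < N. \<Sum>s<K. of_bool (deg \<alpha> \<in> window n s) * ((cmod (coef x \<alpha>))\<^sup>2 / multinom \<alpha>))"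
    by (simp only:) (rule sum.swap)
  also have "\<dots> \<le> (\<Sum>\<alpha> | deg \<alpha> < N. real n * ((cmod (coef x \<alpha>))\<^sup>2 / multinom \<alpha>))"
  proof (rule sum_mono)
    fix \<alpha> :: "'n mindex"
    have "(\<Sum>s<K. of_bool (deg \<alpha> \<in> window n s) :: real) = real (card {s. s < K \<and> deg \<alpha> \<in> window n s})"
      by (simp add: of_bool_def sum.If_cases Int_def)
    also have "\<dots> \<le> real n" using card_window_le by simp
    finally show "(\<Sum>s<K. of_bool (deg \<alpha> \<in> window n s) * ((cmod (coef x \<alpha>))\<^sup>2 / multinom \<alpha>)) \<le> real n * ((cmod (coef x \<alpha>))\<^sup>2 / multinom \<alpha>)"
      unfolding sum_distrib_right[symmetric] by (rule mult_right_mono) simp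
  qed
  also have "\<dots> = real n * (nm (trunc N x))\<^sup>2" using x by (simp add: nm_proj_sq sum_distrib_left)
  also have "\<dots> \<le> real n * (nm x)\<^sup>2" using x by (intro mult_left_mono power_mono nm_proj_le) auto
  finally show ?thesis .
qed

text \<open>Cauchy-Schwarz over the windows. Each of the two sums of squares contributes a factor
  \<open>sqrt n\<close>, and the normalisation of the mean cancels their product, so that no
  constant beyond \<open>mnorm g\<close> remains.\<close>

lemma fejer_ip_bound:
  assumes g: "g \<in> multipliers H" and x: "x \<in> H" and y: "y \<in> H"
  shows "real n * cmod (ip (fejer n g * trunc N x) (trunc S y)) \<le> real n * (mnorm g * nm x * nm y)"
proof -
  let ?a = "\<lambda>s. nm (win n s (trunc N x))" and ?b = "\<lambda>s. nm (win n s (trunc S y))"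
  have "real n * cmod (ip (fejer n g * trunc N x) (trunc S y)) = cmod (of_nat n * ip (fejer n g * trunc N x) (trunc S y))"
    by (simp only: norm_mult norm_of_nat)
  also have "\<dots> \<le> (\<Sum>s<N + n. mnorm g * (?a s * ?b s))"
    unfolding fejer_window[OF g x y]
  proof (rule order_trans[OF norm_sum], rule sum_mono)
    fix s
    have "cmod (ip (g * win n s (trunc N x)) (win n s (trunc S y))) \<le> nm (g * win n s (trunc N x)) * ?b s"
      using g by (intro Cauchy_Schwarz multipliers_mult_in) auto
    also have "\<dots> \<le> mnorm g * ?a s * ?b s" using g by (intro mult_right_mono nm_mult_le) auto
    finally show "cmod (ip (g * win n s (trunc N x)) (win n s (trunc S y))) \<le> mnorm g * (?a s * ?b s)"
      by (simp only: mult.assoc)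
  qed
  also have "\<dots> = mnorm g * (\<Sum>s<N + n. \<bar>?a s\<bar> * \<bar>?b s\<bar>)" by (simp add: sum_distrib_left)
  also have "(\<Sum>s<N + n. \<bar>?a s\<bar> * \<bar>?b s\<bar>) \<le> L2_set ?a {..<N + n} * L2_set ?b {..<N + n}"
    by (rule L2_set_mult_ineq)
  also have "L2_set ?a {..<N + n} \<le> sqrt (real n) * nm x"
    unfolding L2_set_def using x by (intro real_le_lsqrt) (auto simp: sum_nonneg power_mult_distrib sum_nm_win_le)
  also have "L2_set ?b {..<N + n} \<le> sqrt (real n) * nm y"
    unfolding L2_set_def using y by (intro real_le_lsqrt) (auto simp: sum_nonneg power_mult_distrib sum_nm_win_le)
  finally have "real n * cmod (ip (fejer n g * trunc N x) (trunc S y)) \<le> mnorm g * ((sqrt (real n) * nm x) * (sqrt (real n) * nm y))"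
    using g x by (simp add: mult_left_mono mult_right_mono L2_set_nonneg)
  also have "\<dots> = (sqrt (real n) * sqrt (real n)) * (mnorm g * nm x * nm y)" by (simp only: mult_ac)
  finally show ?thesis by simp
qed

theorem nm_fejer_mult_le:
  assumes g: "g \<in> multipliers H" and x: "x \<in> H" and n: "n > 0"
  shows "nm (fejer n g * x) \<le> mnorm g * nm x"
proof (rule LIMSEQ_le_const2)
  obtain C where C: "\<And>x. x \<in> H \<Longrightarrow> fejer n g * x \<in> H \<and> nm (fejer n g * x) \<le> C * nm x"
    using polys_mult[OF fejer_polys[of n g]] by blast
  have "nm (fejer n g * trunc N x - fejer n g * x) \<le> C * nm (trunc N x - x)" for N
    using C[OF diff_in[OF proj_in x], THEN conjunct2] by (simp only: right_diff_distrib)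
  then have "lim_in (\<lambda>N. fejer n g * trunc N x) (fejer n g * x)"
    by (intro lim_in_bounded[where A = "\<lambda>v. fejer n g * v" and C = C] lim_trunc x proj_in C[THEN conjunct1])
  then show "(\<lambda>N. nm (fejer n g * trunc N x)) \<longlonglongrightarrow> nm (fejer n g * x)"
    by (intro lim_in_nm C[THEN conjunct1] x proj_in)
  have "nm (fejer n g * trunc N x) \<le> mnorm g * nm x" for N
  proof (rule LIMSEQ_le_const2)
    let ?y = "fejer n g * trunc N x"
    have y: "?y \<in> H" by (intro C[THEN conjunct1] proj_in)
    then show "(\<lambda>S. nm (trunc S ?y)) \<longlonglongrightarrow> nm ?y" by (intro lim_in_nm lim_trunc) auto
    have "nm (trunc S ?y) \<le> mnorm g * nm x" for S
    proof -
      \<comment> \<open>Testing \<open>?y\<close> against its own truncation turns the bound for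
        inner products into one for norms.\<close>
      let ?t = "trunc S ?y"
      have "ip ?t ?t = ip ?y (trunc S ?t)" using y by (simp only: ip_proj_swap proj_in)
      then have "complex_of_real ((nm ?t)\<^sup>2) = ip ?y (trunc S ?t)" by (simp only: ip_self proj_in)
      then have "(nm ?t)\<^sup>2 = cmod (ip ?y (trunc S ?t))" by (metis abs_of_nonneg norm_of_real zero_le_power2)
      also have "\<dots> \<le> mnorm g * nm x * nm ?t"
        using fejer_ip_bound[OF g x, of ?t n N S] n by simp
      finally have "nm ?t * nm ?t \<le> mnorm g * nm x * nm ?t" by (simp add: power2_eq_square)
      then show ?thesis using g x by (cases "nm ?t = 0") (auto simp: less_le)
    qed
    then show "\<exists>K. \<forall>S\<ge>K. nm (trunc S ?y) \<le> mnorm g * nm x" by blast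
  qed
  then show "\<exists>K. \<forall>N\<ge>K. nm (fejer n g * trunc N x) \<le> mnorm g * nm x" by blast
qed

text \<open>Boundedness of the sequence controls the error of replacing \<open>y\<close> by
  \<open>trunc M y\<close>, uniformly in \<open>n\<close>.\<close>

lemma weak_lim:
  assumes u: "\<And>n. u n \<in> H" and v: "v \<in> H" and y: "y \<in> H" and B: "\<And>n. nm (u n) \<le> B"
    and lim: "\<And>M. (\<lambda>n. ip (u n) (trunc M y)) \<longlonglongrightarrow> ip v (trunc M y)"
  shows "(\<lambda>n. ip (u n) y) \<longlonglongrightarrow> ip v y"
proof (rule LIMSEQ_I)
  fix e :: real assume e: "e > 0"
  define K where "K = B + nm v + 1"
  have K: "K > 0" using B[of 0] nm_nonneg[OF u[of 0]] nm_nonneg[OF v] by (simp add: K_def)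
  obtain M where M: "nm (trunc M y - y) < e / (2 * K)"
    using order_tendstoD(2)[OF lim_trunc[OF y, unfolded lim_in_def], of "e / (2 * K)"] e K
    by (auto simp: eventually_sequentially)
  obtain N where N: "\<And>n. n \<ge> N \<Longrightarrow> norm (ip (u n) (trunc M y) - ip v (trunc M y)) < e / 2"
    using LIMSEQ_D[OF lim[of M], of "e / 2"] e by auto
  have "norm (ip (u n) y - ip v y) < e" if n: "n \<ge> N" for n
  proof -
    have "ip (u n) y - ip v y = (ip (u n) (trunc M y) - ip v (trunc M y)) - ip (u n - v) (trunc M y - y)"
      using u v y by (simp add: ip_diff_left ip_diff_right)
    then have "norm (ip (u n) y - ip v y) \<le> norm (ip (u n) (trunc M y) - ip v (trunc M y)) + norm (ip (u n - v) (trunc M y - y))"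
      by (metis norm_triangle_ineq4)
    moreover have "norm (ip (u n - v) (trunc M y - y)) \<le> e / 2"
    proof -
      have "norm (ip (u n - v) (trunc M y - y)) \<le> nm (u n - v) * nm (trunc M y - y)"
        using u v y by (intro Cauchy_Schwarz) auto
      also have "\<dots> \<le> K * (e / (2 * K))"
        using nm_triangle_diff[OF u[of n] v] B[of n] M K u v y
        by (intro mult_mono) (auto simp: K_def)
      finally show ?thesis using K by simp
    qed
    ultimately show ?thesis using N[OF n] by linarith
  qed
  then show "\<exists>no. \<forall>n\<ge>no. norm (ip (u n) y - ip v y) < e" by blast
qed

text \<open>Once \<open>y\<close> is truncated, finitely many pairs of components of
  \<open>g\<close> and \<open>x\<close> enter, and the Fejer weight of each tends to 1. The index
  \<open>Suc n\<close> meets the condition \<open>n > 0\<close> of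
  \<open>nm_fejer_mult_le\<close>.\<close>

theorem fejer_weak_lim:
  assumes g: "g \<in> multipliers H" and x: "x \<in> H" and y: "y \<in> H"
  shows "(\<lambda>n. ip (fejer (Suc n) g * x) y) \<longlonglongrightarrow> ip (g * x) y"
proof (rule weak_lim[OF _ _ y])
  have gx: "g * x \<in> H" and gH: "g \<in> H" using g x multipliers_mult_in multipliers_in by auto
  show fx: "fejer (Suc n) g * x \<in> H" for n using x by (intro polys_mult_in fejer_polys)
  show "g * x \<in> H" by fact
  show "nm (fejer (Suc n) g * x) \<le> mnorm g * nm x" for n using g x by (intro nm_fejer_mult_le) auto
  fix M
  have pm: "hom k g * hom l x \<in> H" for k l by (intro polys_mult_in proj_polys) auto
  have "ip (fejer (Suc n) g * x) (trunc M y) = (\<Sum>m<M. \<Sum>k\<le>m. of_real (if k < Suc n then 1 - real k / real (Suc n) else 0) * ip (hom k g * hom (m - k) x) y)" for n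
  proof -
    have "ip (fejer (Suc n) g * x) (trunc M y) = ip (trunc M (fejer (Suc n) g * x)) y"
      using fx y by (simp only: ip_proj_swap)
    also have "trunc M (fejer (Suc n) g * x) = (\<Sum>m<M. \<Sum>k\<le>m. of_real (if k < Suc n then 1 - real k / real (Suc n) else 0) \<odot> (hom k g * hom (m - k) x))"
      unfolding trunc_eq_sum_hom hom_mult[OF fejer_in x fx] hom_fejer mult_smul ..
    finally show ?thesis using pm y by (simp add: ip_sum_left sum_in ip_smul_left del: times_fun_apply)
  qed
  moreover have "ip (g * x) (trunc M y) = (\<Sum>m<M. \<Sum>k\<le>m. 1 * ip (hom k g * hom (m - k) x) y)"
  proof -
    have "ip (g * x) (trunc M y) = ip (trunc M (g * x)) y"
      using gx y by (simp only: ip_proj_swap)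
    also have "trunc M (g * x) = (\<Sum>m<M. \<Sum>k\<le>m. hom k g * hom (m - k) x)"
      unfolding trunc_eq_sum_hom hom_mult[OF gH x gx] ..
    finally show ?thesis using pm y by (simp add: ip_sum_left sum_in del: times_fun_apply)
  qed
  moreover have "(\<lambda>n. complex_of_real (if k < Suc n then 1 - real k / real (Suc n) else 0)) \<longlonglongrightarrow> 1" for k
  proof -
    have "(\<lambda>n. 1 - real k / real (Suc n)) \<longlonglongrightarrow> 1" by real_asymp
    then have "(\<lambda>n. if k < Suc n then 1 - real k / real (Suc n) else 0) \<longlonglongrightarrow> 1"
      by (rule Lim_transform_eventually) (auto intro!: eventually_sequentiallyI[of "Suc k"])
    then show ?thesis using tendsto_of_real by fastforce
  qed
  ultimately show "(\<lambda>n. ip (fejer (Suc n) g * x) (trunc M y)) \<longlonglongrightarrow> ip (g * x) (trunc M y)"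
    by (simp only:) (intro tendsto_sum tendsto_mult tendsto_const)
qed

end

section \<open>Functionals in the predual\<close>

context function_hilbert_space
begin

lemma B_predual_terms:
  assumes "range x \<subseteq> H" "range y \<subseteq> H" "summable (\<lambda>n. (nm (x n))\<^sup>2)" "summable (\<lambda>n. (nm (y n))\<^sup>2)"
    and "A \<in> bounded_ops H ip"
  shows "cmod (ip (A (x n)) (y n)) \<le> op_norm H ip A * ((nm (x n))\<^sup>2 + (nm (y n))\<^sup>2)"
    and "summable (\<lambda>n. ip (A (x n)) (y n))"
proof -
  have xy: "x n \<in> H" "y n \<in> H" for n by (rule range_subsetD[OF assms(1)], rule range_subsetD[OF assms(2)])
  have *: "cmod (ip (A (x n)) (y n)) \<le> op_norm H ip A * ((nm (x n))\<^sup>2 + (nm (y n))\<^sup>2)" for n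
  proof -
    have "cmod (ip (A (x n)) (y n)) \<le> nm (A (x n)) * nm (y n)"
      by (rule Cauchy_Schwarz[OF op_in[OF assms(5) xy(1)] xy(2)])
    also have "\<dots> \<le> (op_norm H ip A * nm (x n)) * nm (y n)"
      using op_norm_bound[OF assms(5) xy(1)[of n]] nm_nonneg[OF xy(2)[of n]] by (rule mult_right_mono)
    also have "\<dots> = op_norm H ip A * (nm (x n) * nm (y n))" by simp
    also have "nm (x n) * nm (y n) \<le> (nm (x n))\<^sup>2 + (nm (y n))\<^sup>2"
      by (intro mult_le_sum_squares nm_nonneg xy)
    finally show ?thesis using op_norm_nonneg[OF assms(5)] by (simp add: mult_left_mono)
  qed
  then show "cmod (ip (A (x n)) (y n)) \<le> op_norm H ip A * ((nm (x n))\<^sup>2 + (nm (y n))\<^sup>2)" .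
  show "summable (\<lambda>n. ip (A (x n)) (y n))"
    by (rule summable_comparison_test'[of "\<lambda>n. op_norm H ip A * ((nm (x n))\<^sup>2 + (nm (y n))\<^sup>2)" 0])
      (use * assms in \<open>auto intro!: summable_mult summable_add\<close>)
qed

lemma B_predual_bound:
  assumes "\<phi> \<in> B_predual H ip"
  obtains C where "C \<ge> 0" "\<And>A. A \<in> bounded_ops H ip \<Longrightarrow> cmod (\<phi> A) \<le> C * op_norm H ip A"
proof -
  obtain x y where xy: "range x \<subseteq> H" "range y \<subseteq> H" "summable (\<lambda>n. (nm (x n))\<^sup>2)" "summable (\<lambda>n. (nm (y n))\<^sup>2)"
    and \<phi>: "\<phi> = (\<lambda>T. if T \<in> bounded_ops H ip then \<Sum>n. ip (T (x n)) (y n) else 0)"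
    using assms unfolding B_predual_def by blast
  have sm: "summable (\<lambda>n. (nm (x n))\<^sup>2 + (nm (y n))\<^sup>2)" using xy by (intro summable_add)
  have "cmod (\<phi> A) \<le> (\<Sum>n. (nm (x n))\<^sup>2 + (nm (y n))\<^sup>2) * op_norm H ip A" if A: "A \<in> bounded_ops H ip" for A
  proof -
    have "cmod (\<Sum>n. ip (A (x n)) (y n)) \<le> (\<Sum>n. op_norm H ip A * ((nm (x n))\<^sup>2 + (nm (y n))\<^sup>2))"
      by (intro norm_suminf_le B_predual_terms xy A summable_mult sm)
    also have "\<dots> = (\<Sum>n. (nm (x n))\<^sup>2 + (nm (y n))\<^sup>2) * op_norm H ip A"
      using suminf_mult[OF sm] by (simp add: mult.commute)
    finally show ?thesis using A by (simp add: \<phi>)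
  qed
  moreover have "(\<Sum>n. (nm (x n))\<^sup>2 + (nm (y n))\<^sup>2) \<ge> 0" by (intro suminf_nonneg sm) auto
  ultimately show ?thesis using that by blast
qed

lemma functional_bdd_above:
  assumes "\<phi> \<in> B_predual H ip"
  shows "bdd_above {cmod (\<phi> v) | v. v \<in> bounded_ops H ip \<and> op_norm H ip v \<le> 1}"
proof -
  obtain C where C: "C \<ge> 0" "\<And>A. A \<in> bounded_ops H ip \<Longrightarrow> cmod (\<phi> A) \<le> C * op_norm H ip A"
    using B_predual_bound[OF assms] by blast
  show ?thesis
  proof (rule bdd_aboveI[of _ C])
    fix r assume "r \<in> {cmod (\<phi> v) | v. v \<in> bounded_ops H ip \<and> op_norm H ip v \<le> 1}"
    then obtain v where v: "r = cmod (\<phi> v)" "v \<in> bounded_ops H ip" "op_norm H ip v \<le> 1" by blast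
    then show "r \<le> C" using C(2)[of v] mult_left_mono[OF v(3) C(1)] by simp
  qed
qed

lemma smul_op:
  assumes A: "A \<in> bounded_ops H ip"
  shows "(\<lambda>h. c \<odot> A h) \<in> bounded_ops H ip"
  unfolding bounded_ops_def
proof (intro CollectI conjI allI ballI impI)
  show "c \<odot> A h \<in> H" if "h \<in> H" for h by (rule smul_in[OF op_in[OF A that]])
  show "c \<odot> A h = 0" if "h \<notin> H" for h using A that by (simp add: bounded_ops_def)
  show "c \<odot> A (\<lambda>x. g x + h x) = (\<lambda>x. (c \<odot> A g) x + (c \<odot> A h) x)" if "g \<in> H" "h \<in> H" for g h
    using op_add[OF A that] by (simp add: plus_fun_def distrib_left fun_eq_iff)
  show "c \<odot> A (\<lambda>x. k * h x) = (\<lambda>x. k * (c \<odot> A h) x)" if "h \<in> H" for k h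
    using op_smul[OF A that, of k] by (simp add: smul_def mult_ac)
  obtain C where C: "C \<ge> 0" "\<And>h. h \<in> H \<Longrightarrow> nm (A h) \<le> C * nm h" using op_bound[OF A] by blast
  have "nm (c \<odot> A h) \<le> (cmod c * C) * nm h" if "h \<in> H" for h
    unfolding nm_smul[OF op_in[OF A that]] mult.assoc by (rule mult_left_mono[OF C(2)[OF that]]) simp
  then show "\<exists>C. \<forall>h\<in>H. nm (c \<odot> A h) \<le> C * nm h" by blast
qed

lemma functional_norm_upper:
  assumes "\<phi> \<in> B_predual H ip" "A \<in> bounded_ops H ip"
  shows "cmod (\<phi> A) \<le> functional_norm (op_norm H ip) (bounded_ops H ip) \<phi> * op_norm H ip A"
proof -
  obtain C where C: "C \<ge> 0" "\<And>A. A \<in> bounded_ops H ip \<Longrightarrow> cmod (\<phi> A) \<le> C * op_norm H ip A"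
    using B_predual_bound[OF assms(1)] by blast
  obtain x y where xy: "range x \<subseteq> H" "range y \<subseteq> H" "summable (\<lambda>n. (nm (x n))\<^sup>2)" "summable (\<lambda>n. (nm (y n))\<^sup>2)"
    and \<phi>: "\<phi> = (\<lambda>T. if T \<in> bounded_ops H ip then \<Sum>n. ip (T (x n)) (y n) else 0)"
    using assms unfolding B_predual_def by blast
  note bdd = functional_bdd_above[OF assms(1)]
  show ?thesis
  proof (cases "op_norm H ip A = 0")
    case True
    then show ?thesis using C(2)[OF assms(2)] by simp
  next
    case False
    then have pos: "op_norm H ip A > 0" using op_norm_nonneg[OF assms(2)] by linarith
    define c where "c = complex_of_real (1 / op_norm H ip A)"
    define B where "B = (\<lambda>h. c \<odot> A h)"
    have B: "B \<in> bounded_ops H ip" unfolding B_def by (rule smul_op[OF assms(2)])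
    have "op_norm H ip B \<le> 1"
    proof (rule op_norm_le)
      fix h assume h: "h \<in> H"
      have "nm (B h) = 1 / op_norm H ip A * nm (A h)"
        unfolding B_def c_def nm_smul[OF op_in[OF assms(2) h]] norm_of_real using pos by simp
      also have "\<dots> \<le> 1 / op_norm H ip A * (op_norm H ip A * nm h)"
        using pos h assms by (intro mult_left_mono op_norm_bound) auto
      finally show "nm (B h) \<le> 1 * nm h" using pos by simp
    qed auto
    then have "cmod (\<phi> B) \<le> functional_norm (op_norm H ip) (bounded_ops H ip) \<phi>"
      unfolding functional_norm_def using B by (intro cSup_upper[OF _ bdd]) auto
    moreover have "\<phi> B = c * \<phi> A"
    proof -
      have "ip (B (x n)) (y n) = c * ip (A (x n)) (y n)" for n
        unfolding B_def using xy op_in[OF assms(2)] by (intro ip_smul_left) blast+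
      then show ?thesis using B assms(2) B_predual_terms(2)[OF xy assms(2)] by (simp add: \<phi> suminf_mult)
    qed
    ultimately show ?thesis using pos by (simp add: c_def norm_mult norm_divide field_simps)
  qed
qed

lemma functional_norm_nonneg:
  assumes "\<phi> \<in> B_predual H ip"
  shows "functional_norm (op_norm H ip) (bounded_ops H ip) \<phi> \<ge> 0"
proof (rule ccontr)
  assume neg: "\<not> ?thesis"
  have "(\<lambda>h. 0) \<in> bounded_ops H ip" by (auto simp: bounded_ops_def zero_fun_def zero_mem nm_zero intro!: exI[of _ 0])
  moreover have "op_norm H ip (\<lambda>h. 0) \<le> 1" by (rule op_norm_le) (auto simp: nm_zero)
  ultimately have "cmod (\<phi> (\<lambda>h. 0)) \<le> functional_norm (op_norm H ip) (bounded_ops H ip) \<phi>"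
    unfolding functional_norm_def by (intro cSup_upper functional_bdd_above assms) auto
  then show False using neg norm_ge_zero[of "\<phi> (\<lambda>h. 0)"] by linarith
qed

end

context drury_arveson_space
begin

text \<open>Dominated convergence for the series that defines \<phi>, in the form of Tannery's
  theorem: every term converges by \<open>fejer_weak_lim\<close>, and
  \<open>nm_fejer_mult_le\<close> supplies a summable majorant independent of
  \<open>n\<close>.\<close>

theorem predual_fejer_lim:
  assumes \<phi>: "\<phi> \<in> B_predual H ip" and g: "g \<in> multipliers H"
  shows "(\<lambda>n. \<phi> (mult_op H (fejer (Suc n) g))) \<longlonglongrightarrow> \<phi> (mult_op H g)"
proof -
  obtain x y where xy: "range x \<subseteq> H" "range y \<subseteq> H" "summable (\<lambda>n. (nm (x n))\<^sup>2)" "summable (\<lambda>n. (nm (y n))\<^sup>2)"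
    and \<phi>: "\<phi> = (\<lambda>T. if T \<in> bounded_ops H ip then \<Sum>n. ip (T (x n)) (y n) else 0)"
    using \<phi> unfolding B_predual_def by blast
  have xH: "x n \<in> H" and yH: "y n \<in> H" for n by (rule range_subsetD[OF xy(1)], rule range_subsetD[OF xy(2)])
  have fm: "fejer (Suc n) g \<in> multipliers H" for n by (intro polys_multipliers fejer_polys)
  have eq: "\<phi> (mult_op H h) = (\<Sum>k. ip (h * x k) (y k))" if "h \<in> multipliers H" for h
    using mult_op_bounded[OF that] xH by (simp add: \<phi> mult_op_apply del: times_fun_apply)
  have dom: "cmod (ip (fejer (Suc n) g * x k) (y k)) \<le> mnorm g * ((nm (x k))\<^sup>2 + (nm (y k))\<^sup>2)" for n k
  proof -
    have fx: "fejer (Suc n) g * x k \<in> H" using xH by (intro polys_mult_in fejer_polys)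
    have "cmod (ip (fejer (Suc n) g * x k) (y k)) \<le> nm (fejer (Suc n) g * x k) * nm (y k)"
      by (rule Cauchy_Schwarz[OF fx yH])
    also have "\<dots> \<le> (mnorm g * nm (x k)) * nm (y k)"
      using xH yH g by (intro mult_right_mono nm_fejer_mult_le) auto
    also have "\<dots> = mnorm g * (nm (x k) * nm (y k))" by simp
    also have "nm (x k) * nm (y k) \<le> (nm (x k))\<^sup>2 + (nm (y k))\<^sup>2"
      by (intro mult_le_sum_squares nm_nonneg xH yH)
    finally show ?thesis using g by (simp add: mult_left_mono)
  qed
  have "(\<lambda>n. \<Sum>k. ip (fejer (Suc n) g * x k) (y k)) \<longlonglongrightarrow> (\<Sum>k. ip (g * x k) (y k))"
  proof (rule tannerys_theorem[
      where a = "\<lambda>k n. ip (fejer (Suc n) g * x k) (y k)" and b = "\<lambda>k. ip (g * x k) (y k)" and M = "\<lambda>k. mnorm g * ((nm (x k))\<^sup>2 + (nm (y k))\<^sup>2)",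
      THEN conjunct2, THEN conjunct2])
    show "(\<lambda>n. ip (fejer (Suc n) g * x k) (y k)) \<longlonglongrightarrow> ip (g * x k) (y k)" for k
      by (rule fejer_weak_lim[OF g xH yH])
    show "summable (\<lambda>k. mnorm g * ((nm (x k))\<^sup>2 + (nm (y k))\<^sup>2))"
      using xy by (intro summable_mult summable_add)
    show "\<forall>\<^sub>F (k, n) in at_top \<times>\<^sub>F sequentially. norm (ip (fejer (Suc n) g * x k) (y k)) \<le> mnorm g * ((nm (x k))\<^sup>2 + (nm (y k))\<^sup>2)"
      by (rule always_eventually) (use dom in \<open>auto simp del: times_fun_apply\<close>)
  qed auto
  then show ?thesis by (simp only: eq[OF fm] eq[OF g])
qed

text \<open>By \<open>predual_fejer_lim\<close> the polynomials are weak-star dense in the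
  multipliers. Restriction to A_d is therefore injective on the predual, so that a representation
  found on A_d determines the functional.\<close>

corollary M_predual_eqI:
  assumes "\<Phi> \<in> M_predual H ip" "\<Psi> \<in> M_predual H ip" "\<And>p. p \<in> polys \<Longrightarrow> \<Phi> p = \<Psi> p"
  shows "\<Phi> = \<Psi>"
proof
  fix g
  obtain \<phi> \<psi> where \<phi>: "\<phi> \<in> B_predual H ip" "\<Phi> = predual_class H \<phi>" and \<psi>: "\<psi> \<in> B_predual H ip" "\<Psi> = predual_class H \<psi>"
    using assms by (auto simp: M_predual_def)
  show "\<Phi> g = \<Psi> g"
  proof (cases "g \<in> multipliers H")
    case True
    have "\<phi> (mult_op H (fejer (Suc n) g)) = \<psi> (mult_op H (fejer (Suc n) g))" for n
      using assms(3)[OF fejer_polys[of "Suc n" g]] polys_multipliers[OF fejer_polys[of "Suc n" g]]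
      by (simp add: \<phi> \<psi> predual_class_def)
    then have "\<phi> (mult_op H g) = \<psi> (mult_op H g)"
      using predual_fejer_lim[OF \<phi>(1) True] predual_fejer_lim[OF \<psi>(1) True] LIMSEQ_unique by auto
    then show ?thesis using True by (simp add: \<phi> \<psi> predual_class_def)
  qed (simp add: \<phi> \<psi> predual_class_def)
qed

end

section \<open>Essential norms of polynomial multipliers\<close>

lemma kap_card_nonzero [simp]: "kap CARD('n::finite) k \<noteq> 0"
  using kap_pos[of "CARD('n)" k] by (auto simp del: kap_pos)

section \<open>Asymptotics of ratios of multinomial coefficients\<close>

lemma fact_add_le: "fact (a + b) \<le> fact a * real (a + b) ^ b"
proof (induction b)
  case (Suc b)
  have "fact (a + Suc b) = real (a + Suc b) * fact (a + b)" by simp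
  also have "\<dots> \<le> real (a + Suc b) * (fact a * real (a + b) ^ b)" by (intro mult_left_mono Suc) simp
  also have "\<dots> \<le> real (a + Suc b) * (fact a * real (a + Suc b) ^ b)"
    by (intro mult_left_mono power_mono) auto
  finally show ?case by (simp add: mult_ac)
qed simp

lemma fact_add_ge: "fact a * real a ^ b \<le> fact (a + b)"
proof (induction b)
  case (Suc b)
  have "fact a * real a ^ Suc b = real a * (fact a * real a ^ b)" by simp
  also have "\<dots> \<le> real (a + Suc b) * fact (a + b)" by (intro mult_mono Suc) auto
  finally show ?case by simp
qed simp

lemma multinom_ratio:
  "multinom \<gamma> / multinom (\<gamma> + \<beta>) = (\<Prod>i\<in>UNIV. fact (\<gamma> i + \<beta> i) / fact (\<gamma> i)) * (fact (deg \<gamma>) / fact (deg \<gamma> + deg \<beta>))"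
  by (simp add: multinom_def prod_dividef field_simps)

text \<open>When \<gamma> is large the ratio is nearly the monomial \<beta> at the point
  \<open>\<gamma> / deg \<gamma>\<close> of the simplex. Adding \<open>L\<close> to every coordinate
  dominates the rising factorials, as \<open>\<beta> i \<le> L\<close>;
  \<open>multinom_ratio_ge\<close> is the bound from the other side, without a shift.\<close>

lemma multinom_ratio_le:
  assumes "deg \<beta> \<le> L"
  shows "multinom \<gamma> / multinom (\<gamma> + \<beta>) * real (deg \<gamma>) ^ deg \<beta> \<le> mpow (\<lambda>i. real (\<gamma> i + L)) \<beta>"
proof -
  have "(\<Prod>i\<in>UNIV. fact (\<gamma> i + \<beta> i) / fact (\<gamma> i)) \<le> mpow (\<lambda>i. real (\<gamma> i + L)) \<beta>"
    unfolding mpow_def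
  proof (intro prod_mono conjI)
    fix i
    have "fact (\<gamma> i + \<beta> i) / fact (\<gamma> i) \<le> real (\<gamma> i + \<beta> i) ^ \<beta> i"
      using fact_add_le[of "\<gamma> i" "\<beta> i"] by (simp add: field_simps)
    also have "\<dots> \<le> real (\<gamma> i + L) ^ \<beta> i" using le_deg[of \<beta> i] assms by (intro power_mono) auto
    finally show "fact (\<gamma> i + \<beta> i) / fact (\<gamma> i) \<le> real (\<gamma> i + L) ^ \<beta> i" .
  qed auto
  moreover have "fact (deg \<gamma>) / fact (deg \<gamma> + deg \<beta>) * real (deg \<gamma>) ^ deg \<beta> \<le> 1"
    using fact_add_ge[of "deg \<gamma>" "deg \<beta>"] by (simp add: field_simps)
  ultimately have "(\<Prod>i\<in>UNIV. fact (\<gamma> i + \<beta> i) / fact (\<gamma> i)) * (fact (deg \<gamma>) / fact (deg \<gamma> + deg \<beta>) * real (deg \<gamma>) ^ deg \<beta>)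
     \<le> mpow (\<lambda>i. real (\<gamma> i + L)) \<beta> * 1"
    by (intro mult_mono mpow_nonneg) auto
  then show ?thesis unfolding multinom_ratio by (simp add: mult_ac)
qed

lemma multinom_ratio_ge:
  "mpow (\<lambda>i. real (\<gamma> i)) \<beta> \<le> multinom \<gamma> / multinom (\<gamma> + \<beta>) * real (deg \<gamma> + deg \<beta>) ^ deg \<beta>"
proof -
  have "mpow (\<lambda>i. real (\<gamma> i)) \<beta> \<le> (\<Prod>i\<in>UNIV. fact (\<gamma> i + \<beta> i) / fact (\<gamma> i))"
    unfolding mpow_def
    using fact_add_ge[of "\<gamma> _" "\<beta> _"] by (intro prod_mono) (auto simp: field_simps)
  moreover have "1 \<le> fact (deg \<gamma>) / fact (deg \<gamma> + deg \<beta>) * real (deg \<gamma> + deg \<beta>) ^ deg \<beta>"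
    using fact_add_le[of "deg \<gamma>" "deg \<beta>"] by (simp add: field_simps)
  ultimately have "mpow (\<lambda>i. real (\<gamma> i)) \<beta> * 1 \<le> (\<Prod>i\<in>UNIV. fact (\<gamma> i + \<beta> i) / fact (\<gamma> i)) *
      (fact (deg \<gamma>) / fact (deg \<gamma> + deg \<beta>) * real (deg \<gamma> + deg \<beta>) ^ deg \<beta>)"
    by (intro mult_mono prod_nonneg) auto
  then show ?thesis unfolding multinom_ratio by (simp add: mult_ac)
qed

text \<open>Moments of the points \<open>(\<gamma> + L) / (M + d L + 1)\<close>, \<open>|\<gamma>| = M\<close>, of the simplex.  As \<open>M\<close> grows they
  converge to the moments of the uniform distribution, which belong to the Hardy space of the ball.\<close>

definition simplex_point :: "nat \<Rightarrow> nat \<Rightarrow> 'n::finite mindex \<Rightarrow> 'n \<Rightarrow> real" where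
  "simplex_point L M \<gamma> = (\<lambda>i. real (\<gamma> i + L) / real (M + CARD('n) * L + 1))"

lemma simplex_point_nonneg: "simplex_point L M \<gamma> i \<ge> 0"
  by (simp add: simplex_point_def)

text \<open>The extra 1 in the denominator makes the inequality strict, so that the square roots of
  the coordinates are the radii of a torus in the open ball.\<close>

lemma simplex_point_sum: "deg \<gamma> = M \<Longrightarrow> (\<Sum>i\<in>UNIV. simplex_point L M \<gamma> i) < 1"
proof -
  assume g: "deg \<gamma> = M"
  have "(\<Sum>i\<in>UNIV. simplex_point L M \<gamma> i) = real (\<Sum>i\<in>UNIV. \<gamma> i + L) / real (M + CARD('a) * L + 1)"
    by (simp add: simplex_point_def sum_divide_distrib)
  also have "(\<Sum>i\<in>UNIV. \<gamma> i + L) = M + CARD('a) * L" using g by (simp add: sum.distrib deg_def)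
  also have "real (M + CARD('a) * L) / real (M + CARD('a) * L + 1) < 1"
  proof -
    have "real k / real (k + 1) < 1" for k by (simp add: divide_less_eq)
    then show ?thesis .
  qed
  finally show ?thesis .
qed

lemma mpow_divide: "mpow (\<lambda>i. x i / c) \<beta> = mpow x \<beta> / c ^ deg \<beta>" for c :: real
  by (simp add: mpow_def power_divide prod_dividef deg_def power_sum)

text \<open>With n = deg \<beta> this is (d - 1)! \<beta>! / (n + d - 1)!, the squared norm of the
  monomial for the normalised surface measure of the unit sphere.\<close>

definition hardy_weight :: "'n::finite mindex \<Rightarrow> real" where
  "hardy_weight \<beta> = 1 / (kap CARD('n) (deg \<beta>) * multinom \<beta>)"

text \<open>A sandwich: \<open>sum_multinom_ratio\<close> evaluates the sums of ratios exactly, so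
  both bounds are multiples of \<open>hardy_weight \<beta>\<close> by factors tending to 1.\<close>

lemma simplex_moment_tendsto:
  fixes \<beta> :: "'n::finite mindex"
  assumes L: "deg \<beta> \<le> L"
  shows "(\<lambda>M. (\<Sum>\<gamma> | deg \<gamma> = M. mpow (simplex_point L M \<gamma>) \<beta>) / kap CARD('n) M) \<longlonglongrightarrow> hardy_weight \<beta>"
proof -
  let ?d = "CARD('n)" and ?n = "deg \<beta>"
  let ?M1 = "\<lambda>M. real (M + ?d * L + 1)"
  have kp: "kap ?d k > 0" for k by simp
  have pd: "(a / c) ^ ?n * q = q * a ^ ?n / c ^ ?n" for a c q :: real by (simp add: power_divide)
  have sumr: "(\<Sum>\<gamma> | deg \<gamma> = M. multinom \<gamma> / multinom (\<gamma> + \<beta>)) = kap ?d (M + ?n) * hardy_weight \<beta>" for M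
    unfolding sum_multinom_ratio hardy_weight_def by simp
  have lower: "(real M / ?M1 M) ^ ?n * (kap ?d (M + ?n) / kap ?d M) * hardy_weight \<beta>
      \<le> (\<Sum>\<gamma> | deg \<gamma> = M. mpow (simplex_point L M \<gamma>) \<beta>) / kap ?d M" for M
  proof -
    have "(real M / ?M1 M) ^ ?n * (kap ?d (M + ?n) * hardy_weight \<beta>) = (\<Sum>\<gamma> | deg \<gamma> = M. (real M / ?M1 M) ^ ?n * (multinom \<gamma> / multinom (\<gamma> + \<beta>)))"
      by (simp only: sumr[symmetric] sum_distrib_left)
    also have "\<dots> \<le> (\<Sum>\<gamma> | deg \<gamma> = M. mpow (simplex_point L M \<gamma>) \<beta>)"
    proof (rule sum_mono)
      fix \<gamma> :: "'n mindex" assume "\<gamma> \<in> {\<gamma>. deg \<gamma> = M}"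
      then have "multinom \<gamma> / multinom (\<gamma> + \<beta>) * real M ^ ?n / ?M1 M ^ ?n \<le> mpow (\<lambda>i. real (\<gamma> i + L)) \<beta> / ?M1 M ^ ?n"
        using multinom_ratio_le[OF L, of \<gamma>] by (intro divide_right_mono) auto
      then show "(real M / ?M1 M) ^ ?n * (multinom \<gamma> / multinom (\<gamma> + \<beta>)) \<le> mpow (simplex_point L M \<gamma>) \<beta>"
        unfolding simplex_point_def mpow_divide pd .
    qed
    finally show ?thesis using kp[of M] by (simp add: field_simps)
  qed
  have upper: "(\<Sum>\<gamma> | deg \<gamma> = M. mpow (simplex_point L M \<gamma>) \<beta>) / kap ?d M
     \<le> (real (M + ?d * L + ?n) / ?M1 M) ^ ?n * (kap ?d (M + (?d * L + ?n)) / kap ?d M) * hardy_weight \<beta>" for M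
  proof -
    \<comment> \<open>Shifting every coordinate by \<open>L\<close> turns the numerators of the
      simplex points into multi-indices of degree \<open>M + d * L\<close>; the sum over the shifted
      ones is then enlarged to all indices of that degree.\<close>
    let ?s = "\<lambda>\<gamma> :: 'n mindex. (\<lambda>i. \<gamma> i + L)"
    have degs: "deg (?s \<gamma>) = deg \<gamma> + ?d * L" for \<gamma> by (simp add: deg_def sum.distrib)
    have inj: "inj_on ?s A" for A by (auto simp: inj_on_def fun_eq_iff)
    have "(\<Sum>\<gamma> | deg \<gamma> = M. mpow (simplex_point L M \<gamma>) \<beta>)
       \<le> (\<Sum>\<gamma> | deg \<gamma> = M. (real (M + ?d * L + ?n) / ?M1 M) ^ ?n * (multinom (?s \<gamma>) / multinom (?s \<gamma> + \<beta>)))"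
    proof (rule sum_mono)
      fix \<gamma> :: "'n mindex" assume "\<gamma> \<in> {\<gamma>. deg \<gamma> = M}"
      then have "mpow (\<lambda>i. real (\<gamma> i + L)) \<beta> / ?M1 M ^ ?n \<le> multinom (?s \<gamma>) / multinom (?s \<gamma> + \<beta>) * real (M + ?d * L + ?n) ^ ?n / ?M1 M ^ ?n"
        using multinom_ratio_ge[of "?s \<gamma>" \<beta>] degs[of \<gamma>] by (intro divide_right_mono) auto
      then show "mpow (simplex_point L M \<gamma>) \<beta> \<le> (real (M + ?d * L + ?n) / ?M1 M) ^ ?n * (multinom (?s \<gamma>) / multinom (?s \<gamma> + \<beta>))"
        unfolding simplex_point_def mpow_divide pd .
    qed
    also have "\<dots> = (real (M + ?d * L + ?n) / ?M1 M) ^ ?n * (\<Sum>\<gamma>\<in>?s ` {\<gamma>. deg \<gamma> = M}. multinom \<gamma> / multinom (\<gamma> + \<beta>))"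
      unfolding sum.reindex[OF inj] by (simp only: sum_distrib_left o_def)
    also have "\<dots> \<le> (real (M + ?d * L + ?n) / ?M1 M) ^ ?n * (\<Sum>\<gamma> | deg \<gamma> = M + ?d * L. multinom \<gamma> / multinom (\<gamma> + \<beta>))"
      using degs by (intro mult_left_mono sum_mono2) auto
    finally show ?thesis unfolding sumr using kp[of M] by (simp add: field_simps)
  qed
  have r1: "(\<lambda>M. real M / ?M1 M) \<longlonglongrightarrow> 1" by real_asymp
  have r2: "(\<lambda>M. real (M + ?d * L + ?n) / ?M1 M) \<longlonglongrightarrow> 1"
  proof -
    have "(\<lambda>M. real (M + a) / real (M + c + 1)) \<longlonglongrightarrow> 1" for a c by real_asymp
    from this[of "?d * L + ?n" "?d * L"] show ?thesis by (simp only: add.assoc)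
  qed
  have d0: "?d > 0" by simp
  have l1: "(\<lambda>M. (real M / ?M1 M) ^ ?n * (kap ?d (M + ?n) / kap ?d M) * hardy_weight \<beta>) \<longlonglongrightarrow> 1 ^ ?n * 1 * hardy_weight \<beta>"
    by (intro tendsto_mult tendsto_power r1 kap_ratio_tendsto[OF d0] tendsto_const)
  have l2: "(\<lambda>M. (real (M + ?d * L + ?n) / ?M1 M) ^ ?n * (kap ?d (M + (?d * L + ?n)) / kap ?d M) * hardy_weight \<beta>) \<longlonglongrightarrow> 1 ^ ?n * 1 * hardy_weight \<beta>"
    by (intro tendsto_mult tendsto_power r2 kap_ratio_tendsto[OF d0] tendsto_const)
  show ?thesis
  proof (rule tendsto_sandwich)
    show "(\<lambda>M. (real M / ?M1 M) ^ ?n * (kap ?d (M + ?n) / kap ?d M) * hardy_weight \<beta>) \<longlonglongrightarrow> hardy_weight \<beta>" using l1 by simp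
    show "(\<lambda>M. (real (M + ?d * L + ?n) / ?M1 M) ^ ?n * (kap ?d (M + (?d * L + ?n)) / kap ?d M) * hardy_weight \<beta>) \<longlonglongrightarrow> hardy_weight \<beta>" using l2 by simp
  qed (intro always_eventually allI lower upper)+
qed

lemma mpow_sqrt: "(\<And>i. t i \<ge> 0) \<Longrightarrow> mpow (\<lambda>i. sqrt (t i)) \<beta> * mpow (\<lambda>i. sqrt (t i)) \<beta> = mpow t \<beta>"
  unfolding mpow_mult[symmetric] by simp

section \<open>The Hardy norm as a limit over tori in the open ball\<close>

context drury_arveson_space
begin

lemma proj_monomial: "finite A \<Longrightarrow> proj A (monomial \<beta>) = (if \<beta> \<in> A then monomial \<beta> else 0)"
  by (simp add: proj_def coef_monomial if_distrib[of "\<lambda>c. c \<odot> _"] cong: if_cong)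

lemma trunc_lincomb:
  assumes "finite B" "\<And>\<beta>. \<beta> \<in> B \<Longrightarrow> deg \<beta> < L"
  shows "trunc L (\<Sum>\<beta>\<in>B. c \<beta> \<odot> monomial \<beta>) = (\<Sum>\<beta>\<in>B. c \<beta> \<odot> monomial \<beta>)"
  using assms by (subst proj_sum) (auto intro!: sum.cong simp: proj_smul proj_monomial)

text \<open>\<open>trunc L u = u\<close> says that \<open>u\<close> is a polynomial of degree below
  \<open>L\<close>, so no two of its exponents are aliased on the grid. Square roots appear because
  \<open>t\<close> stands for the squared moduli of the coordinates.\<close>

lemma torus_parseval:
  assumes u: "trunc L u = u" and t: "\<And>i. t i \<ge> 0" "(\<Sum>i\<in>UNIV. t i) < 1" and L: "L > 0"
  defines "z \<equiv> \<lambda>\<theta>. (\<chi> i. torus_point L (\<lambda>i. sqrt (t i)) \<theta> i) :: complex ^ 'n"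
  shows "(\<Sum>\<theta>\<in>torus_grid L. (cmod (u (z \<theta>)))\<^sup>2) = real L ^ CARD('n) * (\<Sum>\<beta> | deg \<beta> < L. (cmod (coef u \<beta>))\<^sup>2 * mpow t \<beta>)"
    and "z \<theta> \<in> ball 0 1"
proof -
  have "norm (z \<theta>) = sqrt (\<Sum>i\<in>UNIV. t i)" for \<theta>
    using t by (simp add: z_def norm_vec_def L2_set_def torus_point_def norm_mult)
  then show ball: "z \<theta> \<in> ball 0 1" for \<theta> using t by (simp add: mem_ball_0 real_sqrt_lt_1_iff)
  let ?D = "{\<beta> :: 'n mindex. deg \<beta> < L}"
  let ?p = "\<lambda>\<theta>. mpow (torus_point L (\<lambda>i. sqrt (t i)) \<theta>)"
  have val: "u (z \<theta>) = (\<Sum>\<beta>\<in>?D. coef u \<beta> * ?p \<theta> \<beta>)" for \<theta>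
  proof -
    have "u (z \<theta>) = trunc L u (z \<theta>)" by (simp only: u)
    also have "\<dots> = (\<Sum>\<beta>\<in>?D. coef u \<beta> * ?p \<theta> \<beta>)"
      using ball[of \<theta>] by (simp add: proj_def sum_fun_apply monomial_def) (simp add: z_def mpow_def)
    finally show ?thesis .
  qed
  have "complex_of_real (\<Sum>\<theta>\<in>torus_grid L. (cmod (u (z \<theta>)))\<^sup>2) = (\<Sum>\<theta>\<in>torus_grid L. u (z \<theta>) * cnj (u (z \<theta>)))"
    by (simp add: complex_norm_square del: of_real_power)
  also have "\<dots> = (\<Sum>\<theta>\<in>torus_grid L. \<Sum>\<beta>\<in>?D. \<Sum>\<beta>'\<in>?D. coef u \<beta> * cnj (coef u \<beta>') * (?p \<theta> \<beta> * cnj (?p \<theta> \<beta>')))"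
    by (simp add: val sum_product mult_ac)
  also have "\<dots> = (\<Sum>\<beta>\<in>?D. \<Sum>\<beta>'\<in>?D. \<Sum>\<theta>\<in>torus_grid L. coef u \<beta> * cnj (coef u \<beta>') * (?p \<theta> \<beta> * cnj (?p \<theta> \<beta>')))"
    by (subst sum.swap, rule sum.cong[OF refl], rule sum.swap)
  also have "\<dots> = (\<Sum>\<beta>\<in>?D. \<Sum>\<beta>'\<in>?D. if \<beta> = \<beta>' then of_real (real L ^ CARD('n) * ((cmod (coef u \<beta>))\<^sup>2 * mpow t \<beta>)) else 0)"
  proof (intro sum.cong refl)
    fix \<beta> \<beta>' :: "'n mindex" assume *: "\<beta> \<in> ?D" "\<beta>' \<in> ?D"
    have "(\<forall>i. \<beta> i mod L = \<beta>' i mod L) \<longleftrightarrow> \<beta> = \<beta>'"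
      using le_deg[of \<beta>] le_deg[of \<beta>'] * by (metis ext le_less_trans mod_less mem_Collect_eq)
    then have "(\<Sum>\<theta>\<in>torus_grid L. ?p \<theta> \<beta> * cnj (?p \<theta> \<beta>')) = (if \<beta> = \<beta>' then of_nat L ^ CARD('n) * of_real (mpow t \<beta>) else 0)"
      unfolding torus_orthogonality[OF L] using mpow_sqrt[OF t(1), where \<beta> = \<beta>] by (auto simp flip: of_real_mult)
    then show "(\<Sum>\<theta>\<in>torus_grid L. coef u \<beta> * cnj (coef u \<beta>') * (?p \<theta> \<beta> * cnj (?p \<theta> \<beta>')))
      = (if \<beta> = \<beta>' then of_real (real L ^ CARD('n) * ((cmod (coef u \<beta>))\<^sup>2 * mpow t \<beta>)) else 0)"
      unfolding sum_distrib_left[symmetric] using of_real_power[of "real L" "CARD('n)", where 'a = complex]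
      by (simp add: complex_norm_square mult_ac del: of_real_power)
  qed
  also have "\<dots> = of_real (real L ^ CARD('n) * (\<Sum>\<beta>\<in>?D. (cmod (coef u \<beta>))\<^sup>2 * mpow t \<beta>))"
    by (simp add: sum_distrib_left)
  finally show "(\<Sum>\<theta>\<in>torus_grid L. (cmod (u (z \<theta>)))\<^sup>2) = real L ^ CARD('n) * (\<Sum>\<beta> | deg \<beta> < L. (cmod (coef u \<beta>))\<^sup>2 * mpow t \<beta>)"
    by (rule of_real_eq_iff[THEN iffD1])
qed

lemma torus_mult_le:
  assumes u: "trunc L u = u" and pu: "trunc L (p * u) = p * u" and b: "\<And>z. z \<in> ball 0 1 \<Longrightarrow> cmod (p z) \<le> b"
    and t: "\<And>i. t i \<ge> 0" "(\<Sum>i\<in>UNIV. t i) < 1" and L: "L > 0"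
  shows "(\<Sum>\<beta> | deg \<beta> < L. (cmod (coef (p * u) \<beta>))\<^sup>2 * mpow t \<beta>) \<le> b\<^sup>2 * (\<Sum>\<beta> | deg \<beta> < L. (cmod (coef u \<beta>))\<^sup>2 * mpow t \<beta>)"
proof -
  define z where "z \<theta> = ((\<chi> i. torus_point L (\<lambda>i. sqrt (t i)) \<theta> i) :: complex ^ 'n)" for \<theta>
  have ball: "z \<theta> \<in> ball 0 1" for \<theta> unfolding z_def by (rule torus_parseval(2)[OF u t L])
  have "real L ^ CARD('n) * (\<Sum>\<beta> | deg \<beta> < L. (cmod (coef (p * u) \<beta>))\<^sup>2 * mpow t \<beta>) = (\<Sum>\<theta>\<in>torus_grid L. (cmod ((p * u) (z \<theta>)))\<^sup>2)"
    unfolding z_def by (rule torus_parseval(1)[OF pu t L, symmetric])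
  also have "\<dots> \<le> (\<Sum>\<theta>\<in>torus_grid L. b\<^sup>2 * (cmod (u (z \<theta>)))\<^sup>2)"
    using b[OF ball] by (intro sum_mono) (auto simp: norm_mult power_mult_distrib intro!: mult_right_mono power_mono)
  also have "\<dots> = b\<^sup>2 * (real L ^ CARD('n) * (\<Sum>\<beta> | deg \<beta> < L. (cmod (coef u \<beta>))\<^sup>2 * mpow t \<beta>))"
    unfolding sum_distrib_left[symmetric] z_def torus_parseval(1)[OF u t L] ..
  finally have "real L ^ CARD('n) * (\<Sum>\<beta> | deg \<beta> < L. (cmod (coef (p * u) \<beta>))\<^sup>2 * mpow t \<beta>)
      \<le> real L ^ CARD('n) * (b\<^sup>2 * (\<Sum>\<beta> | deg \<beta> < L. (cmod (coef u \<beta>))\<^sup>2 * mpow t \<beta>))"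
    by (simp only: mult_ac)
  then show ?thesis using L by simp
qed

text \<open>The trivial estimate for multiplication on the Hardy space. The pointwise bound on each
  torus is averaged over the simplex points before \<open>M\<close> tends to infinity; at each stage
  the tori lie in the open ball, where \<open>b\<close> bounds \<open>p\<close>.\<close>

lemma hardy_mult_le:
  assumes u: "trunc L u = u" and pu: "trunc L (p * u) = p * u" and b: "\<And>z. z \<in> ball 0 1 \<Longrightarrow> cmod (p z) \<le> b" and L: "L > 0"
  shows "(\<Sum>\<beta> | deg \<beta> < L. (cmod (coef (p * u) \<beta>))\<^sup>2 * hardy_weight \<beta>) \<le> b\<^sup>2 * (\<Sum>\<beta> | deg \<beta> < L. (cmod (coef u \<beta>))\<^sup>2 * hardy_weight \<beta>)"
proof -
  let ?D = "{\<beta> :: 'n mindex. deg \<beta> < L}"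
  let ?W = "\<lambda>M \<beta> :: 'n mindex. (\<Sum>\<gamma> | deg \<gamma> = M. mpow (simplex_point L M \<gamma>) \<beta>) / kap CARD('n) M"
  have lim: "(\<lambda>M. \<Sum>\<beta>\<in>?D. (cmod (coef x \<beta>))\<^sup>2 * ?W M \<beta>) \<longlonglongrightarrow> (\<Sum>\<beta>\<in>?D. (cmod (coef x \<beta>))\<^sup>2 * hardy_weight \<beta>)" for x
    by (intro tendsto_sum tendsto_mult tendsto_const simplex_moment_tendsto) auto
  have eq: "(\<Sum>\<beta>\<in>?D. (cmod (coef x \<beta>))\<^sup>2 * ?W M \<beta>)
      = (\<Sum>\<gamma> | deg \<gamma> = M. \<Sum>\<beta>\<in>?D. (cmod (coef x \<beta>))\<^sup>2 * mpow (simplex_point L M \<gamma>) \<beta>) / kap CARD('n) M" for x M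
    by (simp only: sum_divide_distrib sum_distrib_left times_divide_eq_right) (rule sum.swap)
  have le: "(\<Sum>\<beta>\<in>?D. (cmod (coef (p * u) \<beta>))\<^sup>2 * ?W M \<beta>) \<le> b\<^sup>2 * (\<Sum>\<beta>\<in>?D. (cmod (coef u \<beta>))\<^sup>2 * ?W M \<beta>)" for M
  proof -
    let ?S = "\<lambda>x. \<Sum>\<gamma> | deg \<gamma> = M. \<Sum>\<beta>\<in>?D. (cmod (coef x \<beta>))\<^sup>2 * mpow (simplex_point L M \<gamma>) \<beta>"
    have "?S (p * u) \<le> (\<Sum>\<gamma> | deg \<gamma> = M. b\<^sup>2 * (\<Sum>\<beta>\<in>?D. (cmod (coef u \<beta>))\<^sup>2 * mpow (simplex_point L M \<gamma>) \<beta>))"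
      by (intro sum_mono torus_mult_le[OF u pu b] simplex_point_nonneg simplex_point_sum L) auto
    also have "\<dots> = b\<^sup>2 * ?S u" by (rule sum_distrib_left[symmetric])
    finally have "?S (p * u) / kap CARD('n) M \<le> b\<^sup>2 * ?S u / kap CARD('n) M"
      by (rule divide_right_mono) (simp add: less_imp_le)
    then show ?thesis unfolding eq times_divide_eq_right[of "b\<^sup>2"] .
  qed
  show ?thesis
    by (rule LIMSEQ_le[OF lim tendsto_mult[OF tendsto_const lim]]) (use le in blast)
qed

text \<open>With weights \<open>1 / sqrt (kap d n)\<close> the Drury-Arveson norm of the rescaled function is the Hardy
  norm of the original one.\<close>

definition wt :: "(nat \<Rightarrow> real) \<Rightarrow> nat \<Rightarrow> (complex ^ 'n \<Rightarrow> complex) \<Rightarrow> complex ^ 'n \<Rightarrow> complex" where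
  "wt \<omega> L x = (\<Sum>\<beta> | deg \<beta> < L. (of_real (\<omega> (deg \<beta>)) * coef x \<beta>) \<odot> monomial \<beta>)"

lemma wt_in [simp]: "wt \<omega> L x \<in> H"
  unfolding wt_def by (intro sum_in smul_in monomial_in)

lemma coef_wt: "coef (wt \<omega> L x) \<beta> = (if deg \<beta> < L then of_real (\<omega> (deg \<beta>)) * coef x \<beta> else 0)"
  unfolding wt_def coef_lincomb[OF finite_deg_less] by simp

lemma nm_wt_sq: "(nm (wt \<omega> L x))\<^sup>2 = (\<Sum>\<beta> | deg \<beta> < L. (\<omega> (deg \<beta>))\<^sup>2 * ((cmod (coef x \<beta>))\<^sup>2 / multinom \<beta>))"
  unfolding wt_def nm_lincomb[OF finite_deg_less] by (simp add: norm_mult power_mult_distrib)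

lemma wt_add: "x \<in> H \<Longrightarrow> y \<in> H \<Longrightarrow> wt \<omega> L (x + y) = wt \<omega> L x + wt \<omega> L y"
  by (simp add: wt_def coef_add distrib_left smul_distrib sum.distrib del: plus_fun_apply)

lemma wt_smul: "x \<in> H \<Longrightarrow> wt \<omega> L (c \<odot> x) = c \<odot> wt \<omega> L x"
  by (simp add: wt_def coef_smul smul_sum mult_ac)

lemma wt_sum: "(\<And>i. i \<in> I \<Longrightarrow> f i \<in> H) \<Longrightarrow> wt \<omega> L (sum f I) = (\<Sum>i\<in>I. wt \<omega> L (f i))"
  by (induction I rule: infinite_finite_induct)
    (auto simp: wt_add sum_in wt_def[of _ _ 0] simp del: plus_fun_apply)

lemma wt_monomial: "wt \<omega> L (monomial \<beta>) = (if deg \<beta> < L then of_real (\<omega> (deg \<beta>)) \<odot> monomial \<beta> else 0)"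
  by (rule eq_if_coef_eq) (auto simp: coef_wt coef_smul coef_monomial)

lemma nm_hardy_mult_le:
  assumes u: "trunc L u = u" and pu: "trunc L (p * u) = p * u" and b: "\<And>z. z \<in> ball 0 1 \<Longrightarrow> cmod (p z) \<le> b" and L: "L > 0"
  shows "nm (wt (\<lambda>n. 1 / sqrt (kap CARD('n) n)) L (p * u)) \<le> b * nm (wt (\<lambda>n. 1 / sqrt (kap CARD('n) n)) L u)"
proof (rule power2_le_imp_le)
  have w: "(1 / sqrt (kap CARD('n) n))\<^sup>2 = 1 / kap CARD('n) n" for n
    using kap_pos[of "CARD('n)" n] by (simp add: power_divide less_imp_le)
  have eq: "(nm (wt (\<lambda>n. 1 / sqrt (kap CARD('n) n)) L x))\<^sup>2 = (\<Sum>\<beta> | deg \<beta> < L. (cmod (coef x \<beta>))\<^sup>2 * hardy_weight \<beta>)" for x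
    unfolding nm_wt_sq w hardy_weight_def by simp
  show "(nm (wt (\<lambda>n. 1 / sqrt (kap CARD('n) n)) L (p * u)))\<^sup>2 \<le> (b * nm (wt (\<lambda>n. 1 / sqrt (kap CARD('n) n)) L u))\<^sup>2"
    unfolding power_mult_distrib eq by (rule hardy_mult_le[OF u pu b L])
  have "0 \<le> cmod (p 0)" by simp
  also have "\<dots> \<le> b" by (rule b) (simp add: mem_ball_0)
  finally show "0 \<le> b * nm (wt (\<lambda>n. 1 / sqrt (kap CARD('n) n)) L u)" by simp
qed

section \<open>Comparison with the Hardy space in high degrees\<close>

lemma trunc_mono:
  assumes "trunc N x = x" "N \<le> L"
  shows "trunc L x = x"
proof -
  have "{\<alpha> :: 'n mindex. deg \<alpha> < L} \<inter> {\<alpha>. deg \<alpha> < N} = {\<alpha>. deg \<alpha> < N}" using assms by auto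
  then have "trunc L (trunc N x) = trunc N x" by (simp add: proj_proj)
  then show ?thesis by (simp only: assms(1))
qed

lemma trunc_monomial_mult:
  assumes "trunc N u = u" "deg \<alpha> + N \<le> L"
  shows "trunc L (monomial \<alpha> * u) = monomial \<alpha> * u"
proof -
  have inj: "inj_on (\<lambda>\<beta>. \<alpha> + \<beta>) A" for A by (auto intro: inj_onI)
  have "monomial \<alpha> * u = monomial \<alpha> * trunc N u" by (simp only: assms(1))
  also have "\<dots> = (\<Sum>\<gamma>\<in>(\<lambda>\<beta>. \<alpha> + \<beta>) ` {\<beta>. deg \<beta> < N}. coef u (\<gamma> - \<alpha>) \<odot> monomial \<gamma>)"
    unfolding monomial_mult_proj sum.reindex[OF inj] by (simp del: plus_fun_apply)
  finally have eq: "monomial \<alpha> * u = (\<Sum>\<gamma>\<in>(\<lambda>\<beta>. \<alpha> + \<beta>) ` {\<beta>. deg \<beta> < N}. coef u (\<gamma> - \<alpha>) \<odot> monomial \<gamma>)" .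
  show ?thesis unfolding eq using assms(2) by (intro trunc_lincomb) auto
qed

text \<open>The weights \<open>1 / sqrt (kap n)\<close> take \<open>u\<close>, which is
  \<open>h\<close> weighted by \<open>sqrt (kap n)\<close>, back to \<open>h\<close>. Applied after
  multiplication by the monomial \<alpha>, they would restore its product with \<open>h\<close> if
  \<open>h\<close> had been weighted by \<open>sqrt (kap (n + deg \<alpha>))\<close> instead;
  \<open>v \<alpha>\<close> is the difference. The main term \<open>p * u\<close> obeys the Hardy
  bound with \<open>b\<close>, and the corrections have relative size at most \<delta> because
  \<open>h\<close> has no terms below degree \<open>N0\<close>.\<close>

lemma essential_bound_finite:
  assumes A: "finite A" and h: "h \<in> H" "trunc N h = h"
    and low: "\<And>\<beta>. deg \<beta> < N0 \<Longrightarrow> coef h \<beta> = 0"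
    and d: "\<And>\<alpha> n. \<alpha> \<in> A \<Longrightarrow> n \<ge> N0 \<Longrightarrow> \<bar>sqrt (kap CARD('n) (n + deg \<alpha>) / kap CARD('n) n) - 1\<bar> \<le> \<delta>"
    and b: "\<And>z. z \<in> ball 0 1 \<Longrightarrow> cmod ((\<Sum>\<alpha>\<in>A. c \<alpha> \<odot> monomial \<alpha>) z) \<le> b"
    and \<delta>: "\<delta> \<ge> 0"
  shows "nm ((\<Sum>\<alpha>\<in>A. c \<alpha> \<odot> monomial \<alpha>) * h) \<le> (b + \<delta> * (\<Sum>\<alpha>\<in>A. cmod (c \<alpha>))) * nm h"
proof -
  let ?kap = "kap CARD('n)"
  let ?\<rho> = "\<lambda>n. 1 / sqrt (?kap n)"
  define p where "p = (\<Sum>\<alpha>\<in>A. c \<alpha> \<odot> monomial \<alpha>)"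
  define K where "K = (\<Sum>\<alpha>\<in>A. deg \<alpha>)"
  define L where "L = N + K + 1"
  have K: "deg \<alpha> \<le> K" if "\<alpha> \<in> A" for \<alpha> unfolding K_def using A that by (intro member_le_sum) auto
  have L: "L > 0" "N \<le> L" by (simp_all add: L_def)
  define u where "u = wt (\<lambda>n. sqrt (?kap n)) N h"
  define v where "v \<alpha> = wt (\<lambda>n. sqrt (?kap (n + deg \<alpha>)) - sqrt (?kap n)) N h" for \<alpha> :: "'n mindex"
  have kp: "?kap n > 0" for n by simp
  have tr: "trunc N (wt \<omega> N h) = wt \<omega> N h" for \<omega> unfolding wt_def by (intro trunc_lincomb) auto
  have uH: "u \<in> H" and vH: "v \<alpha> \<in> H" for \<alpha> by (simp_all add: u_def v_def)
  have mem: "monomial \<alpha> * x \<in> H" if "x \<in> H" for \<alpha> x using that by (rule monomial_mult_in)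
  have wtwt: "wt \<omega> L (wt \<omega>' N h) = wt (\<lambda>n. \<omega> n * \<omega>' n) N h" for \<omega> \<omega>'
    by (rule eq_if_coef_eq) (use L in \<open>auto simp: coef_wt\<close>)
  have wt1: "wt (\<lambda>n. 1) N h = h"
    using h(2) by (simp add: wt_def proj_def)
  have key: "wt ?\<rho> L (monomial \<alpha> * (u + v \<alpha>)) = monomial \<alpha> * h" if \<alpha>: "\<alpha> \<in> A" for \<alpha>
  proof -
    have uv: "u + v \<alpha> = (\<Sum>\<beta> | deg \<beta> < N. (of_real (sqrt (?kap (deg \<beta> + deg \<alpha>))) * coef h \<beta>) \<odot> monomial \<beta>)"
      unfolding u_def v_def wt_def sum.distrib[symmetric] smul_distrib(3)[symmetric] distrib_right[symmetric]
      by (simp flip: of_real_add)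
    have "wt ?\<rho> L (monomial \<alpha> * (u + v \<alpha>)) = (\<Sum>\<beta> | deg \<beta> < N. (of_real (sqrt (?kap (deg \<beta> + deg \<alpha>))) * coef h \<beta>) \<odot> wt ?\<rho> L (monomial (\<alpha> + \<beta>)))"
      unfolding uv sum_distrib_left mult_smul monomial_mult
      by (subst wt_sum) (simp_all add: wt_smul del: plus_fun_apply)
    also have "\<dots> = (\<Sum>\<beta> | deg \<beta> < N. coef h \<beta> \<odot> monomial (\<alpha> + \<beta>))"
    proof (rule sum.cong[OF refl])
      fix \<beta> :: "'n mindex" assume "\<beta> \<in> {\<beta>. deg \<beta> < N}"
      then have dl: "deg (\<alpha> + \<beta>) < L" using K[OF \<alpha>] by (simp add: L_def)
      have "complex_of_real (sqrt (?kap (deg \<beta> + deg \<alpha>))) * of_real (?\<rho> (deg (\<alpha> + \<beta>))) = 1"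
        using less_imp_neq[OF kp[of "deg \<alpha> + deg \<beta>"], symmetric] by (simp add: add.commute flip: of_real_mult)
      then have e: "complex_of_real (sqrt (?kap (deg \<beta> + deg \<alpha>))) * coef h \<beta> * of_real (?\<rho> (deg (\<alpha> + \<beta>))) = coef h \<beta>"
        by (metis mult.assoc mult.commute mult_1)
      show "(of_real (sqrt (?kap (deg \<beta> + deg \<alpha>))) * coef h \<beta>) \<odot> wt ?\<rho> L (monomial (\<alpha> + \<beta>)) = coef h \<beta> \<odot> monomial (\<alpha> + \<beta>)"
        unfolding wt_monomial if_P[OF dl] smul_smul e ..
    qed
    also have "\<dots> = monomial \<alpha> * trunc N h" by (rule monomial_mult_proj[symmetric])
    finally show ?thesis by (simp only: h(2))
  qed
  have pu: "p * u = (\<Sum>\<alpha>\<in>A. c \<alpha> \<odot> (monomial \<alpha> * u))" unfolding p_def sum_distrib_right by simp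
  have "p * h = (\<Sum>\<alpha>\<in>A. c \<alpha> \<odot> (monomial \<alpha> * h))" unfolding p_def sum_distrib_right by simp
  also have "\<dots> = (\<Sum>\<alpha>\<in>A. c \<alpha> \<odot> (wt ?\<rho> L (monomial \<alpha> * u) + wt ?\<rho> L (monomial \<alpha> * v \<alpha>)))"
    using key mem[OF uH] mem[OF vH] by (intro sum.cong refl) (simp only: distrib_left wt_add flip: wt_add)
  also have "\<dots> = wt ?\<rho> L (p * u) + (\<Sum>\<alpha>\<in>A. c \<alpha> \<odot> wt ?\<rho> L (monomial \<alpha> * v \<alpha>))"
  proof -
    have "wt ?\<rho> L (p * u) = (\<Sum>\<alpha>\<in>A. c \<alpha> \<odot> wt ?\<rho> L (monomial \<alpha> * u))"
      unfolding pu using mem[OF uH] by (subst wt_sum) (auto simp: wt_smul simp del: times_fun_apply)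
    then show ?thesis by (simp only: smul_distrib sum.distrib)
  qed
  finally have split: "p * h = wt ?\<rho> L (p * u) + (\<Sum>\<alpha>\<in>A. c \<alpha> \<odot> wt ?\<rho> L (monomial \<alpha> * v \<alpha>))" .
  have tu: "trunc L u = u" unfolding u_def by (rule trunc_mono[OF tr L(2)])
  have tv: "trunc L (v \<alpha>) = v \<alpha>" for \<alpha> unfolding v_def by (rule trunc_mono[OF tr L(2)])
  have tmu: "trunc L (monomial \<alpha> * u) = monomial \<alpha> * u" if "\<alpha> \<in> A" for \<alpha>
    unfolding u_def by (rule trunc_monomial_mult[OF tr]) (use K[OF that] in \<open>simp add: L_def\<close>)
  have tmv: "trunc L (monomial \<alpha> * v \<alpha>) = monomial \<alpha> * v \<alpha>" if "\<alpha> \<in> A" for \<alpha>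
    unfolding v_def by (rule trunc_monomial_mult[OF tr]) (use K[OF that] in \<open>simp add: L_def\<close>)
  have tpu: "trunc L (p * u) = p * u"
    unfolding pu using mem[OF uH] tmu by (subst proj_sum) (auto simp: proj_smul simp del: times_fun_apply)
  have n1: "nm (wt ?\<rho> L (p * u)) \<le> b * nm h"
  proof -
    have "nm (wt ?\<rho> L (p * u)) \<le> b * nm (wt ?\<rho> L u)"
      by (rule nm_hardy_mult_le[OF tu tpu _ L(1)]) (unfold p_def, rule b)
    also have "wt ?\<rho> L u = h"
    proof -
      have "(\<lambda>n. ?\<rho> n * sqrt (?kap n)) = (\<lambda>n. 1)" using kp by (auto simp: fun_eq_iff less_imp_neq)
      then show ?thesis unfolding u_def wtwt by (simp only: wt1)
    qed
    finally show ?thesis .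
  qed
  have n2: "nm (wt ?\<rho> L (monomial \<alpha> * v \<alpha>)) \<le> \<delta> * nm h" if \<alpha>: "\<alpha> \<in> A" for \<alpha>
  proof -
    \<comment> \<open>The Hardy bound once more, for a single monomial, which is bounded by 1 on the
      ball.\<close>
    have "nm (wt ?\<rho> L (monomial \<alpha> * v \<alpha>)) \<le> 1 * nm (wt ?\<rho> L (v \<alpha>))"
      by (rule nm_hardy_mult_le[OF tv tmv[OF \<alpha>] _ L(1)]) (simp add: monomial_def cmod_mpow_le_1)
    also have "nm (wt ?\<rho> L (v \<alpha>)) \<le> \<delta> * nm h"
    proof (rule power2_le_imp_le)
      let ?\<omega> = "\<lambda>n. ?\<rho> n * (sqrt (?kap (n + deg \<alpha>)) - sqrt (?kap n))"
      have om: "?\<omega> n = sqrt (?kap (n + deg \<alpha>) / ?kap n) - 1" for n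
        using kp[of n] by (simp add: field_simps real_sqrt_divide)
      have "(nm (wt ?\<rho> L (v \<alpha>)))\<^sup>2 = (\<Sum>\<beta> | deg \<beta> < N. (?\<omega> (deg \<beta>))\<^sup>2 * ((cmod (coef h \<beta>))\<^sup>2 / multinom \<beta>))"
        unfolding v_def wtwt nm_wt_sq ..
      also have "\<dots> \<le> (\<Sum>\<beta> | deg \<beta> < N. \<delta>\<^sup>2 * ((cmod (coef h \<beta>))\<^sup>2 / multinom \<beta>))"
      proof (rule sum_mono)
        fix \<beta> :: "'n mindex"
        show "(?\<omega> (deg \<beta>))\<^sup>2 * ((cmod (coef h \<beta>))\<^sup>2 / multinom \<beta>) \<le> \<delta>\<^sup>2 * ((cmod (coef h \<beta>))\<^sup>2 / multinom \<beta>)"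
        proof (cases "deg \<beta> < N0")
          case False
          then have "\<bar>?\<omega> (deg \<beta>)\<bar> \<le> \<delta>" unfolding om using d[OF \<alpha>, of "deg \<beta>"] by simp
          then have "(?\<omega> (deg \<beta>))\<^sup>2 \<le> \<delta>\<^sup>2" using \<delta> by (intro abs_le_square_iff[THEN iffD1]) simp
          then show ?thesis by (rule mult_right_mono) simp
        qed (simp add: low)
      qed
      also have "\<dots> = \<delta>\<^sup>2 * (nm (trunc N h))\<^sup>2" using h(1) by (simp add: nm_proj_sq sum_distrib_left)
      finally show "(nm (wt ?\<rho> L (v \<alpha>)))\<^sup>2 \<le> (\<delta> * nm h)\<^sup>2" by (simp only: h(2) power_mult_distrib)
      show "0 \<le> \<delta> * nm h" using h \<delta> by simp
    qed
    finally show ?thesis by simp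
  qed
  have "nm (p * h) \<le> nm (wt ?\<rho> L (p * u)) + nm (\<Sum>\<alpha>\<in>A. c \<alpha> \<odot> wt ?\<rho> L (monomial \<alpha> * v \<alpha>))"
    unfolding split by (intro nm_triangle sum_in smul_in wt_in)
  also have "\<dots> \<le> b * nm h + (\<Sum>\<alpha>\<in>A. cmod (c \<alpha>) * (\<delta> * nm h))"
  proof (intro add_mono n1)
    have "nm (\<Sum>\<alpha>\<in>A. c \<alpha> \<odot> wt ?\<rho> L (monomial \<alpha> * v \<alpha>)) \<le> (\<Sum>\<alpha>\<in>A. nm (c \<alpha> \<odot> wt ?\<rho> L (monomial \<alpha> * v \<alpha>)))"
      by (intro nm_sum_le smul_in wt_in)
    also have "\<dots> \<le> (\<Sum>\<alpha>\<in>A. cmod (c \<alpha>) * (\<delta> * nm h))"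
      by (intro sum_mono) (simp add: nm_smul n2 mult_left_mono)
    finally show "nm (\<Sum>\<alpha>\<in>A. c \<alpha> \<odot> wt ?\<rho> L (monomial \<alpha> * v \<alpha>)) \<le> (\<Sum>\<alpha>\<in>A. cmod (c \<alpha>) * (\<delta> * nm h))" .
  qed
  also have "(\<Sum>\<alpha>\<in>A. cmod (c \<alpha>) * (\<delta> * nm h)) = (\<Sum>\<alpha>\<in>A. cmod (c \<alpha>)) * (\<delta> * nm h)"
    by (rule sum_distrib_right[symmetric])
  also have "b * nm h + \<dots> = (b + \<delta> * (\<Sum>\<alpha>\<in>A. cmod (c \<alpha>))) * nm h"
    by (simp add: algebra_simps)
  finally show ?thesis unfolding p_def .
qed

text \<open>The condition \<open>trunc N0 h = 0\<close> describes a subspace of finite codimension,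
  so this bounds the essential norm. \<open>N0\<close> is a degree from which the ratios of
  \<open>kap\<close> are close to 1 for the finitely many shifts occurring in
  \<open>p\<close>.\<close>

theorem essential_norm_poly:
  assumes p: "p \<in> polys" and b: "\<And>z. z \<in> ball 0 1 \<Longrightarrow> cmod (p z) \<le> b" and e: "e > 0"
  shows "\<exists>N0. \<forall>h\<in>H. trunc N0 h = 0 \<longrightarrow> nm (p * h) \<le> (b + e) * nm h"
proof -
  obtain A c where pA: "p = (\<Sum>\<alpha>\<in>A. c \<alpha> \<odot> monomial \<alpha>)" and A: "finite A" using p by (auto simp: polys_def)
  define S where "S = (\<Sum>\<alpha>\<in>A. cmod (c \<alpha>))"
  have S: "S \<ge> 0" unfolding S_def by (intro sum_nonneg) auto
  \<comment> \<open>\<open>S + 1\<close> instead of \<open>S\<close> covers the case that all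
    coefficients vanish.\<close>
  define \<delta> where "\<delta> = e / (S + 1)"
  have \<delta>: "\<delta> > 0" "\<delta> * S \<le> e" using e S by (auto simp: \<delta>_def field_simps)
  have "\<forall>\<^sub>F n in sequentially. \<forall>\<alpha>\<in>A. \<bar>sqrt (kap CARD('n) (n + deg \<alpha>) / kap CARD('n) n) - 1\<bar> \<le> \<delta>"
  proof (intro eventually_ball_finite A ballI)
    fix \<alpha> :: "'n mindex"
    have "(\<lambda>n. sqrt (kap CARD('n) (n + deg \<alpha>) / kap CARD('n) n)) \<longlonglongrightarrow> sqrt 1"
      by (intro tendsto_real_sqrt kap_ratio_tendsto) simp
    then have "\<forall>\<^sub>F n in sequentially. dist (sqrt (kap CARD('n) (n + deg \<alpha>) / kap CARD('n) n)) (sqrt 1) < \<delta>"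
      using \<delta>(1) by (rule tendstoD)
    then show "\<forall>\<^sub>F n in sequentially. \<bar>sqrt (kap CARD('n) (n + deg \<alpha>) / kap CARD('n) n) - 1\<bar> \<le> \<delta>"
      by (rule eventually_mono) (simp add: dist_real_def)
  qed
  then obtain N0 where N0: "\<And>n \<alpha>. n \<ge> N0 \<Longrightarrow> \<alpha> \<in> A \<Longrightarrow> \<bar>sqrt (kap CARD('n) (n + deg \<alpha>) / kap CARD('n) n) - 1\<bar> \<le> \<delta>"
    unfolding eventually_sequentially by blast
  have "nm (p * h) \<le> (b + e) * nm h" if h: "h \<in> H" "trunc N0 h = 0" for h
  proof (rule LIMSEQ_le)
    obtain C where C: "\<And>x. x \<in> H \<Longrightarrow> p * x \<in> H \<and> nm (p * x) \<le> C * nm x"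
      using polys_mult[OF p] by blast
    have "nm (p * trunc N h - p * h) \<le> C * nm (trunc N h - h)" for N
      using C[OF diff_in[OF proj_in h(1)], THEN conjunct2] by (simp only: right_diff_distrib)
    then have "lim_in (\<lambda>N. p * trunc N h) (p * h)"
      by (intro lim_in_bounded[where A = "\<lambda>v. p * v" and C = C] lim_trunc h proj_in C[THEN conjunct1])
    then show "(\<lambda>N. nm (p * trunc N h)) \<longlonglongrightarrow> nm (p * h)"
      by (intro lim_in_nm C[THEN conjunct1] h proj_in)
    show "(\<lambda>N. (b + e) * nm (trunc N h)) \<longlonglongrightarrow> (b + e) * nm h"
      by (intro tendsto_mult_left lim_in_nm lim_trunc h proj_in)
    have low: "coef h \<beta> = 0" if "deg \<beta> < N0" for \<beta>
      using coef_proj[of "{\<alpha>. deg \<alpha> < N0}" h \<beta>] h(2) that by simp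
    have "nm (p * trunc N h) \<le> (b + e) * nm (trunc N h)" for N
    proof -
      have "nm (p * trunc N h) \<le> (b + \<delta> * S) * nm (trunc N h)"
        unfolding pA S_def
      proof (rule essential_bound_finite[OF A, where N = N and N0 = N0])
        show "trunc N (trunc N h) = trunc N h" by (simp add: proj_proj)
        show "coef (trunc N h) \<beta> = 0" if "deg \<beta> < N0" for \<beta> using low[OF that] by (simp add: coef_proj)
        show "cmod ((\<Sum>\<alpha>\<in>A. c \<alpha> \<odot> monomial \<alpha>) z) \<le> b" if "z \<in> ball 0 1" for z using b[OF that] unfolding pA .
      qed (use N0 \<delta> in auto)
      also have "\<dots> \<le> (b + e) * nm (trunc N h)" using \<delta> by (intro mult_right_mono) auto
      finally show ?thesis .
    qed
    then show "\<exists>K. \<forall>N\<ge>K. nm (p * trunc N h) \<le> (b + e) * nm (trunc N h)" by blast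
  qed
  then show ?thesis by blast
qed

end

section \<open>Norming vectors\<close>

text \<open>Meant for an \<open>x\<close> of unknown sign: if \<open>1 + x\<close> is negative, then
  so is \<open>1 + 2 * x\<close>; otherwise square and drop the quadratic term.\<close>

lemma one_plus_double_le_square:
  fixes x w :: real
  assumes "1 + x < w"
  shows "1 + 2 * x \<le> w\<^sup>2"
proof (cases "1 + x \<ge> 0")
  case True
  then have "(1 + x)\<^sup>2 \<le> w\<^sup>2" using assms by (intro power_mono) auto
  moreover have "(1 + x)\<^sup>2 = 1 + 2 * x + x\<^sup>2" by (simp add: power2_eq_square algebra_simps)
  ultimately show ?thesis using zero_le_power2[of x] by linarith
next
  case False
  then show ?thesis using zero_le_power2[of w] by linarith
qed

lemma finite_convergent_subseq:
  fixes a :: "nat \<Rightarrow> 'i \<Rightarrow> complex"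
  assumes "finite D" "\<And>i. i \<in> D \<Longrightarrow> bounded (range (\<lambda>n. a n i))"
  shows "\<exists>r. strict_mono (r :: nat \<Rightarrow> nat) \<and> (\<forall>i\<in>D. convergent (\<lambda>n. a (r n) i))"
  using assms
proof (induction D rule: finite_induct)
  case empty
  then show ?case by (intro exI[of _ id]) (auto simp: strict_mono_def)
next
  case (insert x D)
  then obtain r where r: "strict_mono (r :: nat \<Rightarrow> nat)" "\<And>i. i \<in> D \<Longrightarrow> convergent (\<lambda>n. a (r n) i)" by auto
  have "bounded (range (\<lambda>n. a (r n) x))"
    using insert(4)[of x] by (rule bounded_subset) auto
  then obtain l s where s: "strict_mono (s :: nat \<Rightarrow> nat)" "((\<lambda>n. a (r n) x) \<circ> s) \<longlonglongrightarrow> l"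
    using bounded_imp_convergent_subsequence by blast
  have "convergent (\<lambda>n. a ((r \<circ> s) n) i)" if "i \<in> insert x D" for i
  proof (cases "i = x")
    case True
    then show ?thesis using s by (auto simp: convergent_def o_def)
  next
    case False
    then have "convergent ((\<lambda>n. a (r n) i) \<circ> s)"
      using that r(2) by (intro convergent_subseq_convergent s(1)) auto
    then show ?thesis by (simp add: o_def)
  qed
  then show ?case using strict_mono_o[OF r(1) s(1)] by blast
qed

section \<open>The algebra A_d as a normed space\<close>

context drury_arveson_space
begin

lemma A_d_multipliers: "g \<in> A_d H ip \<Longrightarrow> g \<in> multipliers H"
  by (simp add: A_d_def)

lemma A_d_approx: "g \<in> A_d H ip \<Longrightarrow> e > 0 \<Longrightarrow> \<exists>p\<in>polys. mnorm (g - p) < e"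
  by (simp add: A_d_def ball_polynomials_eq)

lemma A_dI: "g \<in> multipliers H \<Longrightarrow> (\<And>e. e > 0 \<Longrightarrow> \<exists>p\<in>polys. mnorm (g - p) < e) \<Longrightarrow> g \<in> A_d H ip"
  by (simp add: A_d_def ball_polynomials_eq)

lemma polys_smul: "p \<in> polys \<Longrightarrow> c \<odot> p \<in> polys"
  unfolding polys_def
proof clarify
  fix A :: "'n mindex set" and a assume "finite A"
  then show "\<exists>B b. c \<odot> (\<Sum>\<alpha>\<in>A. a \<alpha> \<odot> monomial \<alpha>) = (\<Sum>\<alpha>\<in>B. b \<alpha> \<odot> monomial \<alpha>) \<and> finite B"
    by (intro exI[of _ A] exI[of _ "\<lambda>\<alpha>. c * a \<alpha>"]) (simp add: smul_sum)
qed

lemma polys_add: "p \<in> polys \<Longrightarrow> q \<in> polys \<Longrightarrow> p + q \<in> polys"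
proof -
  assume "p \<in> polys" "q \<in> polys"
  then obtain A a B b where p: "p = (\<Sum>\<alpha>\<in>A. a \<alpha> \<odot> monomial \<alpha>)" "finite A"
    and q: "q = (\<Sum>\<alpha>\<in>B. b \<alpha> \<odot> monomial \<alpha>)" "finite B" unfolding polys_def by blast
  have "(\<Sum>\<alpha>\<in>A. a \<alpha> \<odot> monomial \<alpha>) = (\<Sum>\<alpha>\<in>A \<union> B. (if \<alpha> \<in> A then a \<alpha> else 0) \<odot> monomial \<alpha>)"
    using p q by (intro sum.mono_neutral_cong_left) auto
  moreover have "(\<Sum>\<alpha>\<in>B. b \<alpha> \<odot> monomial \<alpha>) = (\<Sum>\<alpha>\<in>A \<union> B. (if \<alpha> \<in> B then b \<alpha> else 0) \<odot> monomial \<alpha>)"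
    using p q by (intro sum.mono_neutral_cong_left) auto
  ultimately have "p + q = (\<Sum>\<alpha>\<in>A \<union> B. ((if \<alpha> \<in> A then a \<alpha> else 0) + (if \<alpha> \<in> B then b \<alpha> else 0)) \<odot> monomial \<alpha>)"
    unfolding p q by (simp only: smul_distrib(3) sum.distrib)
  moreover have "finite (A \<union> B)" using p q by simp
  ultimately show ?thesis unfolding polys_def by (intro CollectI exI conjI)
qed

lemma monomial_polys: "monomial \<alpha> \<in> polys"
  unfolding polys_def by (intro CollectI exI[of _ "{\<alpha>}"] exI[of _ "\<lambda>_. 1"]) simp

lemma A_d_add: "g \<in> A_d H ip \<Longrightarrow> h \<in> A_d H ip \<Longrightarrow> g + h \<in> A_d H ip"
proof (rule A_dI)
  assume g: "g \<in> A_d H ip" and h: "h \<in> A_d H ip"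
  then show "g + h \<in> multipliers H" by (intro multipliers_add A_d_multipliers)
  fix e :: real assume e: "e > 0"
  obtain p q where pq: "p \<in> polys" "q \<in> polys" "mnorm (g - p) < e / 2" "mnorm (h - q) < e / 2"
    using A_d_approx[OF g, of "e / 2"] A_d_approx[OF h, of "e / 2"] e by auto
  have "(g + h) - (p + q) = (g - p) + (h - q)" by simp
  then have "mnorm ((g + h) - (p + q)) \<le> mnorm (g - p) + mnorm (h - q)"
    using g h pq by (simp only:) (intro mnorm_add multipliers_diff A_d_multipliers polys_multipliers)
  then show "\<exists>p\<in>polys. mnorm (g + h - p) < e" using pq polys_add by (intro bexI[of _ "p + q"]) auto
qed

lemma A_d_smul: "g \<in> A_d H ip \<Longrightarrow> c \<odot> g \<in> A_d H ip"
proof (rule A_dI)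
  assume g: "g \<in> A_d H ip"
  then show "c \<odot> g \<in> multipliers H" by (intro multipliers_smul A_d_multipliers)
  fix e :: real assume e: "e > 0"
  then have "e / (cmod c + 1) > 0" by (simp add: add_nonneg_pos)
  then obtain p where p: "p \<in> polys" "mnorm (g - p) < e / (cmod c + 1)"
    using A_d_approx[OF g] by blast
  have m: "g - p \<in> multipliers H" using g p by (intro multipliers_diff A_d_multipliers polys_multipliers)
  have "c \<odot> g - c \<odot> p = c \<odot> (g - p)" by (rule smul_distrib(2)[symmetric])
  then have "mnorm (c \<odot> g - c \<odot> p) \<le> cmod c * mnorm (g - p)" using mnorm_smul[OF m] by (simp only:)
  also have "\<dots> \<le> (cmod c + 1) * mnorm (g - p)" using m by (intro mult_right_mono) auto
  also have "\<dots> < (cmod c + 1) * (e / (cmod c + 1))" using p by (intro mult_strict_left_mono) (auto simp: add_nonneg_pos)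
  also have "\<dots> = e" using norm_ge_zero[of c] by (simp add: field_simps del: norm_ge_zero)
  finally show "\<exists>p\<in>polys. mnorm (c \<odot> g - p) < e" using polys_smul[OF p(1)] by blast
qed

lemma A_d_zero: "0 \<in> A_d H ip"
proof -
  have "0 \<odot> monomial 0 \<in> polys" by (intro polys_smul monomial_polys)
  then have p: "0 \<in> polys" by simp
  have "mnorm 0 \<le> 0" by (rule mnorm_le) auto
  then show ?thesis using p polys_multipliers[OF p] by (intro A_dI) (auto intro!: bexI[of _ 0])
qed

lemma A_d_sum: "(\<And>i. i \<in> I \<Longrightarrow> g i \<in> A_d H ip) \<Longrightarrow> sum g I \<in> A_d H ip"
  by (induction I rule: infinite_finite_induct) (auto intro: A_d_zero A_d_add simp del: plus_fun_apply)

lemma polys_A_d: "p \<in> polys \<Longrightarrow> p \<in> A_d H ip"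
proof (rule A_dI)
  assume p: "p \<in> polys"
  have "mnorm (p - p) \<le> 0" by (rule mnorm_le) auto
  then show "\<exists>q\<in>polys. mnorm (p - q) < e" if "e > 0" for e using p that by (intro bexI[of _ p]) auto
qed (rule polys_multipliers)

lemma less_mnormE:
  assumes g: "g \<in> multipliers H" and r: "r < mnorm g"
  obtains h where "h \<in> H" "nm h \<le> 1" "r < nm (g * h)"
proof -
  have ne: "{nm (mult_op H g h) | h. h \<in> H \<and> nm h \<le> 1} \<noteq> {}"
    using zero_in by (metis (mono_tags, lifting) empty_Collect_eq nm_zero zero_le_one)
  have "r < Sup {nm (mult_op H g h) | h. h \<in> H \<and> nm h \<le> 1}"
    using r by (simp add: mult_norm_def op_norm_def)
  then obtain h where "h \<in> H" "nm h \<le> 1" "r < nm (mult_op H g h)"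
    unfolding less_cSup_iff[OF ne op_norm_bdd_above[OF mult_op_bounded[OF g]]] by blast
  then show ?thesis using that[of h] by (simp add: mult_op_apply)
qed

lemma lim_in_mult:
  assumes "g \<in> multipliers H" "\<And>n. u n \<in> H" "h \<in> H" "lim_in u h"
  shows "lim_in (\<lambda>n. g * u n) (g * h)"
proof (rule lim_in_bounded[where A = "\<lambda>v. g * v" and C = "mnorm g"])
  show "nm (g * u n - g * h) \<le> mnorm g * nm (u n - h)" for n
    using nm_mult_le[OF assms(1) diff_in[OF assms(2,3)]] by (simp only: right_diff_distrib)
qed (intro assms multipliers_mult_in)+

end

section \<open>Compactness of norming sequences\<close>

locale norming_function = drury_arveson_space H ip
  for H :: "(complex ^ 'n \<Rightarrow> complex) set" and ip +
  fixes f :: "complex ^ 'n \<Rightarrow> complex"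
  assumes f_A_d: "f \<in> A_d H ip"
    and sup_norm_f: "sup_norm f < 1"
    and mnorm_f: "mult_norm H ip f = 1"
begin

lemma f_mult: "f \<in> multipliers H"
  by (rule A_d_multipliers[OF f_A_d])

lemma f_mult_in [simp]: "h \<in> H \<Longrightarrow> f * h \<in> H"
  by (rule multipliers_mult_in[OF f_mult])

lemma nm_f_le: "h \<in> H \<Longrightarrow> nm (f * h) \<le> nm h"
  using nm_mult_le[OF f_mult, of h] by (simp only: mnorm_f mult_1)

text \<open>The strict inequality \<open>sup_norm f < 1\<close> becomes a strict contraction on
  functions of high degree: \<open>f\<close> is close in multiplier norm to a polynomial, to which
  \<open>essential_norm_poly\<close> applies.\<close>

lemma essential_gap: "\<exists>c N. 0 \<le> c \<and> c < 1 \<and> (\<forall>h\<in>H. trunc N h = 0 \<longrightarrow> nm (f * h) \<le> c * nm h)"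
proof -
  define s where "s = sup_norm f"
  have bdd: "bdd_above ((\<lambda>z. cmod (f z)) ` ball 0 1)"
    by (rule bdd_aboveI[of _ "mnorm f"]) (auto intro: cmod_le_mnorm[OF f_mult])
  have fz: "cmod (f z) \<le> s" if "z \<in> ball 0 1" for z
    unfolding s_def sup_norm_def by (rule cSUP_upper[OF that bdd])
  have s0: "s \<ge> 0" using order_trans[OF norm_ge_zero fz[of 0]] by (simp add: mem_ball_0)
  have s1: "s < 1" unfolding s_def by (rule sup_norm_f)
  \<comment> \<open>Three errors of size \<open>e\<close> occur: in the sup bound of
    \<open>p\<close>, in its essential norm, and in \<open>f - p\<close>. A quarter of the gap
    leaves their sum short of 1.\<close>
  define e where "e = (1 - s) / 4"
  have e: "e > 0" using s1 by (simp add: e_def)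
  obtain p where p: "p \<in> polys" "mnorm (f - p) < e" using A_d_approx[OF f_A_d e] by blast
  have fp: "f - p \<in> multipliers H" by (intro multipliers_diff f_mult polys_multipliers p)
  have pz: "cmod (p z) \<le> s + e" if "z \<in> ball 0 1" for z
  proof -
    have "cmod (p z) \<le> cmod (f z) + cmod ((f - p) z)"
      using norm_triangle_ineq4[of "f z" "(f - p) z"] by simp
    then show ?thesis using fz[OF that] cmod_le_mnorm[OF fp, of z] p(2) by linarith
  qed
  obtain N where N: "\<And>h. h \<in> H \<Longrightarrow> trunc N h = 0 \<Longrightarrow> nm (p * h) \<le> (s + e + e) * nm h"
    using essential_norm_poly[OF p(1) pz e] by blast
  have "nm (f * h) \<le> (s + 3 * e) * nm h" if h: "h \<in> H" "trunc N h = 0" for h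
  proof -
    have "f * h = p * h + (f - p) * h" by (simp add: left_diff_distrib)
    then have "nm (f * h) \<le> nm (p * h) + nm ((f - p) * h)"
      using nm_triangle[OF polys_mult_in[OF p(1) h(1)] multipliers_mult_in[OF fp h(1)]] by (simp only:)
    also have "nm ((f - p) * h) \<le> mnorm (f - p) * nm h" by (rule nm_mult_le[OF fp h(1)])
    also have "\<dots> \<le> e * nm h" using p h by (intro mult_right_mono) auto
    finally show ?thesis using N[OF h] by (simp add: algebra_simps del: times_fun_apply)
  qed
  moreover have "s + 3 * e < 1" using s1 unfolding e_def by (simp add: field_simps)
  moreover have "s + 3 * e \<ge> 0" using s0 e by simp
  ultimately show ?thesis by blast
qed

text \<open>The parallelogram law shows that \<open>f\<close> almost preserves the norms of differences of late terms of
  the sequence, whose low-degree parts are small along a subsequence.\<close>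

theorem norming_compact:
  assumes u: "\<And>n. u n \<in> H" "\<And>n. nm (u n) \<le> 1" and lim: "(\<lambda>n. nm (f * u n)) \<longlonglongrightarrow> 1"
  obtains r h where "strict_mono (r :: nat \<Rightarrow> nat)" "h \<in> H" "lim_in (u \<circ> r) h" "nm h = 1" "nm (f * h) = 1"
proof -
  obtain c N where c: "0 \<le> c" "c < 1" and gap: "\<And>h. h \<in> H \<Longrightarrow> trunc N h = 0 \<Longrightarrow> nm (f * h) \<le> c * nm h"
    using essential_gap by blast
  let ?D = "{\<alpha> :: 'n mindex. deg \<alpha> < N}"
  \<comment> \<open>There are finitely many coefficients below degree \<open>N\<close>, so a
    subsequence makes all of them converge; the higher degrees are left to the gap.\<close>
  have "bounded (range (\<lambda>n. coef (u n) \<alpha>))" for \<alpha>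
  proof (rule boundedI[of _ "sqrt (multinom \<alpha>)"])
    fix x assume "x \<in> range (\<lambda>n. coef (u n) \<alpha>)"
    then obtain n where x: "x = coef (u n) \<alpha>" by blast
    have "(nm (u n))\<^sup>2 \<le> 1" using u by (simp add: power_le_one)
    then have "multinom \<alpha> * (nm (u n))\<^sup>2 \<le> multinom \<alpha> * 1" by (intro mult_left_mono) auto
    then have "(cmod x)\<^sup>2 \<le> multinom \<alpha>" using coef_le[OF u(1), of n \<alpha>] unfolding x by linarith
    then show "norm x \<le> sqrt (multinom \<alpha>)" by (rule real_le_rsqrt)
  qed
  then obtain r where r: "strict_mono (r :: nat \<Rightarrow> nat)" and conv: "\<And>\<alpha>. \<alpha> \<in> ?D \<Longrightarrow> convergent (\<lambda>n. coef (u (r n)) \<alpha>)"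
    using finite_convergent_subseq[of ?D "\<lambda>n. coef (u n)"] by auto
  define v where "v n = u (r n)" for n
  have v: "v n \<in> H" "nm (v n) \<le> 1" for n using u by (auto simp: v_def)
  have vlim: "(\<lambda>n. nm (f * v n)) \<longlonglongrightarrow> 1"
    using LIMSEQ_subseq_LIMSEQ[OF lim r] by (simp add: o_def v_def)
  have low: "\<exists>K. \<forall>m\<ge>K. \<forall>n\<ge>K. nm (trunc N (v m - v n)) < e" if e: "e > 0" for e
  proof -
    obtain l where l: "\<And>\<alpha>. \<alpha> \<in> ?D \<Longrightarrow> (\<lambda>n. coef (v n) \<alpha>) \<longlonglongrightarrow> l \<alpha>"
      using conv unfolding convergent_def v_def by metis
    have "(\<lambda>n. \<Sum>\<alpha>\<in>?D. (cmod (coef (v n) \<alpha> - l \<alpha>))\<^sup>2 / multinom \<alpha>) \<longlonglongrightarrow> (\<Sum>\<alpha>\<in>?D. (cmod (l \<alpha> - l \<alpha>))\<^sup>2 / multinom \<alpha>)"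
      by (intro tendsto_intros l) auto
    then have "(\<lambda>n. sqrt (\<Sum>\<alpha>\<in>?D. (cmod (coef (v n) \<alpha> - l \<alpha>))\<^sup>2 / multinom \<alpha>)) \<longlonglongrightarrow> sqrt 0"
      by (intro tendsto_real_sqrt) simp
    then obtain K where K: "\<And>n. n \<ge> K \<Longrightarrow> sqrt (\<Sum>\<alpha>\<in>?D. (cmod (coef (v n) \<alpha> - l \<alpha>))\<^sup>2 / multinom \<alpha>) < e / 2"
      using order_tendstoD(2)[of _ "sqrt 0" sequentially "e / 2"] e by (auto simp: eventually_sequentially)
    define g where "g = (\<Sum>\<alpha>\<in>?D. l \<alpha> \<odot> monomial \<alpha>)"
    have gH: "g \<in> H" unfolding g_def by (intro sum_in smul_in monomial_in)
    have "nm (trunc N (v n) - g) < e / 2" if "n \<ge> K" for n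
    proof -
      have "trunc N (v n) - g = (\<Sum>\<alpha>\<in>?D. (coef (v n) \<alpha> - l \<alpha>) \<odot> monomial \<alpha>)"
        by (simp only: g_def proj_def smul_distrib sum_subtractf)
      then have "(nm (trunc N (v n) - g))\<^sup>2 = (\<Sum>\<alpha>\<in>?D. (cmod (coef (v n) \<alpha> - l \<alpha>))\<^sup>2 / multinom \<alpha>)"
        by (simp only: nm_lincomb[OF finite_deg_less])
      then show ?thesis using K[OF that] gH nm_nonneg[of "trunc N (v n) - g"] by (metis diff_in proj_in real_sqrt_unique)
    qed
    then have "nm (trunc N (v m - v n)) < e" if "m \<ge> K" "n \<ge> K" for m n
      using nm_dist_triangle[of "trunc N (v m)" g "trunc N (v n)"] that gH nm_minus_commute[of g "trunc N (v n)"]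
      unfolding proj_diff[OF v(1) v(1)] by (smt (verit) field_sum_of_halves proj_in)
    then show ?thesis by blast
  qed
  obtain h where h: "h \<in> H" "lim_in v h"
  proof (rule Cauchy_lim[of v])
    fix e0 :: real assume e0: "e0 > 0"
    \<comment> \<open>\<open>k\<close> is the level below which
      \<open>(1 - c\<^sup>2) * (nm d)\<^sup>2\<close> has to be brought. The parallelogram law costs
      \<open>k / 4\<close> and the low degrees \<open>5 * e\<close>; with
      \<open>e \<le> k / 16\<close> the total stays below \<open>k\<close>.\<close>
    define k where "k = (1 - c\<^sup>2) * e0\<^sup>2"
    have c2: "c\<^sup>2 < 1" using c by (simp add: power_less_one_iff)
    have k: "k > 0" using c2 e0 by (simp add: k_def)
    define e where "e = min 1 (k / 16)"
    have e: "e > 0" "e \<le> 1" "e \<le> k / 16" using k by (auto simp: e_def)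
    obtain K1 where K1: "\<And>m n. m \<ge> K1 \<Longrightarrow> n \<ge> K1 \<Longrightarrow> nm (trunc N (v m - v n)) < e"
      using low[OF e(1)] by blast
    have "(\<lambda>n. (nm (f * v n))\<^sup>2) \<longlonglongrightarrow> 1\<^sup>2" by (intro tendsto_power vlim)
    then obtain K2 where K2: "\<And>n. n \<ge> K2 \<Longrightarrow> (nm (f * v n))\<^sup>2 > 1 - k / 16"
      using order_tendstoD(1)[of _ "1\<^sup>2" sequentially "1 - k / 16"] k by (auto simp: eventually_sequentially)
    have "nm (v m - v n) < e0" if "m \<ge> max K1 K2" "n \<ge> max K1 K2" for m n
    proof -
      define d where "d = v m - v n"
      have dH: "d \<in> H" using v by (simp add: d_def)
      have d2: "nm d \<le> 2" using nm_triangle_diff[OF v(1) v(1), of m n] v(2)[of m] v(2)[of n] by (simp add: d_def)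
      have "f * d = f * v m - f * v n" "f * (v m + v n) = f * v m + f * v n"
        by (simp_all only: d_def right_diff_distrib distrib_left)
      then have "(nm (f * d))\<^sup>2 = 2 * (nm (f * v m))\<^sup>2 + 2 * (nm (f * v n))\<^sup>2 - (nm (f * (v m + v n)))\<^sup>2"
        using parallelogram[of "f * v m" "f * v n"] v by simp
      moreover have "(nm (f * (v m + v n)))\<^sup>2 \<le> (nm (v m + v n))\<^sup>2"
        using v by (intro power_mono nm_f_le nm_nonneg f_mult_in) auto
      moreover have "(nm (v m + v n))\<^sup>2 + (nm d)\<^sup>2 = 2 * (nm (v m))\<^sup>2 + 2 * (nm (v n))\<^sup>2"
        unfolding d_def using v by (intro parallelogram)
      moreover have "(nm (v m))\<^sup>2 \<le> 1" "(nm (v n))\<^sup>2 \<le> 1" using v by (simp_all add: power_le_one)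
      ultimately have lowb: "(nm d)\<^sup>2 - k / 4 \<le> (nm (f * d))\<^sup>2"
        using K2[of m] K2[of n] that by auto
      have "nm (f * d) \<le> e + c * nm d"
      proof -
        have "f * d = f * trunc N d + f * (d - trunc N d)" by (simp only: distrib_left[symmetric]) simp
        then have "nm (f * d) \<le> nm (f * trunc N d) + nm (f * (d - trunc N d))"
          using dH by (simp only:) (intro nm_triangle f_mult_in diff_in proj_in)
        also have "nm (f * trunc N d) \<le> nm (trunc N d)" by (rule nm_f_le) simp
        also have "\<dots> \<le> e" using K1[of m n] that by (simp add: d_def)
        also have "nm (f * (d - trunc N d)) \<le> c * nm (d - trunc N d)"
          using dH by (intro gap) (auto simp: proj_diff proj_proj simp del: minus_apply)
        also have "\<dots> \<le> c * nm d"
        proof (intro mult_left_mono c)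
          show "nm (d - trunc N d) \<le> nm d"
            using nm_proj_split[of ?D d] dH by (intro power2_le_imp_le[of "nm (d - trunc N d)"]) auto
        qed
        finally show ?thesis by simp
      qed
      then have "(nm (f * d))\<^sup>2 \<le> (e + c * nm d)\<^sup>2" using dH by (intro power_mono) auto
      also have "\<dots> = e * e + 2 * (e * (c * nm d)) + c\<^sup>2 * (nm d)\<^sup>2" by (simp add: power2_eq_square algebra_simps)
      also have "\<dots> \<le> e + 2 * (e * 2) + c\<^sup>2 * (nm d)\<^sup>2"
      proof -
        have "e * e \<le> e * 1" using e by (intro mult_left_mono) auto
        moreover have "e * (c * nm d) \<le> e * (1 * 2)" using e c d2 dH by (intro mult_left_mono mult_mono) auto
        ultimately show ?thesis by simp
      qed
      finally have "(1 - c\<^sup>2) * (nm d)\<^sup>2 \<le> k / 4 + 5 * e" using lowb by (simp add: algebra_simps)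
      also have "\<dots> < (1 - c\<^sup>2) * e0\<^sup>2" using e k unfolding k_def[symmetric] by linarith
      finally have "(nm d)\<^sup>2 < e0\<^sup>2" using c2 by simp
      then show ?thesis unfolding d_def[symmetric] using e0 by (intro power2_less_imp_less[of _ e0]) auto
    qed
    then show "\<exists>N. \<forall>m\<ge>N. \<forall>n\<ge>N. nm (v m - v n) < e0" by blast
  qed (rule v)
  have "(\<lambda>n. nm (f * v n)) \<longlonglongrightarrow> nm (f * h)"
    using v h by (intro lim_in_nm lim_in_mult f_mult f_mult_in)
  then have fh: "nm (f * h) = 1" using vlim LIMSEQ_unique by blast
  have "nm h \<le> 1"
    by (rule LIMSEQ_le_const2[OF lim_in_nm[OF v(1) h]]) (use v in auto)
  then have "nm h = 1" using fh nm_f_le[OF h(1)] by simp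
  moreover have "u \<circ> r = v" by (simp add: v_def fun_eq_iff)
  ultimately show ?thesis using that[of r h] r h fh by simp
qed

definition normers :: "(complex ^ 'n \<Rightarrow> complex) set" where
  "normers = {h \<in> H. nm h = 1 \<and> nm (f * h) = 1}"

lemma normers_nonempty: "normers \<noteq> {}"
proof -
  have "\<exists>h. h \<in> H \<and> nm h \<le> 1 \<and> 1 - 1 / real (Suc n) < nm (f * h)" for n
    by (rule less_mnormE[OF f_mult, of "1 - 1 / real (Suc n)"]) (auto simp: mnorm_f)
  then obtain u where u: "\<And>n. u n \<in> H" "\<And>n. nm (u n) \<le> 1" "\<And>n. 1 - 1 / real (Suc n) < nm (f * u n)" by metis
  have "(\<lambda>n. nm (f * u n)) \<longlonglongrightarrow> 1"
  proof (rule tendsto_sandwich)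
    show "(\<lambda>n. 1 - 1 / real (Suc n)) \<longlonglongrightarrow> 1" by real_asymp
    show "\<forall>\<^sub>F n in sequentially. 1 - 1 / real (Suc n) \<le> nm (f * u n)"
      using u(3) by (intro always_eventually allI less_imp_le)
    show "\<forall>\<^sub>F n in sequentially. nm (f * u n) \<le> 1"
      using order_trans[OF nm_f_le[OF u(1)] u(2)] by (intro always_eventually allI)
  qed auto
  from norming_compact[OF u(1,2) this] show ?thesis unfolding normers_def by blast
qed

text \<open>Differentiating \<open>\<parallel>f + \<epsilon> g\<parallel>\<close> at \<open>\<epsilon> = 0\<close>.\<close>

theorem norming_functional_le:
  assumes add: "\<And>a b. a \<in> A_d H ip \<Longrightarrow> b \<in> A_d H ip \<Longrightarrow> \<psi> (a + b) = \<psi> a + \<psi> b"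
    and hom: "\<And>c a. a \<in> A_d H ip \<Longrightarrow> \<psi> (c \<odot> a) = c * \<psi> a"
    and le: "\<And>a. a \<in> A_d H ip \<Longrightarrow> cmod (\<psi> a) \<le> mnorm a"
    and f: "\<psi> f = 1" and g: "g \<in> A_d H ip"
  shows "\<exists>h\<in>normers. Re (\<psi> g) \<le> Re (ip (g * h) (f * h))"
proof -
  define R where "R = Re (\<psi> g)"
  define a where "a = mnorm g"
  define \<epsilon> where "\<epsilon> n = 1 / real (Suc n)" for n
  have eps: "\<epsilon> n > 0" for n by (simp add: \<epsilon>_def)
  have gm: "g \<in> multipliers H" by (rule A_d_multipliers[OF g])
  have a0: "a \<ge> 0" using gm by (simp add: a_def)
  let ?g = "\<lambda>n. complex_of_real (\<epsilon> n) \<odot> g"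
  have gA: "?g n \<in> A_d H ip" for n by (rule A_d_smul[OF g])
  have fgm: "f + ?g n \<in> multipliers H" for n by (intro multipliers_add f_mult A_d_multipliers gA)
  \<comment> \<open>Subtracting \<open>(\<epsilon> n)\<^sup>2\<close> makes the inequality strict,
    as the choice of a vector requires; being of second order, it does not affect the limit.\<close>
  have big: "1 + \<epsilon> n * R - (\<epsilon> n)\<^sup>2 < mnorm (f + ?g n)" for n
  proof -
    have "\<psi> (f + ?g n) = 1 + of_real (\<epsilon> n) * \<psi> g"
      using add[OF f_A_d gA] hom[OF g] f by simp
    then have "1 + \<epsilon> n * R = Re (\<psi> (f + ?g n))" by (simp add: R_def)
    also have "\<dots> \<le> cmod (\<psi> (f + ?g n))" by (rule complex_Re_le_cmod)
    also have "\<dots> \<le> mnorm (f + ?g n)" by (rule le[OF A_d_add[OF f_A_d gA]])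
    moreover have "(\<epsilon> n)\<^sup>2 > 0" using eps[of n] by simp
    ultimately show ?thesis by linarith
  qed
  have "\<exists>h. h \<in> H \<and> nm h \<le> 1 \<and> 1 + \<epsilon> n * R - (\<epsilon> n)\<^sup>2 < nm ((f + ?g n) * h)" for n
    by (rule less_mnormE[OF fgm big]) blast
  then obtain u where u: "\<And>n. u n \<in> H" "\<And>n. nm (u n) \<le> 1" "\<And>n. 1 + \<epsilon> n * R - (\<epsilon> n)\<^sup>2 < nm ((f + ?g n) * u n)"
    by metis
  define q where "q n = Re (ip (g * u n) (f * u n))" for n
  have gu: "g * u n \<in> H" "f * u n \<in> H" for n using u by (auto intro: multipliers_mult_in[OF gm] f_mult_in)
  have nf: "nm (f * u n) \<le> 1" for n by (rule order_trans[OF nm_f_le[OF u(1)] u(2)])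
  have ng: "nm (g * u n) \<le> a" for n
    using order_trans[OF nm_mult_le[OF gm u(1)] mult_left_mono[OF u(2) a0[unfolded a_def]], of n] by (simp add: a_def)
  have qa: "\<bar>q n\<bar> \<le> a" for n
  proof -
    have "\<bar>q n\<bar> \<le> cmod (ip (g * u n) (f * u n))" unfolding q_def by (rule abs_Re_le_cmod)
    also have "\<dots> \<le> nm (g * u n) * nm (f * u n)" by (rule Cauchy_Schwarz[OF gu])
    also have "\<dots> \<le> a * 1" using gu by (intro mult_mono ng nf a0) auto
    finally show ?thesis by simp
  qed
  have main: "1 + 2 * (\<epsilon> n * R - (\<epsilon> n)\<^sup>2) \<le> (nm (f * u n))\<^sup>2 + 2 * \<epsilon> n * q n + (\<epsilon> n)\<^sup>2 * a\<^sup>2" for n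
  proof -
    let ?x = "\<epsilon> n * R - (\<epsilon> n)\<^sup>2" and ?w = "nm ((f + ?g n) * u n)"
    have "1 + 2 * ?x \<le> ?w\<^sup>2" by (rule one_plus_double_le_square) (use u(3)[of n] in simp)
    also have "(f + ?g n) * u n = f * u n + complex_of_real (\<epsilon> n) \<odot> (g * u n)"
      by (simp only: distrib_right mult_smul)
    also have "(nm (f * u n + complex_of_real (\<epsilon> n) \<odot> (g * u n)))\<^sup>2
       = (nm (f * u n))\<^sup>2 + 2 * \<epsilon> n * q n + (\<epsilon> n)\<^sup>2 * (nm (g * u n))\<^sup>2"
    proof -
      have "Re (ip (f * u n) (g * u n)) = q n"
        unfolding q_def using arg_cong[OF ip_cnj[OF gu], of Re] by simp
      then show ?thesis
        using gu[of n] by (simp add: nm_add_sq ip_smul_right nm_smul power_mult_distrib del: times_fun_apply plus_fun_apply)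
    qed
    also have "(\<epsilon> n)\<^sup>2 * (nm (g * u n))\<^sup>2 \<le> (\<epsilon> n)\<^sup>2 * a\<^sup>2"
      using gu by (intro mult_left_mono power_mono ng) auto
    finally show ?thesis by (simp del: times_fun_apply)
  qed
  have e0: "\<epsilon> \<longlonglongrightarrow> 0" unfolding \<epsilon>_def by real_asymp
  \<comment> \<open>In the order zero of \<epsilon>, \<open>main\<close> says that the chosen
    vectors asymptotically attain the norm of \<open>f\<close>, so that
    \<open>norming_compact\<close> applies to them.\<close>
  have "(\<lambda>n. (nm (f * u n))\<^sup>2) \<longlonglongrightarrow> 1"
  proof (rule tendsto_sandwich)
    have "(\<lambda>n. 1 + 2 * (\<epsilon> n * R - (\<epsilon> n)\<^sup>2) - 2 * \<epsilon> n * a - (\<epsilon> n)\<^sup>2 * a\<^sup>2) \<longlonglongrightarrow> 1 + 2 * (0 * R - 0\<^sup>2) - 2 * 0 * a - 0\<^sup>2 * a\<^sup>2"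
      by (intro tendsto_intros e0)
    then show "(\<lambda>n. 1 + 2 * (\<epsilon> n * R - (\<epsilon> n)\<^sup>2) - 2 * \<epsilon> n * a - (\<epsilon> n)\<^sup>2 * a\<^sup>2) \<longlonglongrightarrow> 1" by simp
    have "1 + 2 * (\<epsilon> n * R - (\<epsilon> n)\<^sup>2) - 2 * \<epsilon> n * a - (\<epsilon> n)\<^sup>2 * a\<^sup>2 \<le> (nm (f * u n))\<^sup>2" for n
    proof -
      have "2 * \<epsilon> n * q n \<le> 2 * \<epsilon> n * a" using qa[of n] eps[of n] by (intro mult_left_mono) auto
      then show ?thesis using main[of n] by linarith
    qed
    then show "\<forall>\<^sub>F n in sequentially. 1 + 2 * (\<epsilon> n * R - (\<epsilon> n)\<^sup>2) - 2 * \<epsilon> n * a - (\<epsilon> n)\<^sup>2 * a\<^sup>2 \<le> (nm (f * u n))\<^sup>2" by simp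
    show "\<forall>\<^sub>F n in sequentially. (nm (f * u n))\<^sup>2 \<le> 1" using nf gu by (simp add: power_le_one)
  qed auto
  then have "(\<lambda>n. sqrt ((nm (f * u n))\<^sup>2)) \<longlonglongrightarrow> sqrt 1" by (rule tendsto_real_sqrt)
  then have lim1: "(\<lambda>n. nm (f * u n)) \<longlonglongrightarrow> 1" using gu by simp
  obtain r h where r: "strict_mono (r :: nat \<Rightarrow> nat)" and h: "h \<in> H" "lim_in (u \<circ> r) h" "nm h = 1" "nm (f * h) = 1"
    by (rule norming_compact[OF u(1) u(2) lim1])
  \<comment> \<open>The order one of \<open>main\<close>: the constant term is removed by
    \<open>(nm (f * u n))\<^sup>2 \<le> 1\<close>, and the rest is divided by
    \<open>2 * \<epsilon> n\<close>.\<close>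
  have Rq: "R \<le> q n + \<epsilon> n * (1 + a\<^sup>2)" for n
  proof -
    have "(nm (f * u n))\<^sup>2 \<le> 1" using nf gu by (simp add: power_le_one)
    then have "2 * \<epsilon> n * R \<le> 2 * \<epsilon> n * q n + (\<epsilon> n)\<^sup>2 * a\<^sup>2 + 2 * (\<epsilon> n)\<^sup>2" using main[of n] by (simp add: algebra_simps)
    also have "\<dots> \<le> 2 * \<epsilon> n * q n + 2 * (\<epsilon> n)\<^sup>2 * a\<^sup>2 + 2 * (\<epsilon> n)\<^sup>2" by simp
    also have "\<dots> = 2 * \<epsilon> n * (q n + \<epsilon> n * (1 + a\<^sup>2))" by (simp add: power2_eq_square algebra_simps)
    finally show ?thesis using eps[of n] by simp
  qed
  have "R \<le> Re (ip (g * h) (f * h)) + 0 * (1 + a\<^sup>2)"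
  proof (rule LIMSEQ_le_const)
    have lg: "lim_in (\<lambda>n. g * u (r n)) (g * h)" and lf: "lim_in (\<lambda>n. f * u (r n)) (f * h)"
      using lim_in_mult[OF gm, of "u \<circ> r" h] lim_in_mult[OF f_mult, of "u \<circ> r" h] u h by (simp_all add: o_def)
    have gh: "g * h \<in> H" "f * h \<in> H" using h by (auto intro: multipliers_mult_in[OF gm] f_mult_in)
    have "(\<lambda>n. ip (g * u (r n)) (f * u (r n)) - ip (g * h) (f * h)) \<longlonglongrightarrow> 0"
    proof (rule Lim_null_comparison)
      have "norm (ip (g * u (r n)) (f * u (r n)) - ip (g * h) (f * h)) \<le> nm (g * u (r n) - g * h) * 1 + nm (g * h) * nm (f * u (r n) - f * h)" for n
      proof -
        have eq: "ip (g * u (r n)) (f * u (r n)) - ip (g * h) (f * h) = ip (g * u (r n) - g * h) (f * u (r n)) + ip (g * h) (f * u (r n) - f * h)"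
          using ip_diff_left[OF gu(1) gh(1) gu(2), of "r n" "r n"] ip_diff_right[OF gu(2) gh(2) gh(1), of "r n"] by simp
        have "norm (ip (g * u (r n) - g * h) (f * u (r n))) \<le> nm (g * u (r n) - g * h) * nm (f * u (r n))"
          by (rule Cauchy_Schwarz[OF diff_in[OF gu(1) gh(1)] gu(2)])
        moreover have "nm (g * u (r n) - g * h) * nm (f * u (r n)) \<le> nm (g * u (r n) - g * h) * 1"
          by (rule mult_left_mono[OF nf nm_nonneg[OF diff_in[OF gu(1) gh(1)]]])
        moreover have "norm (ip (g * h) (f * u (r n) - f * h)) \<le> nm (g * h) * nm (f * u (r n) - f * h)"
          by (rule Cauchy_Schwarz[OF gh(1) diff_in[OF gu(2) gh(2)]])
        ultimately show ?thesis unfolding eq by (intro norm_triangle_le) linarith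
      qed
      then show "\<forall>\<^sub>F n in sequentially. norm (ip (g * u (r n)) (f * u (r n)) - ip (g * h) (f * h)) \<le> nm (g * u (r n) - g * h) * 1 + nm (g * h) * nm (f * u (r n) - f * h)"
        by (intro always_eventually allI)
      have "(\<lambda>n. nm (g * u (r n) - g * h) * 1 + nm (g * h) * nm (f * u (r n) - f * h)) \<longlonglongrightarrow> 0 * 1 + nm (g * h) * 0"
        by (intro tendsto_intros lg[unfolded lim_in_def] lf[unfolded lim_in_def])
      then show "(\<lambda>n. nm (g * u (r n) - g * h) * 1 + nm (g * h) * nm (f * u (r n) - f * h)) \<longlonglongrightarrow> 0" by simp
    qed
    then have "(\<lambda>n. ip (g * u (r n)) (f * u (r n))) \<longlonglongrightarrow> ip (g * h) (f * h)" by (rule LIM_zero_cancel)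
    then have ql: "(\<lambda>n. q (r n)) \<longlonglongrightarrow> Re (ip (g * h) (f * h))" unfolding q_def by (rule tendsto_Re)
    have "(\<lambda>n. \<epsilon> (r n)) \<longlonglongrightarrow> 0" using LIMSEQ_subseq_LIMSEQ[OF e0 r] by (simp add: o_def)
    then show "(\<lambda>n. q (r n) + \<epsilon> (r n) * (1 + a\<^sup>2)) \<longlonglongrightarrow> Re (ip (g * h) (f * h)) + 0 * (1 + a\<^sup>2)"
      by (intro tendsto_intros ql)
    show "\<exists>N. \<forall>n\<ge>N. R \<le> q (r n) + \<epsilon> (r n) * (1 + a\<^sup>2)" using Rq by blast
  qed
  then show ?thesis using h by (auto simp: normers_def R_def)
qed

text \<open>By the parallelogram law on both sides, the contraction inequalities for
  \<open>x + y\<close> and \<open>x - y\<close> add up to an equality, so each of them is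
  one.\<close>

lemma normed_subspace_add:
  assumes "x \<in> H" "y \<in> H" "nm (f * x) = nm x" "nm (f * y) = nm y"
  shows "nm (f * (x + y)) = nm (x + y)"
proof -
  have "(nm (f * (x + y)))\<^sup>2 + (nm (f * (x - y)))\<^sup>2 = (nm (x + y))\<^sup>2 + (nm (x - y))\<^sup>2"
    unfolding distrib_left right_diff_distrib
    using parallelogram[of "f * x" "f * y"] parallelogram[of x y] assms by simp
  moreover have "(nm (f * (x + y)))\<^sup>2 \<le> (nm (x + y))\<^sup>2" "(nm (f * (x - y)))\<^sup>2 \<le> (nm (x - y))\<^sup>2"
    using assms by (auto intro!: power_mono nm_f_le nm_nonneg f_mult_in simp del: times_fun_apply plus_fun_apply minus_apply)
  ultimately have "(nm (f * (x + y)))\<^sup>2 = (nm (x + y))\<^sup>2" by linarith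
  then show ?thesis
    by (rule power2_eq_imp_eq[OF _ nm_nonneg[OF f_mult_in[OF add_in[OF assms(1,2)]]] nm_nonneg[OF add_in[OF assms(1,2)]]])
qed

definition normed_subspace :: "(complex ^ 'n \<Rightarrow> complex) set" where
  "normed_subspace = {x \<in> H. nm (f * x) = nm x}"

lemma normed_subspace_closed:
  "x \<in> normed_subspace \<Longrightarrow> y \<in> normed_subspace \<Longrightarrow> x + y \<in> normed_subspace"
  "x \<in> normed_subspace \<Longrightarrow> c \<odot> x \<in> normed_subspace"
  "0 \<in> normed_subspace"
  using normed_subspace_add[of x y]
  by (auto simp: normed_subspace_def nm_smul simp del: plus_fun_apply times_fun_apply)

text \<open>If orthonormal systems could always be extended, there would be an infinite one
  consisting of norming vectors. \<open>norming_compact\<close> would give it a convergent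
  subsequence, although distinct members are at distance sqrt 2. A system without extension spans,
  since a nonzero remainder could be normalised and added.\<close>

theorem normed_subspace_basis:
  obtains k :: nat and e where "\<And>i. i < k \<Longrightarrow> e i \<in> normed_subspace"
    "\<And>i j. i < k \<Longrightarrow> j < k \<Longrightarrow> ip (e i) (e j) = (if i = j then 1 else 0)"
    "\<And>h. h \<in> normed_subspace \<Longrightarrow> h = (\<Sum>i<k. ip h (e i) \<odot> e i)"
proof -
  define P where "P e n r \<longleftrightarrow> r \<in> normed_subspace \<and> nm r = 1 \<and> (\<forall>i<n. ip r (e i) = 0)"
    for e :: "nat \<Rightarrow> complex ^ 'n \<Rightarrow> complex" and n :: nat and r
  have orth: "ip (e i) (e j) = (if i = j then 1 else 0)"
    if P: "\<And>i. i < n \<Longrightarrow> P e i (e i)" and ij: "i < n" "j < n" for n e i j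
  proof -
    have eH: "e i \<in> H" "e j \<in> H" using P ij by (auto simp: P_def normed_subspace_def)
    consider "i = j" | "i < j" | "j < i" by linarith
    then show ?thesis
    proof cases
      case 1
      then show ?thesis using P[OF ij(1)] eH by (simp add: P_def ip_self)
    next
      case 2
      then have "ip (e j) (e i) = 0" using P[OF ij(2)] by (simp add: P_def)
      then show ?thesis using 2 ip_cnj[OF eH(2) eH(1)] by simp
    next
      case 3
      then show ?thesis using P[OF ij(1)] by (simp add: P_def)
    qed
  qed
  \<comment> \<open>The negated hypothesis of the dependent choice principle: it provides the finite
    system that has no extension.\<close>
  have "\<not> (\<forall>x e. (\<forall>y<x. P e y (e y)) \<longrightarrow> (\<exists>r. P e x r))"
  proof
    assume *: "\<forall>x e. (\<forall>y<x. P e y (e y)) \<longrightarrow> (\<exists>r. P e x r)"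
    have "\<exists>e. \<forall>n. P e n (e n)"
      by (rule dependent_wellorder_choice) (use * in \<open>auto simp: P_def\<close>)
    then obtain e where e: "\<And>n. P e n (e n)" by blast
    have eH: "e n \<in> H" and n1: "nm (e n) = 1" and nf: "nm (f * e n) = 1" for n
      using e[of n] by (auto simp: P_def normed_subspace_def simp del: times_fun_apply)
    have lim1: "(\<lambda>n. nm (f * e n)) \<longlonglongrightarrow> 1" unfolding nf by (rule tendsto_const)
    obtain r h where r: "strict_mono (r :: nat \<Rightarrow> nat)" and h: "h \<in> H" "lim_in (e \<circ> r) h" "nm h = 1" "nm (f * h) = 1"
      by (rule norming_compact[OF eH eq_refl[OF n1] lim1])
    obtain N where N: "\<And>n. n \<ge> N \<Longrightarrow> nm (e (r n) - h) < 1 / 2"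
      using order_tendstoD(2)[OF h(2)[unfolded lim_in_def], of "1 / 2"] by (auto simp: eventually_sequentially)
    have "nm (e (r N) - e (r (Suc N))) < 1"
      using nm_dist_triangle[of "e (r N)" h "e (r (Suc N))"] nm_minus_commute[of h "e (r (Suc N))"] N[of N] N[of "Suc N"] eH h by auto
    then have "(nm (e (r N) - e (r (Suc N))))\<^sup>2 < 1" using eH by (simp add: power_less_one_iff)
    moreover have "r N < r (Suc N)" using r by (simp add: strict_mono_Suc_iff)
    then have "ip (e (r N)) (e (r (Suc N))) = 0" using orth[of "Suc (r (Suc N))" e "r N" "r (Suc N)"] e by auto
    then have "(nm (e (r N) - e (r (Suc N))))\<^sup>2 = 2" using eH n1 by (simp add: nm_diff_sq)
    ultimately show False by simp
  qed
  then obtain k e where e: "\<And>i. i < k \<Longrightarrow> P e i (e i)" and max: "\<And>r. \<not> P e k r" by blast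
  have eE: "e i \<in> normed_subspace" if "i < k" for i using e[OF that] by (simp add: P_def)
  then have eH: "e i \<in> H" if "i < k" for i using that by (auto simp: normed_subspace_def)
  have on: "ip (e i) (e j) = (if i = j then 1 else 0)" if "i < k" "j < k" for i j by (rule orth[OF e that])
  have "h = (\<Sum>i<k. ip h (e i) \<odot> e i)" if h: "h \<in> normed_subspace" for h
  proof -
    have hH: "h \<in> H" using h by (simp add: normed_subspace_def)
    define s where "s = (\<Sum>i<k. ip h (e i) \<odot> e i)"
    define d where "d = h + (-1) \<odot> s"
    have sE: "(\<Sum>i<m. ip h (e i) \<odot> e i) \<in> normed_subspace" if "m \<le> k" for m
      using that
    proof (induction m)
      case 0
      show ?case unfolding lessThan_0 sum.empty by (rule normed_subspace_closed(3))
    next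
      case (Suc m)
      have "(\<Sum>i<m. ip h (e i) \<odot> e i) \<in> normed_subspace" by (rule Suc.IH) (use Suc.prems in simp)
      moreover have "e m \<in> normed_subspace" by (rule eE) (use Suc.prems in simp)
      ultimately show ?case unfolding sum.lessThan_Suc
        by (intro normed_subspace_closed(1,2))
    qed
    have dE: "d \<in> normed_subspace" unfolding d_def s_def by (intro normed_subspace_closed h sE order_refl)
    have dH: "d \<in> H" using dE by (simp add: normed_subspace_def)
    have sH: "s \<in> H" unfolding s_def using eH by (intro sum_in smul_in) auto
    have "ip s (e i) = ip h (e i)" if i: "i < k" for i
    proof -
      have "ip s (e i) = (\<Sum>j<k. ip (ip h (e j) \<odot> e j) (e i))"
        unfolding s_def by (rule ip_sum_left[OF smul_in[OF eH] eH[OF i]]) simp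
      also have "\<dots> = (\<Sum>j<k. ip h (e j) * ip (e j) (e i))"
        by (rule sum.cong[OF refl], rule ip_smul_left[OF eH eH[OF i]]) simp
      also have "\<dots> = (\<Sum>j<k. if j = i then ip h (e i) else 0)"
        using on i by (intro sum.cong) auto
      finally show ?thesis using i by simp
    qed
    then have dorth: "ip d (e i) = 0" if "i < k" for i
      unfolding d_def using that hH sH eH by (simp add: ip_add_left ip_smul_left)
    have "d = 0"
    proof (rule ccontr)
      assume "d \<noteq> 0"
      then have pos: "nm d > 0" using nm_eq_0[OF dH] nm_nonneg[OF dH] by linarith
      have "P e k (complex_of_real (1 / nm d) \<odot> d)"
        unfolding P_def using pos dorth eH dH
        by (auto intro!: normed_subspace_closed dE simp: nm_smul ip_smul_left norm_divide)
      then show False using max by blast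
    qed
    then have "h = s" unfolding d_def by (simp add: fun_eq_iff)
    then show ?thesis unfolding s_def .
  qed
  then show ?thesis using that[of k e] eE on by blast
qed

end

section \<open>The face of norming functionals\<close>

lemma compact_unit_polydisc: "compact {c :: 'i \<Rightarrow> complex. \<forall>p. cmod (c p) \<le> 1}"
proof -
  have "compactin (product_topology (\<lambda>_::'i. euclidean) UNIV) (PiE UNIV (\<lambda>_. cball (0::complex) 1))"
    by (subst compactin_PiE) auto
  moreover have "PiE UNIV (\<lambda>_. cball (0::complex) 1) = {c :: 'i \<Rightarrow> complex. \<forall>p. cmod (c p) \<le> 1}"
    by (auto simp: PiE_def Pi_def)
  ultimately show ?thesis by (simp add: euclidean_product_topology)
qed

section \<open>Predual functionals on M_d and on A_d\<close>

context drury_arveson_space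
begin

lemma predual_linear:
  assumes "\<Psi> \<in> M_predual H ip" "g \<in> multipliers H" "h \<in> multipliers H"
  shows "\<Psi> (g + h) = \<Psi> g + \<Psi> h" "\<Psi> (c \<odot> g) = c * \<Psi> g"
proof -
  obtain \<phi> where \<phi>: "\<phi> \<in> B_predual H ip" "\<Psi> = predual_class H \<phi>" using assms by (auto simp: M_predual_def)
  obtain x y where xy: "range x \<subseteq> H" "range y \<subseteq> H" "summable (\<lambda>n. (nm (x n))\<^sup>2)" "summable (\<lambda>n. (nm (y n))\<^sup>2)"
    and \<phi>xy: "\<phi> = (\<lambda>T. if T \<in> bounded_ops H ip then \<Sum>n. ip (T (x n)) (y n) else 0)"
    using \<phi>(1) unfolding B_predual_def by blast
  have xH: "x n \<in> H" and yH: "y n \<in> H" for n by (rule range_subsetD[OF xy(1)], rule range_subsetD[OF xy(2)])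
  have eq: "\<Psi> k = (\<Sum>n. ip (k * x n) (y n))" if "k \<in> multipliers H" for k
    using that mult_op_bounded[OF that] xH by (simp add: \<phi>(2) predual_class_def \<phi>xy mult_op_apply del: times_fun_apply)
  have sm: "summable (\<lambda>n. ip (k * x n) (y n))" if "k \<in> multipliers H" for k
    using B_predual_terms(2)[OF xy mult_op_bounded[OF that]] xH by (simp add: mult_op_apply del: times_fun_apply)
  have "ip ((g + h) * x n) (y n) = ip (g * x n) (y n) + ip (h * x n) (y n)" for n
    unfolding distrib_right
    by (rule ip_add_left[OF multipliers_mult_in[OF assms(2) xH] multipliers_mult_in[OF assms(3) xH] yH])
  then show "\<Psi> (g + h) = \<Psi> g + \<Psi> h"
    unfolding eq[OF assms(2)] eq[OF assms(3)] eq[OF multipliers_add[OF assms(2,3)]] suminf_add[OF sm[OF assms(2)] sm[OF assms(3)]]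
    by (simp only:)
  have "ip ((c \<odot> g) * x n) (y n) = c * ip (g * x n) (y n)" for n
    unfolding mult_smul by (rule ip_smul_left[OF multipliers_mult_in[OF assms(2) xH] yH])
  then show "\<Psi> (c \<odot> g) = c * \<Psi> g"
    unfolding eq[OF assms(2)] eq[OF multipliers_smul[OF assms(2)]] suminf_mult[OF sm[OF assms(2)], symmetric]
    by (simp only:)
qed

lemma predual_bounded:
  assumes "\<Psi> \<in> M_predual H ip"
  obtains C where "C \<ge> 0" "\<And>g. g \<in> multipliers H \<Longrightarrow> cmod (\<Psi> g) \<le> C * mnorm g"
proof -
  obtain \<phi> where \<phi>: "\<phi> \<in> B_predual H ip" "\<Psi> = predual_class H \<phi>" using assms by (auto simp: M_predual_def)
  obtain C where C: "C \<ge> 0" "\<And>A. A \<in> bounded_ops H ip \<Longrightarrow> cmod (\<phi> A) \<le> C * op_norm H ip A"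
    using B_predual_bound[OF \<phi>(1)] by blast
  then show ?thesis using that[of C] mult_op_bounded by (simp add: \<phi>(2) predual_class_def mult_norm_def)
qed

text \<open>The infimum over the representatives need not be attained, hence the room
  \<open>e\<close>; \<open>d\<close> is scaled so that \<open>d * mnorm g\<close> stays within
  it.\<close>

lemma predual_norm_bound:
  assumes \<Psi>: "\<Psi> \<in> M_predual H ip" and g: "g \<in> multipliers H" and n: "M_predual_norm H ip \<Psi> \<le> 1"
  shows "cmod (\<Psi> g) \<le> mnorm g"
proof (rule field_le_epsilon)
  fix e :: real assume e: "e > 0"
  let ?S = "{functional_norm (op_norm H ip) (bounded_ops H ip) \<phi> | \<phi>. \<phi> \<in> B_predual H ip \<and> predual_class H \<phi> = \<Psi>}"
  define d where "d = e / (mnorm g + 1)"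
  have d: "d > 0" using e g by (simp add: d_def add_nonneg_pos)
  have ne: "?S \<noteq> {}" using \<Psi> by (auto simp: M_predual_def)
  have bdd: "bdd_below ?S" by (rule bdd_belowI[of _ 0]) (auto intro: functional_norm_nonneg)
  have "Inf ?S < 1 + d" using n d unfolding M_predual_norm_def by linarith
  then obtain \<phi> where \<phi>: "\<phi> \<in> B_predual H ip" "predual_class H \<phi> = \<Psi>"
    "functional_norm (op_norm H ip) (bounded_ops H ip) \<phi> < 1 + d"
    unfolding cInf_less_iff[OF ne bdd] by blast
  have "cmod (\<Psi> g) = cmod (\<phi> (mult_op H g))" using \<phi>(2)[symmetric] g by (simp add: predual_class_def)
  also have "\<dots> \<le> functional_norm (op_norm H ip) (bounded_ops H ip) \<phi> * mnorm g"
    unfolding mult_norm_def by (rule functional_norm_upper[OF \<phi>(1) mult_op_bounded[OF g]])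
  also have "\<dots> \<le> (1 + d) * mnorm g" using \<phi>(3) g by (intro mult_right_mono) auto
  also have "\<dots> \<le> mnorm g + e"
  proof -
    have "d * mnorm g \<le> d * (mnorm g + 1)" using d by (intro mult_left_mono) auto
    also have "\<dots> = e" using mnorm_nonneg[OF g] by (simp add: d_def)
    finally show ?thesis by (simp add: distrib_right)
  qed
  finally show "cmod (\<Psi> g) \<le> mnorm g + e" .
qed

lemma A_dual_norm_ge:
  assumes \<Psi>: "\<Psi> \<in> M_predual H ip" and g: "g \<in> A_d H ip" "mnorm g \<le> 1"
  shows "cmod (\<Psi> g) \<le> A_dual_norm H ip \<Psi>"
proof -
  let ?S = "{cmod (\<Psi> v) | v. v \<in> A_d H ip \<and> mnorm v \<le> 1}"
  obtain C where C: "C \<ge> 0" "\<And>g. g \<in> multipliers H \<Longrightarrow> cmod (\<Psi> g) \<le> C * mnorm g"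
    using predual_bounded[OF \<Psi>] by blast
  have bdd: "bdd_above ?S"
  proof (rule bdd_aboveI[of _ C])
    fix r assume "r \<in> ?S"
    then obtain v where v: "r = cmod (\<Psi> v)" "v \<in> A_d H ip" "mnorm v \<le> 1" by blast
    then show "r \<le> C" using C(2)[OF A_d_multipliers[OF v(2)]] mult_left_mono[OF v(3) C(1)] by simp
  qed
  show ?thesis unfolding A_dual_norm_def functional_norm_def
    using g by (intro cSup_upper[OF _ bdd]) blast
qed

text \<open>Homogeneity replaces the supremum over the unit ball by one inequality for each
  \<open>g\<close>, the form in which \<open>representation\<close> takes it. Where
  \<open>mnorm g = 0\<close>, boundedness of \<Psi> takes the place of scaling.\<close>

lemma A_dual_norm_le_1_iff:
  assumes \<Psi>: "\<Psi> \<in> M_predual H ip"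
  shows "A_dual_norm H ip \<Psi> \<le> 1 \<longleftrightarrow> (\<forall>g\<in>A_d H ip. cmod (\<Psi> g) \<le> mnorm g)"
proof -
  let ?S = "{cmod (\<Psi> v) | v. v \<in> A_d H ip \<and> mnorm v \<le> 1}"
  obtain C where C: "C \<ge> 0" "\<And>g. g \<in> multipliers H \<Longrightarrow> cmod (\<Psi> g) \<le> C * mnorm g"
    using predual_bounded[OF \<Psi>] by blast
  have ne: "?S \<noteq> {}"
  proof -
    have "mnorm 0 \<le> 0" by (rule mnorm_le) auto
    then have "mnorm 0 \<le> 1" by linarith
    then show ?thesis using A_d_zero by blast
  qed
  show ?thesis
  proof
    assume n: "A_dual_norm H ip \<Psi> \<le> 1"
    have unit: "cmod (\<Psi> v) \<le> 1" if "v \<in> A_d H ip" "mnorm v \<le> 1" for v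
      using A_dual_norm_ge[OF \<Psi> that] n by linarith
    show "\<forall>g\<in>A_d H ip. cmod (\<Psi> g) \<le> mnorm g"
    proof
      fix g assume g: "g \<in> A_d H ip"
      then have gm: "g \<in> multipliers H" by (rule A_d_multipliers)
      show "cmod (\<Psi> g) \<le> mnorm g"
      proof (cases "mnorm g = 0")
        case True
        then show ?thesis using C(2)[OF gm] by simp
      next
        case False
        then have pos: "mnorm g > 0" using mnorm_nonneg[OF gm] by linarith
        let ?c = "complex_of_real (1 / mnorm g)"
        have "mnorm (?c \<odot> g) \<le> cmod ?c * mnorm g" by (rule mnorm_smul[OF gm])
        also have "\<dots> = 1" using pos by (simp add: norm_divide)
        finally have "cmod (\<Psi> (?c \<odot> g)) \<le> 1" by (rule unit[OF A_d_smul[OF g]])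
        then have "cmod ?c * cmod (\<Psi> g) \<le> 1"
          unfolding predual_linear(2)[OF \<Psi> gm gm] norm_mult .
        then show ?thesis using pos by (simp add: norm_divide field_simps)
      qed
    qed
  next
    assume le: "\<forall>g\<in>A_d H ip. cmod (\<Psi> g) \<le> mnorm g"
    show "A_dual_norm H ip \<Psi> \<le> 1"
      unfolding A_dual_norm_def functional_norm_def
      by (rule cSup_least[OF ne]) (use le in force)
  qed
qed

end

section \<open>Functionals given by matrices over the norming subspace\<close>

context norming_function
begin

definition orthonormal_basis :: "nat \<Rightarrow> (nat \<Rightarrow> complex ^ 'n \<Rightarrow> complex) \<Rightarrow> bool" where
  "orthonormal_basis k e \<longleftrightarrow> (\<forall>i<k. e i \<in> normed_subspace) \<and>
     (\<forall>i<k. \<forall>j<k. ip (e i) (e j) = (if i = j then 1 else 0)) \<and>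
     (\<forall>h\<in>normed_subspace. h = (\<Sum>i<k. ip h (e i) \<odot> e i))"

lemma orthonormal_basis_exists: "\<exists>k e. orthonormal_basis k e"
  unfolding orthonormal_basis_def by (rule normed_subspace_basis) blast

text \<open>One basis is chosen for good, so that the matrices below can refer to it without a
  parameter.\<close>

definition bdim :: nat where
  "bdim = (SOME k. \<exists>e. orthonormal_basis k e)"

definition bvec :: "nat \<Rightarrow> complex ^ 'n \<Rightarrow> complex" where
  "bvec = (SOME e. orthonormal_basis bdim e)"

lemma orthonormal_basis_bvec: "orthonormal_basis bdim bvec"
proof -
  have "\<exists>e. orthonormal_basis bdim e"
    unfolding bdim_def by (rule someI_ex[OF orthonormal_basis_exists])
  then show ?thesis unfolding bvec_def by (rule someI_ex)
qed

lemmas bvec = orthonormal_basis_bvec[unfolded orthonormal_basis_def]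

lemma bvec_in: "i < bdim \<Longrightarrow> bvec i \<in> H" "i < bdim \<Longrightarrow> f * bvec i \<in> H"
  using bvec by (auto simp: normed_subspace_def intro: f_mult_in simp del: times_fun_apply)

lemma nm_bvec: "i < bdim \<Longrightarrow> nm (bvec i) = 1"
proof -
  assume i: "i < bdim"
  then have "ip (bvec i) (bvec i) = 1" using bvec by simp
  then have "(nm (bvec i))\<^sup>2 = 1" using nm_sq[OF bvec_in(1)[OF i]] by simp
  then show ?thesis using nm_nonneg[OF bvec_in(1)[OF i]] by (simp add: power2_eq_1_iff)
qed

lemma normers_expand:
  assumes "h \<in> normers"
  shows "h \<in> H" "h = (\<Sum>i<bdim. ip h (bvec i) \<odot> bvec i)"
  using assms bvec by (auto simp: normers_def normed_subspace_def simp del: times_fun_apply)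

definition matrix_functional :: "(nat \<times> nat \<Rightarrow> complex) \<Rightarrow> ((complex ^ 'n \<Rightarrow> complex) \<Rightarrow> complex ^ 'n \<Rightarrow> complex) \<Rightarrow> complex" where
  "matrix_functional c A = (\<Sum>i<bdim. \<Sum>j<bdim. c (i, j) * ip (A (bvec i)) (f * bvec j))"

text \<open>Entries with an index outside the basis do not affect \<open>matrix_functional\<close>;
  the bound on all entries makes the set compact in the product topology. The matrices
  \<open>vector_matrix h\<close> satisfy the bound, and convex combinations keep it.\<close>

definition norming_matrices :: "(nat \<times> nat \<Rightarrow> complex) set" where
  "norming_matrices = {c. (\<forall>p. cmod (c p) \<le> 1) \<and>
     (\<forall>A\<in>bounded_ops H ip. cmod (matrix_functional c A) \<le> op_norm H ip A) \<and>
     matrix_functional c (mult_op H f) = 1}"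

lemma continuous_matrix_functional: "continuous_on UNIV (\<lambda>c. matrix_functional c A)"
  unfolding matrix_functional_def
  by (intro continuous_on_sum continuous_on_mult continuous_on_const continuous_on_product_coordinates)

lemma compact_norming_matrices: "compact norming_matrices"
proof -
  have "norming_matrices = {c. \<forall>p. cmod (c p) \<le> 1} \<inter>
      ((\<Inter>A\<in>bounded_ops H ip. {c. cmod (matrix_functional c A) \<le> op_norm H ip A}) \<inter>
       {c. matrix_functional c (mult_op H f) = 1})"
    by (auto simp: norming_matrices_def)
  moreover have "closed ((\<Inter>A\<in>bounded_ops H ip. {c. cmod (matrix_functional c A) \<le> op_norm H ip A}) \<inter>
       {c. matrix_functional c (mult_op H f) = 1})"
    by (intro closed_Int closed_INT ballI closed_Collect_le closed_Collect_eq continuous_on_norm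
        continuous_matrix_functional continuous_on_const)
  ultimately show ?thesis using compact_Int_closed[OF compact_unit_polydisc] by (simp only:)
qed

lemma matrix_functional_combination:
  "matrix_functional (\<lambda>p. of_real a * c p + of_real b * d p) A = of_real a * matrix_functional c A + of_real b * matrix_functional d A"
  unfolding matrix_functional_def by (simp add: sum.distrib sum_distrib_left algebra_simps)

lemma norming_matrices_convex:
  assumes c: "c \<in> norming_matrices" and d: "d \<in> norming_matrices" and t: "0 \<le> t" "t \<le> 1"
  shows "(\<lambda>p. of_real (1 - t) * c p + of_real t * d p) \<in> norming_matrices"
proof -
  have comb: "cmod (of_real (1 - t) * x + of_real t * y) \<le> r" if "cmod x \<le> r" "cmod y \<le> r" for x y r
  proof -
    have "cmod (of_real (1 - t) * x + of_real t * y) \<le> (1 - t) * cmod x + t * cmod y"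
      using t by (intro norm_triangle_le) (simp only: norm_mult norm_of_real abs_of_nonneg diff_ge_0_iff_ge order_refl)
    also have "\<dots> \<le> (1 - t) * r + t * r" using t that by (intro add_mono mult_left_mono) auto
    finally show ?thesis by (simp add: algebra_simps)
  qed
  show ?thesis
    unfolding norming_matrices_def
  proof (intro CollectI conjI allI ballI)
    show "cmod (of_real (1 - t) * c p + of_real t * d p) \<le> 1" for p
      by (intro comb) (use c d in \<open>unfold norming_matrices_def, blast+\<close>)
    show "cmod (matrix_functional (\<lambda>p. of_real (1 - t) * c p + of_real t * d p) A) \<le> op_norm H ip A" if "A \<in> bounded_ops H ip" for A
      unfolding matrix_functional_combination by (intro comb) (use c d that in \<open>unfold norming_matrices_def, blast+\<close>)
    show "matrix_functional (\<lambda>p. of_real (1 - t) * c p + of_real t * d p) (mult_op H f) = 1"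
      unfolding matrix_functional_combination using c d by (simp add: norming_matrices_def)
  qed
qed

text \<open>The rank-one matrix whose functional is \<open>A \<mapsto> ip (A h) (f * h)\<close>.
  Beyond \<open>bdim\<close> the vectors \<open>bvec i\<close> are arbitrary, hence the value 0
  there.\<close>

definition vector_matrix :: "(complex ^ 'n \<Rightarrow> complex) \<Rightarrow> nat \<times> nat \<Rightarrow> complex" where
  "vector_matrix h = (\<lambda>(i, j). if i < bdim \<and> j < bdim then ip h (bvec i) * cnj (ip h (bvec j)) else 0)"

lemma vector_matrix_functional:
  assumes h: "h \<in> normers" and A: "A \<in> bounded_ops H ip"
  shows "matrix_functional (vector_matrix h) A = ip (A h) (f * h)"
proof -
  have hH: "h \<in> H" using normers_expand[OF h] by simp
  have Asum: "A (\<Sum>i<m. ip h (bvec i) \<odot> bvec i) = (\<Sum>i<m. ip h (bvec i) \<odot> A (bvec i))" if "m \<le> bdim" for m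
    using that
  proof (induction m)
    case 0
    have "A 0 = 0" using op_smul[OF A zero_in, of 0] by simp
    then show ?case unfolding lessThan_0 sum.empty .
  next
    case (Suc m)
    have m: "m < bdim" using Suc by simp
    have mem: "(\<Sum>i<m. ip h (bvec i) \<odot> bvec i) \<in> H" using m by (intro sum_in smul_in bvec_in) auto
    have IH: "A (\<Sum>i<m. ip h (bvec i) \<odot> bvec i) = (\<Sum>i<m. ip h (bvec i) \<odot> A (bvec i))"
      by (rule Suc.IH) (use m in simp)
    show ?case
      unfolding sum.lessThan_Suc op_add[OF A mem smul_in[OF bvec_in(1)[OF m]]] op_smul[OF A bvec_in(1)[OF m]] IH ..
  qed
  have "A h = A (\<Sum>i<bdim. ip h (bvec i) \<odot> bvec i)" using normers_expand(2)[OF h] by (simp only:)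
  then have Ah: "A h = (\<Sum>i<bdim. ip h (bvec i) \<odot> A (bvec i))" using Asum by simp
  have "f * h = f * (\<Sum>j<bdim. ip h (bvec j) \<odot> bvec j)" using normers_expand(2)[OF h] by (simp only:)
  then have fh: "f * h = (\<Sum>j<bdim. ip h (bvec j) \<odot> (f * bvec j))" by (simp only: sum_distrib_left mult_smul)
  have memA: "ip h (bvec i) \<odot> A (bvec i) \<in> H" if "i < bdim" for i by (rule smul_in[OF op_in[OF A bvec_in(1)[OF that]]])
  have memf: "ip h (bvec i) \<odot> (f * bvec i) \<in> H" if "i < bdim" for i by (rule smul_in[OF bvec_in(2)[OF that]])
  have fhH: "f * h \<in> H" by (rule f_mult_in[OF hH])
  have "ip (A h) (f * h) = (\<Sum>i<bdim. ip (ip h (bvec i) \<odot> A (bvec i)) (f * h))"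
    unfolding Ah using memA fhH by (intro ip_sum_left) auto
  also have "\<dots> = (\<Sum>i<bdim. \<Sum>j<bdim. ip (ip h (bvec i) \<odot> A (bvec i)) (ip h (bvec j) \<odot> (f * bvec j)))"
    unfolding fh using memA memf by (intro sum.cong refl ip_sum_right) auto
  also have "\<dots> = (\<Sum>i<bdim. \<Sum>j<bdim. vector_matrix h (i, j) * ip (A (bvec i)) (f * bvec j))"
  proof (intro sum.cong refl)
    fix i j assume "i \<in> {..<bdim}" "j \<in> {..<bdim}"
    then have ij: "i < bdim" "j < bdim" by auto
    show "ip (ip h (bvec i) \<odot> A (bvec i)) (ip h (bvec j) \<odot> (f * bvec j)) = vector_matrix h (i, j) * ip (A (bvec i)) (f * bvec j)"
      unfolding ip_smul_left[OF op_in[OF A bvec_in(1)[OF ij(1)]] memf[OF ij(2)]]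
        ip_smul_right[OF bvec_in(2)[OF ij(2)] op_in[OF A bvec_in(1)[OF ij(1)]]]
      using ij by (simp add: vector_matrix_def)
  qed
  finally show ?thesis by (simp add: matrix_functional_def)
qed

lemma vector_matrix_norming:
  assumes h: "h \<in> normers"
  shows "vector_matrix h \<in> norming_matrices"
  unfolding norming_matrices_def
proof (intro CollectI conjI allI ballI)
  have hH: "h \<in> H" and n: "nm h = 1" "nm (f * h) = 1" using h by (auto simp: normers_def)
  have fhH: "f * h \<in> H" by (rule f_mult_in[OF hH])
  show "cmod (vector_matrix h p) \<le> 1" for p
  proof -
    have "cmod (ip h (bvec i)) \<le> 1" if "i < bdim" for i
      using Cauchy_Schwarz[OF hH bvec_in(1)[OF that]] by (simp add: n nm_bvec[OF that])
    then show ?thesis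
      by (cases p) (auto simp: vector_matrix_def norm_mult intro: mult_le_one)
  qed
  show "cmod (matrix_functional (vector_matrix h) A) \<le> op_norm H ip A" if A: "A \<in> bounded_ops H ip" for A
    unfolding vector_matrix_functional[OF h A]
    using Cauchy_Schwarz[OF op_in[OF A hH] fhH] op_norm_bound[OF A hH] unfolding n by linarith
  show "matrix_functional (vector_matrix h) (mult_op H f) = 1"
    unfolding vector_matrix_functional[OF h mult_op_bounded[OF f_mult]] mult_op_apply[OF hH] ip_self[OF fhH] n by simp
qed

text \<open>A finite-dimensional Hahn-Banach argument: a nearest point of the compact convex set of
  norming matrices that missed \<open>\<psi>\<close> would yield a function violating \<open>norming_functional_le\<close>.\<close>

lemma representation_finite:
  assumes add: "\<And>a b. a \<in> A_d H ip \<Longrightarrow> b \<in> A_d H ip \<Longrightarrow> \<psi> (a + b) = \<psi> a + \<psi> b"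
    and hom: "\<And>c a. a \<in> A_d H ip \<Longrightarrow> \<psi> (c \<odot> a) = c * \<psi> a"
    and le: "\<And>a. a \<in> A_d H ip \<Longrightarrow> cmod (\<psi> a) \<le> mnorm a"
    and f: "\<psi> f = 1" and G: "finite G" "G \<subseteq> A_d H ip"
  shows "\<exists>c\<in>norming_matrices. \<forall>g\<in>G. \<psi> g = matrix_functional c (mult_op H g)"
proof -
  define \<Phi> where "\<Phi> c g = matrix_functional c (mult_op H g)" for c g
  define D where "D c = (\<Sum>g\<in>G. (cmod (\<psi> g - \<Phi> c g))\<^sup>2)" for c
  have ne: "norming_matrices \<noteq> {}" using normers_nonempty vector_matrix_norming by blast
  have "continuous_on norming_matrices D"
    unfolding D_def \<Phi>_def
    by (intro continuous_intros continuous_on_subset[OF continuous_matrix_functional]) auto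
  then obtain c0 where c0: "c0 \<in> norming_matrices" and min: "\<And>c. c \<in> norming_matrices \<Longrightarrow> D c0 \<le> D c"
    using continuous_attains_inf[OF compact_norming_matrices ne] by blast
  define w where "w g = \<psi> g - \<Phi> c0 g" for g
  \<comment> \<open>The function that detects the error: the difference of \<psi> and the functional
    of \<open>c0\<close> takes at \<open>k\<close> the value \<open>D c0\<close>, the squared
    distance.\<close>
  define k where "k = (\<Sum>g\<in>G. cnj (w g) \<odot> g)"
  have GA: "g \<in> A_d H ip" if "g \<in> G" for g using G that by blast
  have kA: "k \<in> A_d H ip" unfolding k_def by (intro A_d_sum A_d_smul GA)
  obtain h where h: "h \<in> normers" and kh: "Re (\<psi> k) \<le> Re (ip (k * h) (f * h))"
    using norming_functional_le[OF add hom le f kA] by blast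
  have hH: "h \<in> H" using normers_expand[OF h] by simp
  define d where "d = vector_matrix h"
  have d: "d \<in> norming_matrices" unfolding d_def by (rule vector_matrix_norming[OF h])
  have \<psi>0: "\<psi> 0 = 0" using hom[OF A_d_zero, of 0] by simp
  have \<psi>k: "\<psi> k = (\<Sum>g\<in>G. cnj (w g) * \<psi> g)"
    unfolding k_def using G(1) GA
  proof (induction G rule: finite_induct)
    case empty
    show ?case unfolding sum.empty by (rule \<psi>0)
  next
    case (insert x F)
    have "(\<Sum>g\<in>F. cnj (w g) \<odot> g) \<in> A_d H ip" using insert by (intro A_d_sum A_d_smul) auto
    moreover have x: "x \<in> A_d H ip" using insert by simp
    ultimately have "\<psi> (cnj (w x) \<odot> x + (\<Sum>g\<in>F. cnj (w g) \<odot> g)) = cnj (w x) * \<psi> x + \<psi> (\<Sum>g\<in>F. cnj (w g) \<odot> g)"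
      by (simp only: add A_d_smul hom)
    moreover have "\<psi> (\<Sum>g\<in>F. cnj (w g) \<odot> g) = (\<Sum>g\<in>F. cnj (w g) * \<psi> g)"
      by (rule insert.IH) (use insert.prems in simp)
    ultimately show ?case unfolding sum.insert[OF insert(1,2)] by (simp only:)
  qed
  have \<Phi>k: "\<Phi> c k = (\<Sum>g\<in>G. cnj (w g) * \<Phi> c g)" for c
  proof -
    have mem: "g * bvec i \<in> H" if "g \<in> G" "i < bdim" for g i
      by (rule multipliers_mult_in[OF A_d_multipliers[OF GA[OF that(1)]] bvec_in(1)[OF that(2)]])
    have ipk: "ip (k * bvec i) (f * bvec j) = (\<Sum>g\<in>G. cnj (w g) * ip (g * bvec i) (f * bvec j))" if ij: "i < bdim" "j < bdim" for i j
    proof -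
      have "k * bvec i = (\<Sum>g\<in>G. cnj (w g) \<odot> (g * bvec i))" unfolding k_def sum_distrib_right mult_smul ..
      then have "ip (k * bvec i) (f * bvec j) = (\<Sum>g\<in>G. ip (cnj (w g) \<odot> (g * bvec i)) (f * bvec j))"
        using mem[OF _ ij(1)] bvec_in(2)[OF ij(2)] by (simp only:) (intro ip_sum_left smul_in)
      then show ?thesis using mem[OF _ ij(1)] bvec_in(2)[OF ij(2)] by (simp add: ip_smul_left)
    qed
    have "\<Phi> c k = (\<Sum>i<bdim. \<Sum>j<bdim. \<Sum>g\<in>G. cnj (w g) * (c (i, j) * ip (g * bvec i) (f * bvec j)))"
      unfolding \<Phi>_def matrix_functional_def
      by (intro sum.cong refl) (simp add: mult_op_apply bvec_in ipk sum_distrib_left mult_ac del: times_fun_apply)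
    also have "\<dots> = (\<Sum>g\<in>G. \<Sum>i<bdim. \<Sum>j<bdim. cnj (w g) * (c (i, j) * ip (g * bvec i) (f * bvec j)))"
    proof -
      let ?F = "\<lambda>i j g. cnj (w g) * (c (i, j) * ip (g * bvec i) (f * bvec j))"
      have "(\<Sum>g\<in>G. \<Sum>i<bdim. \<Sum>j<bdim. ?F i j g) = (\<Sum>i<bdim. \<Sum>g\<in>G. \<Sum>j<bdim. ?F i j g)"
        by (rule sum.swap)
      also have "\<dots> = (\<Sum>i<bdim. \<Sum>j<bdim. \<Sum>g\<in>G. ?F i j g)"
        by (rule sum.cong[OF refl], rule sum.swap)
      finally show ?thesis by (rule sym)
    qed
    also have "\<dots> = (\<Sum>g\<in>G. cnj (w g) * \<Phi> c g)"
      unfolding \<Phi>_def matrix_functional_def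
      by (intro sum.cong refl) (simp add: mult_op_apply bvec_in sum_distrib_left del: times_fun_apply)
    finally show ?thesis .
  qed
  have \<Phi>d: "\<Phi> d k = ip (k * h) (f * h)"
    unfolding \<Phi>_def d_def vector_matrix_functional[OF h mult_op_bounded[OF A_d_multipliers[OF kA]]] mult_op_apply[OF hH] ..
  define s where "s g = \<Phi> d g - \<Phi> c0 g" for g
  define X where "X = (\<Sum>g\<in>G. Re (cnj (w g) * s g))"
  define Y where "Y = (\<Sum>g\<in>G. (cmod (s g))\<^sup>2)"
  have Y0: "Y \<ge> 0" unfolding Y_def by (intro sum_nonneg) auto
  \<comment> \<open>By the choice of \<open>h\<close>, the matrix \<open>d\<close> does at least as
    well on \<open>k\<close> as \<psi> does.\<close>
  have D0: "D c0 \<le> X"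
  proof -
    have "D c0 = (\<Sum>g\<in>G. Re (cnj (w g) * w g))"
      unfolding D_def w_def by (intro sum.cong refl) (simp only: cmod_power2, simp add: power2_eq_square algebra_simps)
    also have "\<dots> = Re (\<psi> k - \<Phi> c0 k)"
      unfolding \<psi>k \<Phi>k sum_subtractf[symmetric] Re_sum[symmetric] by (simp add: w_def right_diff_distrib)
    also have "\<dots> \<le> Re (\<Phi> d k - \<Phi> c0 k)" using kh unfolding \<Phi>d by simp
    also have "\<dots> = X"
      unfolding X_def \<Phi>k sum_subtractf[symmetric] Re_sum[symmetric] by (simp add: s_def right_diff_distrib)
    finally show ?thesis .
  qed
  \<comment> \<open>Minimality of \<open>c0\<close> is tested on the segment towards
    \<open>d\<close>. Small \<open>t\<close> forces \<open>X \<le> 0\<close>, and with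
    \<open>D c0 \<le> X\<close> the distance is 0.\<close>
  have "2 * X \<le> t * Y" if t: "0 < t" "t \<le> 1" for t
  proof -
    define c where "c = (\<lambda>p. of_real (1 - t) * c0 p + of_real t * d p)"
    have cN: "c \<in> norming_matrices" unfolding c_def using t by (intro norming_matrices_convex c0 d) auto
    have sq: "(cmod (\<psi> g - \<Phi> c g))\<^sup>2 = (cmod (w g))\<^sup>2 - 2 * t * Re (cnj (w g) * s g) + t\<^sup>2 * (cmod (s g))\<^sup>2" for g
    proof -
      have "\<psi> g - \<Phi> c g = w g - of_real t * s g"
        unfolding c_def \<Phi>_def matrix_functional_combination by (simp add: w_def s_def \<Phi>_def algebra_simps)
      then show ?thesis by (simp only: cmod_power2) (simp add: power2_eq_square algebra_simps)
    qed
    have "D c = (\<Sum>g\<in>G. (cmod (w g))\<^sup>2) - 2 * t * X + t\<^sup>2 * Y"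
      unfolding D_def X_def Y_def sum_distrib_left by (simp only: sq sum.distrib sum_subtractf)
    also have "(\<Sum>g\<in>G. (cmod (w g))\<^sup>2) = D c0" by (simp only: D_def w_def)
    finally have "2 * t * X \<le> t\<^sup>2 * Y" using min[OF cN] by linarith
    then have "t * (2 * X) \<le> t * (t * Y)" by (simp add: power2_eq_square algebra_simps)
    then show ?thesis using t by simp
  qed
  note small = this
  have "X \<le> 0"
  proof (rule ccontr)
    assume "\<not> X \<le> 0"
    then have X: "X > 0" by simp
    define t where "t = min 1 (X / (Y + 1))"
    have t: "0 < t" "t \<le> 1" "t \<le> X / (Y + 1)" using X Y0 by (auto simp: t_def)
    have "t * Y \<le> X / (Y + 1) * (Y + 1)" using t Y0 X by (intro mult_mono) auto
    also have "\<dots> = X" using Y0 by simp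
    finally show False using small[OF t(1,2)] X by linarith
  qed
  then have "D c0 = 0" using D0 sum_nonneg[of G "\<lambda>g. (cmod (\<psi> g - \<Phi> c0 g))\<^sup>2"] unfolding D_def by fastforce
  then have "\<psi> g = \<Phi> c0 g" if "g \<in> G" for g
    using that sum_nonneg_eq_0_iff[OF G(1), of "\<lambda>g. (cmod (\<psi> g - \<Phi> c0 g))\<^sup>2"] unfolding D_def by simp
  then show ?thesis using c0 unfolding \<Phi>_def by blast
qed

text \<open>Each \<open>g\<close> imposes a closed condition on the compact set of norming matrices,
  and \<open>representation_finite\<close> supplies the finite intersection property.\<close>

theorem representation:
  assumes add: "\<And>a b. a \<in> A_d H ip \<Longrightarrow> b \<in> A_d H ip \<Longrightarrow> \<psi> (a + b) = \<psi> a + \<psi> b"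
    and hom: "\<And>c a. a \<in> A_d H ip \<Longrightarrow> \<psi> (c \<odot> a) = c * \<psi> a"
    and le: "\<And>a. a \<in> A_d H ip \<Longrightarrow> cmod (\<psi> a) \<le> mnorm a"
    and f: "\<psi> f = 1"
  obtains c where "c \<in> norming_matrices" "\<And>g. g \<in> A_d H ip \<Longrightarrow> \<psi> g = matrix_functional c (mult_op H g)"
proof -
  have "norming_matrices \<inter> (\<Inter>g\<in>A_d H ip. {c. matrix_functional c (mult_op H g) = \<psi> g}) \<noteq> {}"
  proof (rule compact_imp_fip_image[OF compact_norming_matrices])
    show "closed {c. matrix_functional c (mult_op H g) = \<psi> g}" for g
      by (intro closed_Collect_eq continuous_matrix_functional continuous_on_const)
    fix G assume "finite G" "G \<subseteq> A_d H ip"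
    then obtain c where "c \<in> norming_matrices" "\<forall>g\<in>G. \<psi> g = matrix_functional c (mult_op H g)"
      using representation_finite[OF add hom le f] by blast
    then show "norming_matrices \<inter> (\<Inter>g\<in>G. {c. matrix_functional c (mult_op H g) = \<psi> g}) \<noteq> {}" by auto
  qed
  then show ?thesis using that by fastforce
qed

definition matrix_predual :: "(nat \<times> nat \<Rightarrow> complex) \<Rightarrow> ((complex ^ 'n \<Rightarrow> complex) \<Rightarrow> complex ^ 'n \<Rightarrow> complex) \<Rightarrow> complex" where
  "matrix_predual c = (\<lambda>A. if A \<in> bounded_ops H ip then matrix_functional c A else 0)"

lemma matrix_predual_in: "matrix_predual c \<in> B_predual H ip"
proof -
  define x where "x n = (if n < bdim then bvec n else 0)" for n
  \<comment> \<open>Collecting the sum over \<open>j\<close> in the second argument makes the double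
    sum a series of the kind in \<open>B_predual\<close>; the conjugates are undone by the second
    slot of \<open>ip\<close>.\<close>
  define y where "y n = (if n < bdim then (\<Sum>j<bdim. cnj (c (n, j)) \<odot> (f * bvec j)) else 0)" for n
  have xH: "x n \<in> H" for n using bvec_in by (simp add: x_def)
  have yH: "y n \<in> H" for n unfolding y_def using bvec_in(2) by (auto intro!: sum_in smul_in simp del: times_fun_apply)
  have sx: "summable (\<lambda>n. (nm (x n))\<^sup>2)" by (rule summable_finite[of "{..<bdim}"]) (auto simp: x_def)
  have sy: "summable (\<lambda>n. (nm (y n))\<^sup>2)" by (rule summable_finite[of "{..<bdim}"]) (auto simp: y_def)
  have "(\<Sum>n. ip (A (x n)) (y n)) = matrix_functional c A" if A: "A \<in> bounded_ops H ip" for A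
  proof -
    have "(\<Sum>n. ip (A (x n)) (y n)) = (\<Sum>n<bdim. ip (A (x n)) (y n))"
      by (rule suminf_finite) (auto simp: x_def y_def op_in[OF A zero_in])
    also have "\<dots> = matrix_functional c A"
      unfolding matrix_functional_def
    proof (rule sum.cong[OF refl])
      fix i assume "i \<in> {..<bdim}"
      then have i: "i < bdim" by simp
      have Ai: "A (bvec i) \<in> H" by (rule op_in[OF A bvec_in(1)[OF i]])
      have "ip (A (bvec i)) (\<Sum>j<bdim. cnj (c (i, j)) \<odot> (f * bvec j)) = (\<Sum>j<bdim. ip (A (bvec i)) (cnj (c (i, j)) \<odot> (f * bvec j)))"
        using Ai bvec_in(2) by (intro ip_sum_right smul_in) auto
      also have "\<dots> = (\<Sum>j<bdim. c (i, j) * ip (A (bvec i)) (f * bvec j))"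
        using Ai bvec_in(2) by (intro sum.cong refl) (simp add: ip_smul_right)
      finally show "ip (A (x i)) (y i) = (\<Sum>j<bdim. c (i, j) * ip (A (bvec i)) (f * bvec j))"
        using i by (simp add: x_def y_def)
    qed
    finally show ?thesis .
  qed
  then have "matrix_predual c = (\<lambda>T. if T \<in> bounded_ops H ip then \<Sum>n. ip (T (x n)) (y n) else 0)"
    by (auto simp: matrix_predual_def fun_eq_iff)
  then show ?thesis unfolding B_predual_def using xH yH sx sy by blast
qed

definition norming_class :: "(nat \<times> nat \<Rightarrow> complex) \<Rightarrow> (complex ^ 'n \<Rightarrow> complex) \<Rightarrow> complex" where
  "norming_class c = predual_class H (matrix_predual c)"

lemma norming_class_in: "norming_class c \<in> M_predual H ip"
  unfolding norming_class_def M_predual_def using matrix_predual_in by blast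

lemma norming_class_apply: "g \<in> multipliers H \<Longrightarrow> norming_class c g = matrix_functional c (mult_op H g)"
  by (simp add: norming_class_def predual_class_def matrix_predual_def mult_op_bounded)

text \<open>\<open>matrix_predual c\<close> is one representative of the class, and the quotient
  norm is an infimum over all of them.\<close>

lemma norming_class_norm:
  assumes c: "c \<in> norming_matrices"
  shows "M_predual_norm H ip (norming_class c) \<le> 1"
proof -
  let ?S = "{functional_norm (op_norm H ip) (bounded_ops H ip) \<phi> | \<phi>. \<phi> \<in> B_predual H ip \<and> predual_class H \<phi> = norming_class c}"
  have bdd: "bdd_below ?S" by (rule bdd_belowI[of _ 0]) (auto intro: functional_norm_nonneg)
  have "Inf ?S \<le> functional_norm (op_norm H ip) (bounded_ops H ip) (matrix_predual c)"
    by (rule cInf_lower[OF _ bdd]) (use matrix_predual_in in \<open>auto simp: norming_class_def\<close>)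
  also have "\<dots> \<le> 1"
    unfolding functional_norm_def
  proof (rule cSup_least)
    have "mult_op H f \<in> bounded_ops H ip" "op_norm H ip (mult_op H f) \<le> 1"
      using mult_op_bounded[OF f_mult] mnorm_f by (simp_all add: mult_norm_def)
    then show "{cmod (matrix_predual c v) | v. v \<in> bounded_ops H ip \<and> op_norm H ip v \<le> 1} \<noteq> {}" by blast
    fix r assume "r \<in> {cmod (matrix_predual c v) | v. v \<in> bounded_ops H ip \<and> op_norm H ip v \<le> 1}"
    then obtain A where A: "r = cmod (matrix_predual c A)" "A \<in> bounded_ops H ip" "op_norm H ip A \<le> 1" by blast
    then have "r \<le> op_norm H ip A" using c by (simp add: matrix_predual_def norming_matrices_def)
    then show "r \<le> 1" using A(3) by linarith
  qed
  finally show ?thesis unfolding M_predual_norm_def .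
qed

section \<open>The face and its extreme points\<close>

definition face :: "((complex ^ 'n \<Rightarrow> complex) \<Rightarrow> complex) set" where
  "face = {\<Psi> \<in> M_predual H ip. A_dual_norm H ip \<Psi> = 1 \<and> \<Psi> f = 1}"

lemma faceI:
  assumes \<Psi>: "\<Psi> \<in> M_predual H ip" and n: "M_predual_norm H ip \<Psi> \<le> 1" and f: "\<Psi> f = 1"
  shows "\<Psi> \<in> face"
proof -
  have "A_dual_norm H ip \<Psi> \<le> 1"
    unfolding A_dual_norm_le_1_iff[OF \<Psi>] using predual_norm_bound[OF \<Psi> A_d_multipliers n] by blast
  moreover have "1 \<le> A_dual_norm H ip \<Psi>"
    using A_dual_norm_ge[OF \<Psi> f_A_d] by (simp add: mnorm_f f)
  ultimately show ?thesis using \<Psi> f by (simp add: face_def)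
qed

text \<open>For an element of the face, \<open>representation\<close> yields a matrix that is
  correct on A_d, and \<open>M_predual_eqI\<close> extends the equality to all multipliers. A bound
  over A_d thereby becomes a bound for the quotient norm, as recorded in
  \<open>face_subset_ball\<close>.\<close>

theorem face_eq: "face = norming_class ` norming_matrices"
proof
  show "norming_class ` norming_matrices \<subseteq> face"
  proof clarify
    fix c assume c: "c \<in> norming_matrices"
    show "norming_class c \<in> face"
      using c by (intro faceI norming_class_in norming_class_norm) (simp_all add: norming_class_apply[OF f_mult] norming_matrices_def)
  qed
  show "face \<subseteq> norming_class ` norming_matrices"
  proof
    fix \<Psi> assume "\<Psi> \<in> face"
    then have \<Psi>: "\<Psi> \<in> M_predual H ip" "A_dual_norm H ip \<Psi> \<le> 1" "\<Psi> f = 1" by (auto simp: face_def)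
    have le: "cmod (\<Psi> g) \<le> mnorm g" if "g \<in> A_d H ip" for g
      using \<Psi>(2) that unfolding A_dual_norm_le_1_iff[OF \<Psi>(1)] by blast
    obtain c where c: "c \<in> norming_matrices" "\<And>g. g \<in> A_d H ip \<Longrightarrow> \<Psi> g = matrix_functional c (mult_op H g)"
    proof (rule representation[of \<Psi>])
      show "\<Psi> (a + b) = \<Psi> a + \<Psi> b" if "a \<in> A_d H ip" "b \<in> A_d H ip" for a b
        by (rule predual_linear(1)[OF \<Psi>(1) A_d_multipliers[OF that(1)] A_d_multipliers[OF that(2)]])
      show "\<Psi> (k \<odot> a) = k * \<Psi> a" if "a \<in> A_d H ip" for k a
        by (rule predual_linear(2)[OF \<Psi>(1) A_d_multipliers[OF that] A_d_multipliers[OF that]])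
    qed (use le \<Psi>(3) in auto)
    have "\<Psi> = norming_class c"
      by (rule M_predual_eqI[OF \<Psi>(1) norming_class_in])
        (simp add: c(2)[OF polys_A_d] norming_class_apply[OF polys_multipliers])
    then show "\<Psi> \<in> norming_class ` norming_matrices" using c(1) by blast
  qed
qed

lemma face_subset_ball: "\<Psi> \<in> face \<Longrightarrow> \<Psi> \<in> M_predual H ip \<and> M_predual_norm H ip \<Psi> \<le> 1"
  unfolding face_eq using norming_class_in norming_class_norm by blast

text \<open>The set is a face of the ball: if a proper convex combination of two numbers of modulus
  at most 1 equals 1, both numbers are 1. Hence a segment in the ball through a point of the face
  has both its ends in the face, where \<Psi> is extreme.\<close>

lemma extreme_point_of_ball:
  assumes ext: "\<Psi> extreme_point_of face"
  shows "\<Psi> extreme_point_of {\<Phi> \<in> M_predual H ip. M_predual_norm H ip \<Phi> \<le> 1}"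
  unfolding extreme_point_of_def
proof (intro conjI ballI notI)
  have \<Psi>: "\<Psi> \<in> face" using ext by (simp add: extreme_point_of_def)
  then show "\<Psi> \<in> {\<Phi> \<in> M_predual H ip. M_predual_norm H ip \<Phi> \<le> 1}" using face_subset_ball by simp
  fix a b assume ab: "a \<in> {\<Phi> \<in> M_predual H ip. M_predual_norm H ip \<Phi> \<le> 1}" "b \<in> {\<Phi> \<in> M_predual H ip. M_predual_norm H ip \<Phi> \<le> 1}"
    and seg: "\<Psi> \<in> open_segment a b"
  obtain u where u: "0 < u" "u < 1" "\<Psi> = (1 - u) *\<^sub>R a + u *\<^sub>R b"
    using seg by (auto simp: in_segment)
  have fa: "cmod (a f) \<le> 1" and fb: "cmod (b f) \<le> 1"
    using ab predual_norm_bound[OF _ f_mult] by (auto simp: mnorm_f)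
  have "(1 - u) * Re (a f) + u * Re (b f) = 1"
  proof -
    have "Re (\<Psi> f) = 1" using \<Psi> by (simp add: face_def)
    then show ?thesis unfolding u(3) by simp
  qed
  note sum1 = this
  have ra: "Re (a f) \<le> 1" "Re (b f) \<le> 1"
    using order_trans[OF complex_Re_le_cmod fa] order_trans[OF complex_Re_le_cmod fb] .
  have le: "(1 - u) * Re (a f) \<le> (1 - u) * 1" "u * Re (b f) \<le> u * 1"
    using u ra by (auto intro!: mult_left_mono)
  have "p = (1 - u) * 1 \<and> q = u * 1" if "p + q = 1" "p \<le> (1 - u) * 1" "q \<le> u * 1" for p q
    using that by auto
  from this[OF sum1 le] have re: "Re (a f) = 1" "Re (b f) = 1" using u by auto
  have one: "z = 1" if "Re z = 1" "cmod z \<le> 1" for z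
  proof -
    have "(cmod z)\<^sup>2 \<le> 1" using that(2) by (simp add: power_le_one)
    then have "(Im z)\<^sup>2 \<le> 0" using that(1) by (simp add: cmod_power2)
    then show ?thesis using that(1) by (simp add: complex_eq_iff)
  qed
  have "a \<in> face" "b \<in> face" using ab one[OF re(1) fa] one[OF re(2) fb] by (auto intro: faceI)
  then show False using ext seg by (auto simp: extreme_point_of_def)
qed

text \<open>An extreme point is found by maximizing a strictly convex function over the face.\<close>

theorem face_has_extreme_point: "\<exists>\<Psi>. \<Psi> extreme_point_of face"
proof -
  \<comment> \<open>Multi-indices are countable, and \<open>from_nat\<close> reaches all of them,
    with \<open>m (to_nat \<alpha>) = monomial \<alpha>\<close>.\<close>
  define m where "m n = (monomial (from_nat n) :: complex ^ 'n \<Rightarrow> complex)" for n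
  have mp: "m n \<in> polys" for n unfolding m_def by (rule monomial_polys)
  have mm: "m n \<in> multipliers H" for n by (rule polys_multipliers[OF mp])
  have m1: "mnorm (m n) \<le> 1" for n
    unfolding m_def by (rule mnorm_le) (auto simp: nm_monomial_mult simp del: times_fun_apply)
  \<comment> \<open>The geometric weights make the series converge uniformly over the face, so that
    \<open>q\<close> is continuous in the matrix and attains its maximum.\<close>
  define q where "q \<Psi> = (\<Sum>n. (1 / 2) ^ n * (cmod (\<Psi> (m n)))\<^sup>2)" for \<Psi> :: "(complex ^ 'n \<Rightarrow> complex) \<Rightarrow> complex"
  have bound: "cmod (\<Psi> (m n)) \<le> 1" if "\<Psi> \<in> face" for \<Psi> n
    using predual_norm_bound[OF _ mm[of n], of \<Psi>] face_subset_ball[OF that] m1[of n] by auto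
  have geo: "summable (\<lambda>n. (1 / 2 :: real) ^ n * k)" for k
    by (intro summable_mult2 summable_geometric) simp
  have term_le: "(1 / 2) ^ n * (cmod (\<Psi> (m n)))\<^sup>2 \<le> (1 / 2) ^ n * 1" if "\<Psi> \<in> face" for \<Psi> n
    using bound[OF that, of n] by (intro mult_left_mono) (auto simp: power_le_one)
  have sm: "summable (\<lambda>n. (1 / 2) ^ n * (cmod (\<Psi> (m n)))\<^sup>2)" if "\<Psi> \<in> face" for \<Psi>
    by (rule summable_comparison_test'[OF geo[of 1], of 0]) (use term_le[OF that] in auto)
  have "continuous_on norming_matrices (\<lambda>c. q (norming_class c))"
  proof (rule uniform_limit_theorem)
    show "uniform_limit norming_matrices (\<lambda>N c. \<Sum>n<N. (1 / 2) ^ n * (cmod (norming_class c (m n)))\<^sup>2) (\<lambda>c. q (norming_class c)) sequentially"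
      unfolding q_def
      by (rule Weierstrass_m_test[OF _ geo[of 1]]) (use term_le face_eq in auto)
    show "\<forall>\<^sub>F N in sequentially. continuous_on norming_matrices (\<lambda>c. \<Sum>n<N. (1 / 2) ^ n * (cmod (norming_class c (m n)))\<^sup>2)"
      unfolding norming_class_apply[OF mm]
      by (intro always_eventually allI continuous_intros continuous_on_subset[OF continuous_matrix_functional]) auto
  qed simp
  moreover have "norming_matrices \<noteq> {}" using normers_nonempty vector_matrix_norming by blast
  ultimately obtain c0 where c0: "c0 \<in> norming_matrices" "\<And>c. c \<in> norming_matrices \<Longrightarrow> q (norming_class c) \<le> q (norming_class c0)"
    using continuous_attains_sup[OF compact_norming_matrices] by blast
  define \<Psi> where "\<Psi> = norming_class c0"
  have \<Psi>: "\<Psi> \<in> face" unfolding \<Psi>_def face_eq using c0(1) by blast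
  have max: "q \<Phi> \<le> q \<Psi>" if "\<Phi> \<in> face" for \<Phi> using that c0(2) unfolding face_eq \<Psi>_def by blast
  have "\<Psi> extreme_point_of face"
    unfolding extreme_point_of_def
  proof (intro conjI \<Psi> ballI notI)
    fix a b assume ab: "a \<in> face" "b \<in> face" and seg: "\<Psi> \<in> open_segment a b"
    then obtain u where u: "0 < u" "u < 1" "\<Psi> = (1 - u) *\<^sub>R a + u *\<^sub>R b" and neq: "a \<noteq> b"
      by (auto simp: in_segment)
    let ?d = "\<lambda>n. (1 / 2 :: real) ^ n * (cmod (a (m n) - b (m n)))\<^sup>2"
    \<comment> \<open>The exact convexity defect of the squared modulus. At a maximum of
      \<open>q\<close> the sum of the defects must vanish, so \<open>a\<close> and \<open>b\<close>
      agree on all monomials.\<close>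
    have strict: "(1 / 2) ^ n * (cmod (\<Psi> (m n)))\<^sup>2 = (1 - u) * ((1 / 2) ^ n * (cmod (a (m n)))\<^sup>2)
        + u * ((1 / 2) ^ n * (cmod (b (m n)))\<^sup>2) - u * (1 - u) * ?d n" for n
    proof -
      have "(cmod (\<Psi> (m n)))\<^sup>2 = (1 - u) * (cmod (a (m n)))\<^sup>2 + u * (cmod (b (m n)))\<^sup>2 - u * (1 - u) * (cmod (a (m n) - b (m n)))\<^sup>2"
        unfolding u(3) by (simp only: cmod_power2) (simp add: power2_eq_square algebra_simps)
      then show ?thesis by (simp only:) (simp add: algebra_simps)
    qed
    have sd: "summable ?d"
    proof (rule summable_comparison_test'[OF geo[of 4], of 0])
      fix n
      have "cmod (a (m n) - b (m n)) \<le> 2" using norm_triangle_ineq4[of "a (m n)" "b (m n)"] bound[OF ab(1), of n] bound[OF ab(2), of n] by linarith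
      then have "(cmod (a (m n) - b (m n)))\<^sup>2 \<le> 2\<^sup>2" by (intro power_mono) auto
      then show "norm (?d n) \<le> (1 / 2) ^ n * 4" by (simp add: mult_left_mono)
    qed
    have "q \<Psi> = (1 - u) * q a + u * q b - u * (1 - u) * suminf ?d"
      unfolding q_def strict
      by (simp only: suminf_diff[symmetric] suminf_add[symmetric] suminf_mult[symmetric] summable_add summable_mult sm ab sd)
    moreover have "(1 - u) * q a \<le> (1 - u) * q \<Psi>" "u * q b \<le> u * q \<Psi>"
      using max[OF ab(1)] max[OF ab(2)] u by (auto intro!: mult_left_mono)
    ultimately have "u * (1 - u) * suminf ?d \<le> 0" by (simp add: algebra_simps)
    then have "suminf ?d \<le> 0" using u by (simp add: mult_le_0_iff)
    moreover have "suminf ?d \<ge> 0" by (intro suminf_nonneg sd) auto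
    ultimately have "suminf ?d = 0" by linarith
    then have "?d n = 0" for n using suminf_eq_zero_iff[OF sd] by simp
    then have eqm: "a (m n) = b (m n)" for n by simp
    \<comment> \<open>Strictness of the convexity: agreement on the monomials passes to polynomials
      by linearity and from there to the whole predual element by density.\<close>
    have "a = b"
    proof (rule M_predual_eqI)
      show aM: "a \<in> M_predual H ip" and bM: "b \<in> M_predual H ip" using ab by (auto simp: face_def)
      have mono: "a (monomial \<alpha>) = b (monomial \<alpha>)" for \<alpha> :: "'n mindex"
        using eqm[of "to_nat \<alpha>"] by (simp add: m_def)
      have mM: "monomial \<alpha> \<in> multipliers H" for \<alpha> by (rule polys_multipliers[OF monomial_polys])
      fix p assume "p \<in> polys"
      then obtain A k where p: "p = (\<Sum>\<alpha>\<in>A. k \<alpha> \<odot> monomial \<alpha>)" and A: "finite A" unfolding polys_def by blast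
      show "a p = b p"
        unfolding p using A
      proof (induction A rule: finite_induct)
        case empty
        have "a 0 = 0" "b 0 = 0"
          using predual_linear(2)[OF aM mM mM, of 0 0] predual_linear(2)[OF bM mM mM, of 0 0] by simp_all
        then show ?case unfolding sum.empty by (simp only:)
      next
        case (insert x F)
        have F: "(\<Sum>\<alpha>\<in>F. k \<alpha> \<odot> monomial \<alpha>) \<in> multipliers H"
          using insert(1) by (intro polys_multipliers) (auto simp: polys_def)
        show ?case
          unfolding sum.insert[OF insert(1,2)] predual_linear(1)[OF aM multipliers_smul[OF mM] F]
            predual_linear(1)[OF bM multipliers_smul[OF mM] F] predual_linear(2)[OF aM mM mM] predual_linear(2)[OF bM mM mM]
            mono insert(3) ..
      qed
    qed
    then show False using neq by simp
  qed
  then show ?thesis by blast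
qed

end

theorem theorem7p5:
  fixes H :: "(complex ^ 'n \<Rightarrow> complex) set"
    and ip :: "(complex ^ 'n \<Rightarrow> complex) \<Rightarrow> (complex ^ 'n \<Rightarrow> complex) \<Rightarrow> complex"
    and f :: "complex ^ 'n \<Rightarrow> complex"
  assumes "drury_arveson H ip"
    and "f \<in> A_d H ip"
    and "sup_norm f < mult_norm H ip f"
    and "mult_norm H ip f = 1"
  defines "F \<equiv> {\<Psi> \<in> M_predual H ip. A_dual_norm H ip \<Psi> = 1 \<and> \<Psi> f = 1}"
  shows "(\<exists>\<Psi>. \<Psi> extreme_point_of F) \<and>
         (\<forall>\<Psi>. \<Psi> extreme_point_of F \<longrightarrow>
              \<Psi> extreme_point_of {\<Phi> \<in> M_predual H ip. M_predual_norm H ip \<Phi> \<le> 1})"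
proof -
  interpret norming_function H ip f
    using assms by unfold_locales auto
  have F: "F = face" unfolding F_def face_def ..
  show ?thesis unfolding F using face_has_extreme_point extreme_point_of_ball by blast
qed

end
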